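(* Let $\delta_{opt}(\Gamma)$ denote the optimal horoball packing density of the Coxeter simplex tiling $\mathcal{T}_\Gamma$ of hyperbolic $3$-space. For every $\Gamma\in\{\overline{HV}_3,\overline{HP}_3\}$, $$\delta_{opt}(\Gamma)\approx 0.550841.$$
   Context: $\mathbb{H}^3$ is hyperbolic $3$-space of curvature $-1$ and $\overline{\mathbb{H}}^3=\mathbb{H}^3\cup\partial\mathbb{H}^3$. A Coxeter simplex in $\overline{\mathbb{H}}^3$ is a tetrahedron, possibly with ideal vertices (on $\partial\mathbb{H}^3$), of finite volume, whose dihedral angles are integer submultiples of $\pi$. It is determined up to isometry by its Coxeter diagram: one node per facet; two facets orthogonal if the nodes are not joined, dihedral angle $\pi/3$ if joined by an unlabeled edge (label 3), and dihedral angle $\pi/k$ if joined by an edge labeled $k$. $\Gamma$ is the discrete group generated by reflections in the facets, $\mathcal{F}_\Gamma$ is the simplex (a fundamental domain), and $\mathcal{T}_\Gamma$ is the tiling by the images of $\mathcal{F}_\Gamma$ under $\Gamma$. Diagrams of the groups (four nodes each): - $\overline{HV}_3=[5,3,6]$: path with consecutive edge labels $5,3,6$. - $\overline{HP}_3=[5,3^{[3]}]$: a triangle with all edges labeled $3$, with one further node joined to exactly one triangle node by an edge labeled $5$. Horoball packing associated to $\mathcal{T}_\Gamma$: let $v_1,\dots,v_m$ be the ideal vertices of $\mathcal{F}_\Gamma$. It is a $\Gamma$-invariant collection $\mathcal{B}$ of horoballs which restricts on $\mathcal{F}_\Gamma$ to a set $\{B_1,\dots,B_m\}$ such that (1) $B_i$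 is centered at $v_i$; (2) horoballs have pairwise disjoint interiors; (3) each $B_i$ is contained in the half-space (containing $\mathcal{F}_\Gamma$) bounded by the plane of the facet of $\mathcal{F}_\Gamma$ opposite $v_i$. Its density is $$\delta(\mathcal{B})=\frac{\sum_{i=1}^m \mathrm{vol}_{\mathbb{H}^3}(B_i\cap\mathcal{F}_\Gamma)}{\mathrm{vol}_{\mathbb{H}^3}(\mathcal{F}_\Gamma)},$$ and $\delta_{opt}(\Gamma)$ is the supremum of $\delta(\mathcal{B})$ over all such packings. Convention: $x\approx d$ means that the decimal $d$ approximates $x$ with error less than $10^{-6}$. *)

theory Defs
  imports "HOL-Analysis.Analysis"
begin

text \<open>
  Hyperbolic 3-space is the upper sheet of the hyperboloid in Minkowski space
  \<open>\<real> \<times> \<real>\<^sup>3\<close>, the first component being the time coordinate.  Points of the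
  sphere at infinity are represented by future-directed lightlike vectors, two
  such vectors giving the same point iff they are positive multiples of each other.
\<close>

type_synonym mvec = "real \<times> (real^3)"

definition mink :: "mvec \<Rightarrow> mvec \<Rightarrow> real" where
  "mink x y = snd x \<bullet> snd y - fst x * fst y"

definition hyp3 :: "mvec set" where
  "hyp3 = {x. mink x x = -1 \<and> fst x > 0}"

definition future_cone :: "mvec set" where
  "future_cone = {x. mink x x = 0 \<and> fst x > 0}"

definition hyp_interior :: "mvec set \<Rightarrow> mvec set" where
  "hyp_interior S = (top_of_set hyp3) interior_of S"

text \<open>
  In the chart \<open>y \<mapsto> (sqrt (1 + |y|\<^sup>2), y)\<close> of the hyperboloid, the metric induced by
  \<open>mink\<close> has Gram matrix \<open>I - y y\<^sup>T / (1 + |y|\<^sup>2)\<close>, of determinant \<open>1 / (1 + |y|\<^sup>2)\<close>.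
\<close>

definition hyp_lift :: "real^3 \<Rightarrow> mvec" where
  "hyp_lift y = (sqrt (1 + (norm y)\<^sup>2), y)"

definition hyp_measure :: "mvec measure" where
  "hyp_measure = distr (density lborel (\<lambda>y. ennreal (1 / sqrt (1 + (norm y)\<^sup>2)))) borel hyp_lift"

definition hyp_vol :: "mvec set \<Rightarrow> real" where
  "hyp_vol S = measure hyp_measure S"

text \<open>
  The horoballs centered at the ideal point of \<open>l\<close> are the sublevel sets of the
  Busemann function \<open>x \<mapsto> ln (- mink x l)\<close>; they are taken to be closed.
\<close>

definition horoball_at :: "mvec \<Rightarrow> mvec set \<Rightarrow> bool" where
  "horoball_at l H \<longleftrightarrow> l \<in> future_cone \<and> (\<exists>c>0. H = {x \<in> hyp3. - mink x l \<le> c})"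

definition horoball :: "mvec set \<Rightarrow> bool" where
  "horoball H \<longleftrightarrow> (\<exists>l. horoball_at l H)"

text \<open>
  A tetrahedron is given by its vertices, ordinary (in \<open>hyp3\<close>) or ideal (in
  \<open>future_cone\<close>).  Facet \<open>i\<close> is the one opposite vertex \<open>i\<close>.
\<close>

definition tetrahedron :: "(4 \<Rightarrow> mvec) \<Rightarrow> bool" where
  "tetrahedron v \<longleftrightarrow> range v \<subseteq> hyp3 \<union> future_cone \<and> inj v \<and> independent (range v)"

definition solid :: "(4 \<Rightarrow> mvec) \<Rightarrow> mvec set" where
  "solid v = {x \<in> hyp3. \<exists>c. (\<forall>i. c i \<ge> 0) \<and> x = (\<Sum>i\<in>UNIV. c i *\<^sub>R v i)}"

definition ideal_vertices :: "(4 \<Rightarrow> mvec) \<Rightarrow> 4 set" where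
  "ideal_vertices v = {i. v i \<in> future_cone}"

definition outward_normal :: "(4 \<Rightarrow> mvec) \<Rightarrow> 4 \<Rightarrow> mvec" where
  "outward_normal v i =
     (THE u. mink u u = 1 \<and> (\<forall>j. j \<noteq> i \<longrightarrow> mink u (v j) = 0) \<and> mink u (v i) < 0)"

definition facet_halfspace :: "(4 \<Rightarrow> mvec) \<Rightarrow> 4 \<Rightarrow> mvec set" where
  "facet_halfspace v i = {x \<in> hyp3. mink x (outward_normal v i) \<le> 0}"

text \<open>The interior angle is \<open>\<pi>\<close> minus the angle between the outward normals.\<close>

definition dihedral_angle :: "(4 \<Rightarrow> mvec) \<Rightarrow> 4 \<Rightarrow> 4 \<Rightarrow> real" where
  "dihedral_angle v i j = pi - arccos (mink (outward_normal v i) (outward_normal v j))"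

text \<open>
  A diagram is encoded by the labels of pairs of distinct nodes, with label 2 for
  nodes that are not joined.  The diagonal entries are irrelevant.
\<close>

type_synonym diagram = "4 \<Rightarrow> 4 \<Rightarrow> nat"

definition HV3 :: diagram where
  "HV3 i j = (if {i, j} = {1, 2} then 5 else if {i, j} = {2, 3} then 3
              else if {i, j} = {3, 4} then 6 else 2)"

definition HP3 :: diagram where
  "HP3 i j = (if {i, j} = {1, 2} then 5
              else if {i, j} = {2, 3} \<or> {i, j} = {3, 4} \<or> {i, j} = {2, 4} then 3 else 2)"

definition coxeter_simplex :: "diagram \<Rightarrow> (4 \<Rightarrow> mvec) \<Rightarrow> bool" where
  "coxeter_simplex M v \<longleftrightarrow>
     tetrahedron v \<and> (\<forall>i j. i \<noteq> j \<longrightarrow> dihedral_angle v i j = pi / real (M i j))"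

definition reflection :: "mvec \<Rightarrow> mvec \<Rightarrow> mvec" where
  "reflection u x = x - (2 * mink x u) *\<^sub>R u"

text \<open>
  The group generated by the facet reflections; closing under inverses is not
  needed because the generators are involutions.
\<close>

inductive_set refl_group :: "(4 \<Rightarrow> mvec) \<Rightarrow> (mvec \<Rightarrow> mvec) set" for v where
  id: "id \<in> refl_group v"
| step: "g \<in> refl_group v \<Longrightarrow> reflection (outward_normal v i) \<circ> g \<in> refl_group v"

text \<open>
  \<open>\<B>\<close> is the whole collection of horoballs, and \<open>B i\<close>, for \<open>i\<close> an ideal vertex, are
  the members it restricts to on the simplex, i.e. those meeting the interior of
  the simplex.  (A closed horoball tangent to a facet from outside meets the
  simplex, but not its interior.)
\<close>

definition horoball_packing ::
  "(4 \<Rightarrow> mvec) \<Rightarrow> mvec set set \<Rightarrow> (4 \<Rightarrow> mvec set) \<Rightarrow> bool" where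
  "horoball_packing v \<B> B \<longleftrightarrow>
     (\<forall>H\<in>\<B>. horoball H) \<and>
     (\<forall>g\<in>refl_group v. \<forall>H\<in>\<B>. g ` H \<in> \<B>) \<and>
     {H \<in> \<B>. H \<inter> hyp_interior (solid v) \<noteq> {}} = B ` ideal_vertices v \<and>
     (\<forall>i\<in>ideal_vertices v. horoball_at (v i) (B i)) \<and>
     (\<forall>H\<in>\<B>. \<forall>H'\<in>\<B>. H \<noteq> H' \<longrightarrow> hyp_interior H \<inter> hyp_interior H' = {}) \<and>
     (\<forall>i\<in>ideal_vertices v. B i \<subseteq> facet_halfspace v i)"

definition packing_density :: "(4 \<Rightarrow> mvec) \<Rightarrow> (4 \<Rightarrow> mvec set) \<Rightarrow> real" where
  "packing_density v B = (\<Sum>i\<in>ideal_vertices v. hyp_vol (B i \<inter> solid v)) / hyp_vol (solid v)"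

definition delta_opt :: "(4 \<Rightarrow> mvec) \<Rightarrow> real" where
  "delta_opt v = Sup {packing_density v B | \<B> B. horoball_packing v \<B> B}"

text \<open>Both diagrams are realized, the ideal vertex being the one opposite facet 1.\<close>

lemma mink_add_left: "mink (x + y) z = mink x z + mink y z"
  by (simp add: mink_def algebra_simps)

lemma mink_scale_left: "mink (c *\<^sub>R x) z = c * mink x z"
  by (simp add: mink_def algebra_simps)

lemma mink_commute: "mink x y = mink y x"
  by (simp add: mink_def inner_commute mult.commute)

lemma mink_sum_left: "mink (\<Sum>i\<in>A. f i) z = (\<Sum>i\<in>A. mink (f i) z)"
  by (simp add: mink_def fst_sum snd_sum inner_sum_left sum_distrib_right sum_subtractf)

lemma mink_nondegenerate:
  assumes "\<And>z. mink x z = 0"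
  shows "x = 0"
proof -
  have "mink x (- fst x, snd x) = 0" by (rule assms)
  then have "snd x \<bullet> snd x + fst x * fst x = 0" by (simp add: mink_def)
  then have "snd x \<bullet> snd x = 0 \<and> fst x * fst x = 0"
    by (metis add_nonneg_eq_0_iff inner_ge_zero zero_le_square)
  then show ?thesis by (simp add: prod_eq_iff)
qed

lemma dual_basis_independent:
  fixes u v :: "4 \<Rightarrow> mvec"
  assumes "\<And>i j. j \<noteq> i \<Longrightarrow> mink (u i) (v j) = 0" "\<And>i. mink (u i) (v i) < 0"
  shows "inj v" "independent (range v)"
proof -
  show inj: "inj v"
    by (metis assms injI less_irrefl)
  show "independent (range v)"
    unfolding independent_explicit
  proof (intro conjI allI impI ballI)
    fix c y assume 0: "(\<Sum>w\<in>range v. c w *\<^sub>R w) = 0" and "y \<in> range v"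
    then obtain i where i: "y = v i" by auto
    have "0 = mink (\<Sum>w\<in>range v. c w *\<^sub>R w) (u i)"
      unfolding 0 by (simp add: mink_def)
    also have "\<dots> = (\<Sum>j\<in>UNIV. c (v j) * mink (u i) (v j))"
      by (simp add: mink_sum_left mink_scale_left sum.reindex[OF inj] mink_commute[of "v _" "u i"])
    also have "\<dots> = (\<Sum>j\<in>UNIV. if j = i then c (v i) * mink (u i) (v i) else 0)"
      by (intro sum.cong) (auto simp: assms)
    finally show "c y = 0" using assms(2)[of i] i by simp
  qed simp
qed

lemma outward_normal_eqI:
  assumes "tetrahedron v" "mink u u = 1" "\<And>j. j \<noteq> i \<Longrightarrow> mink u (v j) = 0" "mink u (v i) < 0"
  shows "outward_normal v i = u"
  unfolding outward_normal_def
proof (rule the_equality)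
  fix w assume w: "mink w w = 1 \<and> (\<forall>j. j \<noteq> i \<longrightarrow> mink w (v j) = 0) \<and> mink w (v i) < 0"
  define c where "c = mink w (v i) / mink u (v i)"
  have "c > 0" using w assms(4) by (simp add: c_def divide_neg_neg)
  define d where "d = w + (- c) *\<^sub>R u"
  have dm: "mink d z = mink w z - c * mink u z" for z
    unfolding d_def mink_add_left mink_scale_left by simp
  have d: "mink d (v j) = 0" for j
    using w assms(3,4) by (cases "j = i") (auto simp: dm c_def)
  have "card (range v) = DIM(mvec)"
    using assms(1) by (simp add: tetrahedron_def card_image)
  then have span: "span (range v) = UNIV"
    using assms(1) card_eq_dim[of "range v" UNIV]
    by (auto simp: tetrahedron_def dim_UNIV)
  have "mink d z = 0" for z
  proof -
    have "z \<in> span (range v)" using span by simp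
    then have "mink z d = 0"
    proof (induction rule: span_induct_alt)
      case base
      show ?case by (simp add: mink_def)
    next
      case (step k x y)
      then show ?case by (auto simp: mink_add_left mink_scale_left d mink_commute[of "v _" d])
    qed
    then show ?thesis by (simp add: mink_commute)
  qed
  then have "d = 0" by (rule mink_nondegenerate)
  then have wc: "w = c *\<^sub>R u" by (simp add: d_def)
  then have "c * c = 1"
    using w assms(2) by (metis mink_commute mink_scale_left mult.right_neutral)
  then have "c = 1" using \<open>c > 0\<close> by (auto simp: square_eq_1_iff)
  then show "w = u" using wc by simp
qed (use assms in auto)

lemma coxeter_simplexI:
  fixes u v :: "4 \<Rightarrow> mvec"
  assumes "range v \<subseteq> hyp3 \<union> future_cone"
    and "\<And>i j. j \<noteq> i \<Longrightarrow> mink (u i) (v j) = 0" "\<And>i. mink (u i) (v i) < 0"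
    and "\<And>i. mink (u i) (u i) = 1"
    and "\<And>i j. i \<noteq> j \<Longrightarrow> mink (u i) (u j) = - cos (pi / real (M i j))"
    and "\<And>i j. M i j > 0"
  shows "coxeter_simplex M v"
proof -
  have t: "tetrahedron v"
    using assms dual_basis_independent[of u v] by (auto simp: tetrahedron_def)
  have n: "outward_normal v i = u i" for i
    by (rule outward_normal_eqI[OF t]) (use assms in auto)
  have "dihedral_angle v i j = pi / real (M i j)" if "i \<noteq> j" for i j
  proof -
    have "pi / real (M i j) \<le> pi / 1"
      using assms(6)[of i j] by (intro divide_left_mono) auto
    then have "arccos (- cos (pi / real (M i j))) = pi - pi / real (M i j)"
      using arccos_cos[of "pi / real (M i j)"] by (subst arccos_minus) auto
    then show ?thesis using assms(5)[OF that] by (simp add: dihedral_angle_def n)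
  qed
  then show ?thesis using t by (simp add: coxeter_simplex_def)
qed

context
begin

private definition "c5 = cos (pi / 5)"

private lemma c5: "c5 > 0" "1 - 4 * c5\<^sup>2 / 3 > 0" "1 - c5\<^sup>2 > 0"
proof -
  have p: "cos (pi / 5) > 0" by (rule cos_gt_zero) auto
  have "cos (pi / 5) < cos (pi / 6)" by (rule cos_monotone_0_pi) auto
  then have "(cos (pi / 5))\<^sup>2 < (cos (pi / 6))\<^sup>2" using p by (intro power_strict_mono) auto
  then have "c5\<^sup>2 < 3 / 4" by (simp add: c5_def cos_30 power_divide)
  then show "1 - 4 * c5\<^sup>2 / 3 > 0" "1 - c5\<^sup>2 > 0" by auto
  show "c5 > 0" using p by (simp add: c5_def)
qed

private definition pt :: "real \<Rightarrow> real \<Rightarrow> mvec" where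
  "pt x y = (1 / sqrt (1 - x\<^sup>2 - y\<^sup>2)) *\<^sub>R (1, vector [x, y, 0])"

private lemma pt_hyp3: "1 - x\<^sup>2 - y\<^sup>2 > 0 \<Longrightarrow> pt x y \<in> hyp3"
  by (simp add: pt_def hyp3_def mink_def inner_vec_def sum_3 power2_eq_square
      divide_simps real_sqrt_mult_self)

private lemma mink_pt: "mink (a, w) (pt x y) = (1 / sqrt (1 - x\<^sup>2 - y\<^sup>2)) * (w$1 * x + w$2 * y - a)"
  by (simp add: pt_def mink_def inner_vec_def sum_3 algebra_simps divide_simps)

private lemma sqrt3: "sqrt 3 * (sqrt 3 * x) = 3 * x" "sqrt 3 * sqrt 3 = 3"
  by (simp_all flip: mult.assoc)

private definition vv :: "real \<Rightarrow> 4 \<Rightarrow> mvec" where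
  "vv y i = (if i = 1 then (1, vector [0, 0, 1]) else if i = 2 then pt 0 0
             else if i = 3 then pt c5 y else pt c5 (c5 / sqrt 3))"

private definition uu :: "real \<Rightarrow> real \<Rightarrow> 4 \<Rightarrow> mvec" where
  "uu a b i = (if i = 1 then (0, vector [0, 0, -1]) else if i = 2 then (c5, vector [1, 0, c5])
             else if i = 3 then (0, vector [- 1 / 2, sqrt 3 / 2, 0]) else (0, vector [a, b, 0]))"

private lemma mink_top: "mink (a, w) (1, vector [0, 0, 1]) = w $ 3 - a"
  by (simp add: mink_def inner_vec_def sum_3)

private lemma vv_range:
  assumes "y\<^sup>2 \<le> c5\<^sup>2 / 3"
  shows "range (vv y) \<subseteq> hyp3 \<union> future_cone"
proof -
  have "(1, vector [0, 0, 1]) \<in> future_cone"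
    by (simp add: future_cone_def mink_def inner_vec_def sum_3)
  moreover have "pt 0 0 \<in> hyp3" "pt c5 y \<in> hyp3" "pt c5 (c5 / sqrt 3) \<in> hyp3"
    using c5 assms by (auto intro!: pt_hyp3 simp: power_divide)
  ultimately show ?thesis by (auto simp: vv_def)
qed

private lemma radius:
  "1 - c5\<^sup>2 > 0" "1 - c5\<^sup>2 - c5\<^sup>2 / 3 > 0"
  using c5 by auto

lemma exists_HV3: "\<exists>v. coxeter_simplex HV3 v"
proof
  have 1: "\<forall>i j. j \<noteq> i \<longrightarrow> mink (uu 0 (-1) i) (vv 0 j) = 0"
    using radius c5(1)
    by (simp add: forall_4 uu_def mink_top mink_pt vv_def)
  have 2: "\<forall>i. mink (uu 0 (-1) i) (vv 0 i) < 0"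
    using radius c5(1)
    by (simp add: forall_4 uu_def mink_top mink_pt vv_def power_divide zero_less_mult_iff
      zero_less_divide_iff)
  have 3: "\<forall>i. mink (uu 0 (-1) i) (uu 0 (-1) i) = 1"
    by (simp add: forall_4 uu_def mink_def inner_vec_def sum_3 sqrt3 power2_eq_square)
  have 4: "\<forall>i j. i \<noteq> j \<longrightarrow> mink (uu 0 (-1) i) (uu 0 (-1) j) = - cos (pi / real (HV3 i j))"
    by (simp add: forall_4 uu_def HV3_def mink_def inner_vec_def sum_3 doubleton_eq_iff
      cos_30 cos_60 c5_def)
  show "coxeter_simplex HV3 (vv 0)"
    by (rule coxeter_simplexI[of _ "uu 0 (-1)"])
      (use 1 2 3 4 vv_range[of 0] in \<open>auto simp: HV3_def\<close>)
qed

lemma exists_HP3: "\<exists>v. coxeter_simplex HP3 v"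
proof
  let ?y = "- (c5 / sqrt 3)" and ?u = "uu (- 1 / 2) (- sqrt 3 / 2)"
  have 1: "\<forall>i j. j \<noteq> i \<longrightarrow> mink (?u i) (vv ?y j) = 0"
    using radius c5(1)
    by (simp add: forall_4 uu_def mink_top mink_pt vv_def)
  have 2: "\<forall>i. mink (?u i) (vv ?y i) < 0"
    using radius c5(1)
    by (simp add: forall_4 uu_def mink_top mink_pt vv_def power_divide zero_less_mult_iff
      zero_less_divide_iff)
  have 3: "\<forall>i. mink (?u i) (?u i) = 1"
    by (simp add: forall_4 uu_def mink_def inner_vec_def sum_3 sqrt3 power2_eq_square)
  have 4: "\<forall>i j. i \<noteq> j \<longrightarrow> mink (?u i) (?u j) = - cos (pi / real (HP3 i j))"
    by (simp add: forall_4 uu_def HP3_def mink_def inner_vec_def sum_3 doubleton_eq_iff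
      cos_30 cos_60 c5_def)
  show "coxeter_simplex HP3 (vv ?y)"
    by (rule coxeter_simplexI[of _ ?u])
      (use 1 2 3 4 vv_range[of ?y] in \<open>auto simp: HP3_def power_divide\<close>)
qed

end

end

theory Submission imports Defs begin

text \<open>
  Cones over hyperbolic sets turn hyperbolic volume into Lebesgue measure on Minkowski space, which linear
  bijections only rescale.  In null coordinates at the single ideal vertex, the cones over the simplex and
  over its maximal horoball sector become explicit regions, and the ratio of their volumes is \<open>1 / S\<close> with
  \<open>S = (\<Sum>n. a ^ n * m\<^sub>n / (n + 1))\<close>, where \<open>a = (cos (\<pi> / 5))\<^sup>2\<close> and \<open>m\<^sub>n\<close> is the integral of
  \<open>(1 + s\<^sup>2 / 3) ^ n\<close> over the unit interval.  For \<open>HP3\<close> both volumes double, so the density is the same.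

  Condition (3) bounds the horoball by the one tangent to the opposite facet, and the density is monotone
  in the horoball.  The tangent horoball does generate a packing: by Tits' lemma on reduced words, an orbit
  element of the ideal vertex \<open>l\<close> other than \<open>l\<close> is \<open>l\<close> plus a nonnegative combination of the outward normals
  whose coefficient at facet 1 is at least that of the first reflection, and this keeps horoballs disjoint.
\<close>

section \<open>Lebesgue measure under linear bijections\<close>

text \<open>Both cones belong to one family, cut out of the same wedge by inequalities with
  parameters \<open>a\<close> and \<open>b\<close>. Slicing along the null coordinate
  \<open>q\<close> leaves a length that depends on \<open>a - b\<close> only. For the horoball
  \<open>a - b = 0\<close>, so its series collapses to 1, while the simplex has
  \<open>b = 0\<close>. The Jacobian of the coordinate change is a common factor of both volumes, so
  its value never enters. The bound \<open>a < 3 / 4\<close> does double duty: it makes the series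
  converge, since \<open>1 + s\<^sup>2 / 3\<close> reaches 4/3, and it keeps the vertices on the
  facet opposite the ideal vertex inside hyperbolic space. For the packing, the obstacle is the
  infinite orbit of the ideal vertex. Everything about it is read off from signs of products with
  the normals: pairing with \<open>l\<close> isolates the coefficient at facet 1, and the lower
  bound that the first reflection gives for it is exactly what tangency of two horoballs
  requires.\<close>

definition basis_map :: "('a::euclidean_space \<Rightarrow> 'b::euclidean_space) \<Rightarrow> 'a \<Rightarrow> 'b" where
  "basis_map \<phi> x = (\<Sum>b\<in>Basis. (x \<bullet> b) *\<^sub>R \<phi> b)"

lemma linear_basis_map: "linear (basis_map \<phi>)"
  by (rule linearI) (simp_all add: basis_map_def inner_add_left scaleR_add_left sum.distrib scaleR_sum_right)

lemma inner_basis_map: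
  fixes \<phi> :: "'a::euclidean_space \<Rightarrow> 'b::euclidean_space"
  assumes "bij_betw \<phi> Basis Basis" "b \<in> Basis"
  shows "basis_map \<phi> x \<bullet> \<phi> b = x \<bullet> b"
proof -
  have "\<phi> c \<bullet> \<phi> b = (if c = b then 1 else 0)" if "c \<in> Basis" for c
    using assms that by (metis bij_betw_iff_bijections inner_Basis)
  then have "basis_map \<phi> x \<bullet> \<phi> b = (\<Sum>c\<in>Basis. if c = b then x \<bullet> b else 0)"
    unfolding basis_map_def inner_sum_left by (intro sum.cong) auto
  then show ?thesis using assms(2) by simp
qed

lemma bij_basis_map:
  fixes \<phi> :: "'a::euclidean_space \<Rightarrow> 'b::euclidean_space"
  assumes "bij_betw \<phi> Basis Basis"
  shows "bij (basis_map \<phi>)"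
proof (rule o_bij)
  show "basis_map (inv_into Basis \<phi>) \<circ> basis_map \<phi> = id"
  proof (rule ext, rule euclidean_eqI)
    fix x :: 'a and b :: 'a assume b: "b \<in> Basis"
    have "inv_into Basis \<phi> (\<phi> b) = b" "\<phi> b \<in> Basis"
      using bij_betw_inv_into_left[OF assms b] bij_betwE[OF assms] b by blast+
    then show "(basis_map (inv_into Basis \<phi>) \<circ> basis_map \<phi>) x \<bullet> b = id x \<bullet> b"
      using inner_basis_map[OF bij_betw_inv_into[OF assms], of "\<phi> b" "basis_map \<phi> x"]
        inner_basis_map[OF assms b, of x] by (metis comp_apply id_apply)
  qed
  show "basis_map \<phi> \<circ> basis_map (inv_into Basis \<phi>) = id"
  proof (rule ext, rule euclidean_eqI)
    fix x :: 'b and b :: 'b assume b: "b \<in> Basis"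
    have "\<phi> (inv_into Basis \<phi> b) = b" "inv_into Basis \<phi> b \<in> Basis"
      using bij_betw_inv_into_right[OF assms b] bij_betwE[OF bij_betw_inv_into[OF assms]] b by blast+
    then show "(basis_map \<phi> \<circ> basis_map (inv_into Basis \<phi>)) x \<bullet> b = id x \<bullet> b"
      using inner_basis_map[OF assms, of "inv_into Basis \<phi> b" "basis_map (inv_into Basis \<phi>) x"]
        inner_basis_map[OF bij_betw_inv_into[OF assms] b, of x] by (metis comp_apply id_apply)
  qed
qed

lemma borel_measurable_linear:
  fixes f :: "'a::euclidean_space \<Rightarrow> 'b::euclidean_space"
  shows "linear f \<Longrightarrow> f \<in> borel_measurable borel"
  by (intro borel_measurable_continuous_onI linear_continuous_on) (simp add: linear_conv_bounded_linear)

text \<open>Coordinates are only relabelled, so a box pulls back to a box with the same side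
  lengths, and boxes determine \<open>lborel\<close>.\<close>

lemma lborel_distr_basis_map:
  fixes \<phi> :: "'a::euclidean_space \<Rightarrow> 'b::euclidean_space"
  assumes "bij_betw \<phi> Basis Basis"
  shows "distr lborel borel (basis_map \<phi>) = lborel"
proof (rule lborel_eqI[symmetric])
  note [measurable] = borel_measurable_linear[OF linear_basis_map[of \<phi>]]
  have im: "Basis = \<phi> ` Basis" using assms(1) by (auto simp: bij_betw_def)
  fix l u :: 'b assume le: "\<And>b. b \<in> Basis \<Longrightarrow> l \<bullet> b \<le> u \<bullet> b"
  define l' where "l' = (\<Sum>b\<in>Basis. (l \<bullet> \<phi> b) *\<^sub>R b)"
  define u' where "u' = (\<Sum>b\<in>Basis. (u \<bullet> \<phi> b) *\<^sub>R b)"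
  have l': "l' \<bullet> b = l \<bullet> \<phi> b" "u' \<bullet> b = u \<bullet> \<phi> b" if "b \<in> Basis" for b
    using that by (simp_all add: l'_def u'_def)
  have "basis_map \<phi> -` box l u = box l' u'"
  proof (intro set_eqI)
    fix x
    have "(\<forall>i\<in>Basis. l \<bullet> i < basis_map \<phi> x \<bullet> i \<and> basis_map \<phi> x \<bullet> i < u \<bullet> i) \<longleftrightarrow>
        (\<forall>b\<in>Basis. l \<bullet> \<phi> b < basis_map \<phi> x \<bullet> \<phi> b \<and> basis_map \<phi> x \<bullet> \<phi> b < u \<bullet> \<phi> b)"
      unfolding im by blast
    then show "x \<in> basis_map \<phi> -` box l u \<longleftrightarrow> x \<in> box l' u'"
      by (simp add: mem_box inner_basis_map[OF assms] l')
  qed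
  then have "emeasure (distr lborel borel (basis_map \<phi>)) (box l u) = emeasure lborel (box l' u')"
    by (subst emeasure_distr) auto
  also have "\<dots> = (\<Prod>b\<in>Basis. (u' - l') \<bullet> b)"
    using l' le bij_betwE[OF assms] by (intro emeasure_lborel_box) simp
  also have "\<dots> = (\<Prod>b\<in>Basis. (u - l) \<bullet> \<phi> b)"
    by (simp add: inner_diff_left l')
  also have "\<dots> = (\<Prod>b\<in>Basis. (u - l) \<bullet> b)"
    by (subst prod.reindex_bij_betw[OF assms(1)]) simp
  finally show "emeasure (distr lborel borel (basis_map \<phi>)) (box l u) = (\<Prod>b\<in>Basis. (u - l) \<bullet> b)" .
qed simp

lemma obtain_lborel_iso:
  assumes "DIM('a::euclidean_space) = DIM('b::euclidean_space)"
  obtains f :: "'a::euclidean_space \<Rightarrow> 'b::euclidean_space"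
    where "linear f" "bij f" "distr lborel borel f = lborel"
proof -
  obtain \<phi> where \<phi>: "bij_betw \<phi> (Basis::'a set) (Basis::'b set)"
    using finite_same_card_bij[of "Basis::'a set" "Basis::'b set"] assms by auto
  then show ?thesis
    using that linear_basis_map bij_basis_map lborel_distr_basis_map by blast
qed

lemma emeasure_distr_bij:
  assumes "bij f" "distr lborel borel f = lborel" "f \<in> borel_measurable borel" "S \<in> sets borel"
  shows "emeasure lborel (f -` S) = emeasure lborel S"
  using emeasure_distr[of f lborel borel S] assms by simp

lemma borel_linear_image:
  fixes L :: "'a::euclidean_space \<Rightarrow> 'b::euclidean_space"
  assumes "linear L" "bij L" "S \<in> sets borel"
  shows "L ` S \<in> sets borel"
proof -
  obtain g where g: "linear g" "g \<circ> L = id"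
    using linear_injective_left_inverse[OF assms(1)] assms(2) bij_is_inj by blast
  have "L ` S = g -` S"
  proof (intro set_eqI)
    fix y
    obtain x where "y = L x" using bij_is_surj[OF assms(2)] by (auto simp: surj_def)
    moreover have "g (L x) = x" for x using fun_cong[OF g(2), of x] by simp
    ultimately show "y \<in> L ` S \<longleftrightarrow> y \<in> g -` S" by (metis image_iff vimage_eq)
  qed
  also have "\<dots> \<in> sets borel"
    by (rule measurable_sets_borel[OF borel_measurable_linear[OF g(1)] assms(3)])
  finally show ?thesis .
qed

text \<open>Both spaces are identified with \<open>(real,'n) vec\<close> by measure-preserving
  relabellings, and \<open>k\<close> is the absolute determinant of the conjugated map. Only its
  existence is recorded, because densities are ratios of volumes.\<close>

lemma measure_linear_bij:
  fixes L :: "'a::euclidean_space \<Rightarrow> 'b::euclidean_space"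
  assumes "linear L" "bij L" "DIM('a) = CARD('n::{finite,wellorder})" "DIM('b) = CARD('n)"
  shows "\<exists>k>0. \<forall>S. S \<in> sets borel \<longrightarrow> emeasure lborel S < \<infinity> \<longrightarrow>
       emeasure lborel (L ` S) = ennreal (k * measure lborel S)"
proof -
  obtain e :: "(real,'n) vec \<Rightarrow> 'a" where e: "linear e" "bij e" "distr lborel borel e = lborel"
    using obtain_lborel_iso[where 'a="(real,'n) vec" and 'b='a] assms(3) by auto
  obtain f :: "(real,'n) vec \<Rightarrow> 'b" where f: "linear f" "bij f" "distr lborel borel f = lborel"
    using obtain_lborel_iso[where 'a="(real,'n) vec" and 'b='b] assms(4) by auto
  obtain g where g: "linear g" "g \<circ> f = id"
    using linear_injective_left_inverse[OF f(1)] f(2) bij_is_inj by blast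
  have gf: "g (f x) = x" for x using fun_cong[OF g(2), of x] by simp
  have fg: "f (g y) = y" for y
  proof -
    obtain x where "y = f x" using bij_is_surj[OF f(2)] by (auto simp: surj_def)
    then show ?thesis by (simp add: gf)
  qed
  define M where "M = g \<circ> L \<circ> e"
  have linM: "linear M" unfolding M_def using g(1) assms(1) e(1) by (intro linear_compose)
  have "bij g" using gf fg by (intro o_bij[of f]) auto
  then have "inj M" unfolding M_def using assms(2) e(2) by (intro inj_compose bij_is_inj)
  then have "det (matrix M) \<noteq> 0"
    using det_nz_iff_inj[OF linM] by simp
  show ?thesis
  proof (intro exI[of _ "\<bar>det (matrix M)\<bar>"] conjI allI impI)
    show "\<bar>det (matrix M)\<bar> > 0" using \<open>det (matrix M) \<noteq> 0\<close> by simp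
    fix S :: "'a set" assume S: "S \<in> sets borel" "emeasure lborel S < \<infinity>"
    have eS: "e -` S \<in> sets borel" "emeasure lborel (e -` S) = emeasure lborel S"
      using measurable_sets_borel[OF borel_measurable_linear[OF e(1)] S(1)]
        emeasure_distr_bij[OF e(2,3) borel_measurable_linear[OF e(1)] S(1)] by auto
    then have lm: "e -` S \<in> lmeasurable"
      using S(2) by (auto simp: fmeasurable_def)
    have m: "M ` (e -` S) \<in> lmeasurable"
      "measure lebesgue (M ` (e -` S)) = \<bar>det (matrix M)\<bar> * measure lebesgue (e -` S)"
      using measurable_linear_image[OF linM lm] measure_linear_image[OF linM lm] by auto
    have LS: "L ` S \<in> sets borel" by (rule borel_linear_image[OF assms(1,2) S(1)])
    have "f -` (L ` S) = M ` (e -` S)"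
    proof (intro set_eqI)
      fix x
      have "x \<in> f -` (L ` S) \<longleftrightarrow> (\<exists>s\<in>S. f x = L s)" by auto
      also have "\<dots> \<longleftrightarrow> (\<exists>s\<in>S. x = g (L s))" using gf fg by metis
      also have "\<dots> \<longleftrightarrow> x \<in> M ` (e -` S)"
      proof -
        have "\<exists>r. s = e r" for s using bij_is_surj[OF e(2)] by (auto simp: surj_def)
        then show ?thesis unfolding M_def by (auto simp: image_iff Bex_def) metis
      qed
      finally show "x \<in> f -` (L ` S) \<longleftrightarrow> x \<in> M ` (e -` S)" .
    qed
    moreover have fb: "f -` (L ` S) \<in> sets borel"
      by (rule measurable_sets_borel[OF borel_measurable_linear[OF f(1)] LS])
    ultimately have "emeasure lborel (L ` S) = emeasure lebesgue (M ` (e -` S))"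
      using emeasure_distr_bij[OF f(2,3) borel_measurable_linear[OF f(1)] LS] by simp
    also have "\<dots> = ennreal (\<bar>det (matrix M)\<bar> * measure lebesgue (e -` S))"
      using m emeasure_eq_measure2[OF m(1)] by simp
    also have "measure lebesgue (e -` S) = measure lborel S"
      using eS by (simp add: measure_def)
    finally show "emeasure lborel (L ` S) = ennreal (\<bar>det (matrix M)\<bar> * measure lborel S)" .
  qed
qed

section \<open>Hyperbolic volume as the volume of a cone\<close>

text \<open>For \<open>S\<close> inside \<open>hyp3\<close>, the union of the segments from the
  origin to the points of \<open>S\<close>, end points excluded. It lives in flat space, where
  linear maps scale volume by a determinant.\<close>

definition unit_cone :: "mvec set \<Rightarrow> mvec set" where
  "unit_cone S = {X. fst X > 0 \<and> -1 < mink X X \<and> mink X X < 0 \<and> (1 / sqrt (- mink X X)) *\<^sub>R X \<in> S}"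

lemma borel_mink [measurable]: "(\<lambda>X. mink X Y) \<in> borel_measurable borel" "(\<lambda>X. mink X X) \<in> borel_measurable borel"
  unfolding mink_def by (intro borel_measurable_continuous_onI continuous_intros)+

lemma borel_fst_mvec [measurable]: "(fst :: mvec \<Rightarrow> real) \<in> borel_measurable borel"
  by (intro borel_measurable_continuous_onI continuous_intros)

lemma borel_hyp_lift [measurable]: "hyp_lift \<in> borel_measurable borel"
  unfolding hyp_lift_def by (intro borel_measurable_continuous_onI continuous_intros)

lemma borel_unit_cone: 
  assumes [measurable]: "S \<in> sets borel"
  shows "unit_cone S \<in> sets borel"
  unfolding unit_cone_def by measurable

lemma emeasure_hyp_measure:
  assumes [measurable]: "S \<in> sets borel"
  shows "emeasure hyp_measure S =
    (\<integral>\<^sup>+ y. ennreal (1 / sqrt (1 + (norm y)\<^sup>2)) * indicator S (hyp_lift y) \<partial>lborel)"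
proof -
  have "emeasure hyp_measure S =
     emeasure (density lborel (\<lambda>y. ennreal (1 / sqrt (1 + (norm y)\<^sup>2)))) (hyp_lift -` S \<inter> UNIV)"
    unfolding hyp_measure_def by (subst emeasure_distr) auto
  also have "\<dots> = (\<integral>\<^sup>+ y. ennreal (1 / sqrt (1 + (norm y)\<^sup>2)) * indicator (hyp_lift -` S \<inter> UNIV) y \<partial>lborel)"
    by (rule emeasure_density) (auto intro: measurable_sets_borel[OF borel_hyp_lift assms])
  finally show ?thesis by (simp add: indicator_def)
qed

text \<open>Over a fixed spatial part \<open>z\<close> the cone is parametrised by the Minkowski
  length \<open>t\<close>: the time coordinate is
  \<open>sqrt (t\<^sup>2 + (norm z)\<^sup>2)\<close>, and division by \<open>t\<close> projects onto
  the hyperboloid. The condition \<open>z \<noteq> 0\<close> keeps the root differentiable at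
  \<open>t = 0\<close>.\<close>

lemma cone_slice:
  fixes z :: "real^3"
  assumes z: "z \<noteq> 0" and [measurable]: "S \<in> sets borel"
  shows "(\<integral>\<^sup>+ \<tau>. indicator (unit_cone S) (\<tau>, z) \<partial>lborel) =
    (\<integral>\<^sup>+ t. ennreal (t / sqrt (t\<^sup>2 + (norm z)\<^sup>2)) * indicator S (hyp_lift ((1 / t) *\<^sub>R z)) * indicator {0<..<1} t \<partial>lborel)"
proof -
  define g where "g t = sqrt (t\<^sup>2 + (norm z)\<^sup>2)" for t
  define f :: "real \<Rightarrow> real" where "f \<tau> = indicator (unit_cone S) (\<tau>, z)" for \<tau>
  have nz: "norm z > 0" "t\<^sup>2 + (norm z)\<^sup>2 > 0" "g t > 0" for t
    using z by (auto simp: g_def add_nonneg_pos)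
  have mk: "mink (\<tau>, z) (\<tau>, z) = (norm z)\<^sup>2 - \<tau>\<^sup>2" for \<tau>
    unfolding mink_def by (simp add: dot_square_norm power2_eq_square[of \<tau>])
  have [measurable]: "unit_cone S \<in> sets borel" by (rule borel_unit_cone) fact
  have "(\<lambda>\<tau>. (\<tau>, z)) \<in> borel_measurable borel" by (intro borel_measurable_continuous_onI continuous_intros)
  note [measurable] = this
  have fm [measurable]: "f \<in> borel_measurable borel" unfolding f_def by measurable
  have fsupp: "f \<tau> = 0" if "\<tau> \<notin> {g 0..g 1}" for \<tau>
  proof -
    have "\<not> (\<tau> > 0 \<and> -1 < (norm z)\<^sup>2 - \<tau>\<^sup>2 \<and> (norm z)\<^sup>2 - \<tau>\<^sup>2 < 0)"
    proof
      assume a: "\<tau> > 0 \<and> -1 < (norm z)\<^sup>2 - \<tau>\<^sup>2 \<and> (norm z)\<^sup>2 - \<tau>\<^sup>2 < 0"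
      have "norm z \<le> \<tau>" 
        by (rule power2_le_imp_le[OF less_imp_le]) (use a in simp_all)
      then have "g 0 \<le> \<tau>" by (simp add: g_def)
      moreover have "\<tau> \<le> g 1" using a unfolding g_def by (intro real_le_rsqrt) auto
      ultimately show False using that by simp
    qed
    then show ?thesis by (auto simp: f_def unit_cone_def mk)
  qed
  have fg: "f (g t) = indicator S (hyp_lift ((1 / t) *\<^sub>R z)) * indicator {0<..<1} t" if "t \<in> {0..1}" for t
  proof -
    have e: "mink (g t, z) (g t, z) = - t\<^sup>2" unfolding mk using nz(2)[of t] by (simp add: g_def)
    have l: "(1 / t) *\<^sub>R (g t, z) = hyp_lift ((1 / t) *\<^sub>R z)" if "t > 0"
    proof -
      have "1 + (norm ((1 / t) *\<^sub>R z))\<^sup>2 = (t\<^sup>2 + (norm z)\<^sup>2) / t\<^sup>2"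
        using that by (simp add: field_simps power_divide)
      then show ?thesis using that by (simp add: hyp_lift_def g_def real_sqrt_divide)
    qed
    have "t\<^sup>2 < 1 \<longleftrightarrow> t < 1" using that by (simp add: power_less_one_iff)
    then show ?thesis
      using that nz(3)[of t] l e
      by (cases "t = 0") (auto simp: f_def unit_cone_def indicator_def)
  qed
  have "(\<integral>\<^sup>+ \<tau>. indicator (unit_cone S) (\<tau>, z) \<partial>lborel) = (\<integral>\<^sup>+ \<tau>. f \<tau> * indicator {g 0..g 1} \<tau> \<partial>lborel)"
    using fsupp by (intro nn_integral_cong) (auto simp: f_def indicator_def)
  also have "\<dots> = (\<integral>\<^sup>+ t. f (g t) * (t / g t) * indicator {0..1} t \<partial>lborel)"
  proof (rule nn_integral_substitution)
    show "set_borel_measurable borel {g 0..g 1} f" unfolding set_borel_measurable_def by measurable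
    show "(g has_real_derivative x / g x) (at x)" for x
      unfolding g_def using nz(2)[of x] by (auto intro!: derivative_eq_intros simp: field_simps)
    show "continuous_on {0..1} (\<lambda>x. x / g x)"
      unfolding g_def using nz(2) by (auto intro!: continuous_intros simp: less_imp_neq[symmetric])
    show "0 \<le> x / g x" if "x \<in> {0..1}" for x using that nz(3)[of x] by simp
  qed simp
  also have "\<dots> = (\<integral>\<^sup>+ t. ennreal (t / sqrt (t\<^sup>2 + (norm z)\<^sup>2)) * indicator S (hyp_lift ((1 / t) *\<^sub>R z)) * indicator {0<..<1} t \<partial>lborel)"
    unfolding g_def[symmetric] by (intro nn_integral_cong) (auto simp: fg indicator_def)
  finally show ?thesis .
qed

text \<open>Polar integration in the Minkowski length \<open>t\<close>: scaling the spatial part by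
  \<open>t\<close> contributes \<open>t ^ 3\<close> and turns the slice weight into the density of
  \<open>hyp_measure\<close>. The factor 4 is the reciprocal of the integral of \<open>t ^ 3\<close>
  over the unit interval.\<close>

lemma emeasure_unit_cone:
  assumes [measurable]: "S \<in> sets borel"
  shows "4 * emeasure lborel (unit_cone S) = emeasure hyp_measure S"
proof -
  have [measurable]: "unit_cone S \<in> sets borel" by (rule borel_unit_cone) fact
  let ?h = "\<lambda>t z. ennreal (t / sqrt (t\<^sup>2 + (norm z)\<^sup>2)) * indicator S (hyp_lift ((1 / t) *\<^sub>R z)) * indicator {0<..<1} t :: ennreal"
  have hm: "(\<lambda>(z, t). ?h t z) \<in> borel_measurable (lborel \<Otimes>\<^sub>M (lborel :: real measure))"
    by measurable
  have uc: "unit_cone S \<in> sets (lborel \<Otimes>\<^sub>M lborel)"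
    using \<open>unit_cone S \<in> sets borel\<close> by (simp only: lborel_prod sets_lborel)
  have "emeasure lborel (unit_cone S) = (\<integral>\<^sup>+ X. indicator (unit_cone S) X \<partial>(lborel \<Otimes>\<^sub>M lborel))"
    by (simp add: lborel_prod)
  also have "\<dots> = (\<integral>\<^sup>+ z. \<integral>\<^sup>+ \<tau>. indicator (unit_cone S) (\<tau>, z) \<partial>lborel \<partial>lborel)"
    by (rule lborel_pair.nn_integral_snd[symmetric]) (use uc in measurable)
  also have "\<dots> = (\<integral>\<^sup>+ z. \<integral>\<^sup>+ t. ?h t z \<partial>lborel \<partial>lborel)"
    by (intro nn_integral_cong_AE AE_I[of _ _ "{0}"]) (auto dest: cone_slice[OF _ assms])
  also have "\<dots> = (\<integral>\<^sup>+ t. \<integral>\<^sup>+ z. ?h t z \<partial>lborel \<partial>lborel)"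
    using lborel_pair.Fubini'[of "\<lambda>z t. ?h t z"] hm by simp
  also have "\<dots> = (\<integral>\<^sup>+ t. ennreal (t ^ 3) * indicator {0..1} t * emeasure hyp_measure S \<partial>lborel)"
  proof (intro nn_integral_cong_AE AE_I[of _ _ "{0, 1}"])
    show "{t \<in> space lborel. (\<integral>\<^sup>+ z. ?h t z \<partial>lborel) \<noteq> ennreal (t ^ 3) * indicator {0..1} t * emeasure hyp_measure S} \<subseteq> {0, 1}"
    proof (rule subsetI, rule ccontr)
      fix t :: real
      assume "t \<in> {t \<in> space lborel. (\<integral>\<^sup>+ z. ?h t z \<partial>lborel) \<noteq> ennreal (t ^ 3) * indicator {0..1} t * emeasure hyp_measure S}"
        and "t \<notin> {0, 1}"
      then have ne: "(\<integral>\<^sup>+ z. ?h t z \<partial>lborel) \<noteq> ennreal (t ^ 3) * indicator {0..1} t * emeasure hyp_measure S"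
        and t01: "t \<noteq> 0" "t \<noteq> 1" by auto
      show False
      proof (cases "0 < t \<and> t < 1")
        case True
        have "(\<integral>\<^sup>+ z. ?h t z \<partial>lborel) = (\<integral>\<^sup>+ z. ?h t z \<partial>density (distr lborel borel (\<lambda>x::real^3. 0 + t *\<^sub>R x)) (\<lambda>_. ennreal (\<bar>t\<bar> ^ DIM(real^3))))"
          using True by (intro arg_cong[of _ _ "\<lambda>M. integral\<^sup>N M (?h t)"] lborel_affine) simp
        also have "\<dots> = (\<integral>\<^sup>+ y. ennreal (t ^ 3) * ?h t (t *\<^sub>R y) \<partial>lborel)"
          using True by (simp add: nn_integral_density nn_integral_distr abs_of_pos)
        also have "\<dots> = (\<integral>\<^sup>+ y. ennreal (t ^ 3) * (ennreal (1 / sqrt (1 + (norm y)\<^sup>2)) * indicator S (hyp_lift y)) \<partial>lborel)"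
        proof (intro nn_integral_cong)
          fix y :: "real^3"
          have "t\<^sup>2 + (norm (t *\<^sub>R y))\<^sup>2 = t\<^sup>2 * (1 + (norm y)\<^sup>2)" by (simp add: algebra_simps power_mult_distrib)
          then have "t / sqrt (t\<^sup>2 + (norm (t *\<^sub>R y))\<^sup>2) = 1 / sqrt (1 + (norm y)\<^sup>2)"
            using True by (simp add: real_sqrt_mult)
          then show "ennreal (t ^ 3) * ?h t (t *\<^sub>R y) = ennreal (t ^ 3) * (ennreal (1 / sqrt (1 + (norm y)\<^sup>2)) * indicator S (hyp_lift y))"
            using True by simp
        qed
        also have "\<dots> = ennreal (t ^ 3) * emeasure hyp_measure S"
          by (subst nn_integral_cmult) (auto simp: emeasure_hyp_measure[OF assms])
        finally show False using ne True by simp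
      next
        case False
        then show False using ne t01 by (auto simp: indicator_def split: if_splits)
      qed
    qed
  qed (auto simp: emeasure_lborel_countable)
  also have "\<dots> = (\<integral>\<^sup>+ t. ennreal (t ^ 3) * indicator {0..1} t \<partial>lborel) * emeasure hyp_measure S"
    by (rule nn_integral_multc) simp
  also have "(\<integral>\<^sup>+ t. ennreal (t ^ 3) * indicator {0..1} t \<partial>lborel) = ennreal (1 ^ 4 / 4 - 0 ^ 4 / 4)"
    by (rule nn_integral_FTC_Icc) (auto intro!: derivative_eq_intros)
  finally show ?thesis
    by (simp add: mult.assoc[symmetric] ennreal_mult'[symmetric] flip: ennreal_numeral)
qed

section \<open>The volume integral\<close>

text \<open>The antiderivative of \<open>(1 + s\<^sup>2 / 3) ^ n\<close> that vanishes at 0; the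
  recursion is integration by parts, with \<open>s\<^sup>2 / 3\<close> rewritten as
  \<open>(1 + s\<^sup>2 / 3) - 1\<close>.\<close>

fun prim :: "nat \<Rightarrow> real \<Rightarrow> real" where
  "prim 0 s = s"
| "prim (Suc n) s = (s * (1 + s\<^sup>2 / 3) ^ Suc n + 2 * (real n + 1) * prim n s) / (2 * real n + 3)"

lemma prim_deriv: "(prim n has_real_derivative (1 + s\<^sup>2 / 3) ^ n) (at s)"
proof (induction n)
  case 0
  then show ?case by (simp add: fun_eq_iff[of "prim 0"] DERIV_ident[unfolded id_def] prim.simps(1)[abs_def])
next
  case (Suc n)
  let ?w = "1 + s\<^sup>2 / 3"
  have "((\<lambda>s. (s * (1 + s\<^sup>2 / 3) ^ Suc n + 2 * (real n + 1) * prim n s) / (2 * real n + 3)) has_real_derivative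
     (?w ^ Suc n + s * ((real n + 1) * ?w ^ n * (2 * s / 3)) + 2 * (real n + 1) * ?w ^ n) / (2 * real n + 3)) (at s)"
    by (rule derivative_eq_intros Suc refl | simp)+
  also have "?w ^ Suc n + s * ((real n + 1) * ?w ^ n * (2 * s / 3)) + 2 * (real n + 1) * ?w ^ n =
     (2 * real n + 3) * ?w ^ Suc n"
    by (simp add: field_simps power2_eq_square)
  finally show ?case by (simp add: prim.simps(2)[abs_def] del: power_Suc)
qed

lemma prim_minus: "prim n (- s) = - prim n s"
proof (induction n)
  case (Suc n)
  have "(- a - b) / c = - ((a + b) / c)" for a b c :: real
    by (simp add: minus_divide_left)
  then show ?case by (simp add: Suc del: power_Suc)
qed simp

definition moment :: "nat \<Rightarrow> real" where "moment n = prim n 1"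

lemma moment_rec: "moment 0 = 1" 
  "moment (Suc n) = ((4/3) ^ Suc n + 2 * (real n + 1) * moment n) / (2 * real n + 3)"
  by (simp_all add: moment_def)

lemma moment_bounds: "0 < moment n" "moment n \<le> (4/3) ^ n"
proof -
  show "0 < moment n" by (induction n) (auto simp: moment_rec add_pos_pos)
  show "moment n \<le> (4/3) ^ n"
  proof (induction n)
    case (Suc n)
    have "2 * (real n + 1) * moment n \<le> 2 * (real n + 1) * (4/3) ^ n"
      using Suc by (intro mult_left_mono) auto
    also have "\<dots> \<le> 2 * (real n + 1) * (4/3) ^ Suc n" by (intro mult_left_mono) auto
    finally have "(4/3) ^ Suc n + 2 * (real n + 1) * moment n \<le> (2 * real n + 3) * (4/3) ^ Suc n"
      by (simp add: algebra_simps)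
    then show ?case unfolding moment_rec by (simp add: divide_le_eq mult.commute del: power_Suc)
  qed (simp add: moment_rec)
qed

text \<open>The integrand is even, so the symmetric interval doubles the integral. This is where the
  volumes for \<open>HP3\<close> acquire their factor 2.\<close>

lemma nn_integral_moment:
  assumes "\<sigma> = 0 \<or> \<sigma> = (1::real)"
  shows "(\<integral>\<^sup>+ s. ennreal ((1 + s\<^sup>2 / 3) ^ n) * indicator {-\<sigma>..1} s \<partial>lborel) = ennreal ((1 + \<sigma>) * moment n)"
proof -
  have "(\<integral>\<^sup>+ s. ennreal ((1 + s\<^sup>2 / 3) ^ n) * indicator {-\<sigma>..1} s \<partial>lborel) = ennreal (prim n 1 - prim n (- \<sigma>))"
    using assms by (intro nn_integral_FTC_Icc prim_deriv) auto
  moreover have "prim n 0 = 0" using prim_minus[of n 0] by simp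
  ultimately show ?thesis using assms by (auto simp: prim_minus moment_def)
qed

text \<open>Here \<open>a\<close> will be \<open>c\<^sup>2\<close>, and
  \<open>p * q - a * (x\<^sup>2 + y\<^sup>2 / 3)\<close> is the negated Minkowski square. The last
  inequality bounds it by 1. The one before it says \<open>p \<le> q\<close>, the side of facet 1,
  when \<open>b = 0\<close>, and says that \<open>p\<^sup>2\<close> is at most the negated square,
  the horoball condition, when \<open>b = a\<close>.\<close>

definition region :: "real \<Rightarrow> real \<Rightarrow> real \<Rightarrow> (real \<times> real \<times> real \<times> real) set" where
  "region \<sigma> a b = {(p, x, y, q). 0 < p \<and> 0 \<le> x \<and> x \<le> p \<and> - \<sigma> * x \<le> y \<and> y \<le> x \<and>
     p\<^sup>2 + b * (x\<^sup>2 + y\<^sup>2 / 3) \<le> p * q \<and> p * q < 1 + a * (x\<^sup>2 + y\<^sup>2 / 3)}"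

lemma region_borel: "region \<sigma> a b \<in> sets borel"
proof -
  have "(\<lambda>w::real \<times> real \<times> real \<times> real. fst w) \<in> borel_measurable borel"
    "(\<lambda>w::real \<times> real \<times> real \<times> real. fst (snd w)) \<in> borel_measurable borel"
    "(\<lambda>w::real \<times> real \<times> real \<times> real. fst (snd (snd w))) \<in> borel_measurable borel"
    "(\<lambda>w::real \<times> real \<times> real \<times> real. snd (snd (snd w))) \<in> borel_measurable borel"
    by (intro borel_measurable_continuous_onI continuous_intros)+
  note [measurable] = this
  show ?thesis unfolding region_def case_prod_beta by measurable
qed

text \<open>The upper limit is the positive zero of the integrand, beyond which
  \<open>ennreal\<close> truncates it to 0.\<close>

lemma nn_integral_cubic:
  fixes m :: real
  assumes "m > 0"
  shows "(\<integral>\<^sup>+ p. ennreal (p * (1 - p\<^sup>2 * m)) * indicator {0..1 / sqrt m} p \<partial>lborel) = ennreal (1 / (4 * m))"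
proof -
  define r where "r = 1 / sqrt m"
  have r: "r > 0" "r\<^sup>2 = 1 / m" using assms by (auto simp: r_def power_divide)
  have "(\<integral>\<^sup>+ p. ennreal (p * (1 - p\<^sup>2 * m)) * indicator {0..r} p \<partial>lborel) = 
      ennreal ((r\<^sup>2 / 2 - r ^ 4 * m / 4) - (0\<^sup>2 / 2 - 0 ^ 4 * m / 4))"
  proof (rule nn_integral_FTC_Icc)
    fix p assume "p \<in> {0..r}"
    then have "p\<^sup>2 \<le> r\<^sup>2" by (intro power_mono) auto
    then have "p\<^sup>2 * m \<le> 1" using assms by (simp add: r field_simps)
    then show "0 \<le> p * (1 - p\<^sup>2 * m)" using \<open>p \<in> {0..r}\<close> by simp
  next
    fix p
    show "((\<lambda>p. p\<^sup>2 / 2 - p ^ 4 * m / 4) has_real_derivative p * (1 - p\<^sup>2 * m)) (at p)"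
      by (rule derivative_eq_intros refl | simp)+ (simp add: algebra_simps power2_eq_square power3_eq_cube)
  qed (use r in auto)
  also have "r ^ 4 = (1 / m) * (1 / m)" by (simp add: r(2)[symmetric])
  also have "r\<^sup>2 / 2 - (1 / m) * (1 / m) * m / 4 - (0\<^sup>2 / 2 - 0 ^ 4 * m / 4) = 1 / (4 * m)"
    using assms unfolding r(2) by (simp add: field_simps)
  finally show ?thesis unfolding r_def .
qed

lemma nn_integral_lborel_pair:
  fixes f :: "'a::euclidean_space \<times> 'b::euclidean_space \<Rightarrow> ennreal"
  assumes "f \<in> borel_measurable borel"
  shows "(\<integral>\<^sup>+ w. f w \<partial>lborel) = (\<integral>\<^sup>+ x. \<integral>\<^sup>+ y. f (x, y) \<partial>lborel \<partial>lborel)"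
proof -
  have "f \<in> borel_measurable (lborel \<Otimes>\<^sub>M lborel)"
    using assms by (simp add: lborel_prod)
  from lborel.nn_integral_fst[OF this] show ?thesis by (simp add: lborel_prod)
qed

text \<open>Scaling \<open>(x, y) = p (\<xi>, \<xi> s)\<close> turns the wedge into a rectangle and separates the variables.\<close>

lemma geometric_ratio_less_one:
  fixes c \<xi> s :: real
  assumes "0 \<le> c" "c < 3 / 4" "\<bar>\<xi>\<bar> \<le> 1" "\<bar>s\<bar> \<le> 1"
  shows "c * \<xi>\<^sup>2 * (1 + s\<^sup>2 / 3) < 1"
proof -
  have "\<xi>\<^sup>2 \<le> 1" "s\<^sup>2 \<le> 1" using assms by (simp_all add: abs_square_le_1)
  then have "\<xi>\<^sup>2 * (1 + s\<^sup>2 / 3) \<le> 1 * (4 / 3)" by (intro mult_mono) auto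
  from mult_left_mono[OF this assms(1)] show ?thesis using assms(2) unfolding mult.assoc by linarith
qed

text \<open>The slice in \<open>q\<close> has length
  \<open>(1 - p\<^sup>2 + (a - b) * (x\<^sup>2 + y\<^sup>2 / 3)) / p\<close>. The Jacobian
  \<open>p * (p * \<xi>)\<close> of the scaling cancels the denominator, and the integral over
  \<open>p\<close> becomes the cubic one with
  \<open>m = 1 - (a - b) * \<xi>\<^sup>2 * (1 + s\<^sup>2 / 3)\<close>.\<close>

lemma emeasure_region_aux:
  assumes s: "\<sigma> = 0 \<or> \<sigma> = (1::real)" and ab: "0 \<le> b" "b \<le> a" "a < 3 / 4"
  shows "emeasure lborel (region \<sigma> a b) =
    (\<integral>\<^sup>+ \<xi>. \<integral>\<^sup>+ s. ennreal (\<xi> / (4 * (1 - (a - b) * \<xi>\<^sup>2 * (1 + s\<^sup>2 / 3)))) * indicator {-\<sigma>..1} s * indicator {0..1} \<xi> \<partial>lborel \<partial>lborel)"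
proof -
  define R where "R = region \<sigma> a b"
  have [measurable]: "R \<in> sets borel" unfolding R_def by (rule region_borel)
  \<comment> \<open>Where the interval for \<open>q\<close> is empty the difference is at most 0 and
    \<open>ennreal\<close> turns it into 0; this encodes the upper bound on
    \<open>p\<close>.\<close>
  define F :: "real \<Rightarrow> real \<Rightarrow> real \<Rightarrow> ennreal" where
    "F p x y = (if 0 < p \<and> 0 \<le> x \<and> x \<le> p \<and> - \<sigma> * x \<le> y \<and> y \<le> x
       then ennreal ((1 + a * (x\<^sup>2 + y\<^sup>2 / 3)) / p - (p\<^sup>2 + b * (x\<^sup>2 + y\<^sup>2 / 3)) / p) else 0)" for p x y
  have Fm [measurable]: "(\<lambda>(x, y). F p x y) \<in> borel_measurable (borel \<Otimes>\<^sub>M borel)" for p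
    unfolding F_def by measurable
  define m where "m \<xi> s = 1 - (a - b) * \<xi>\<^sup>2 * (1 + s\<^sup>2 / 3)" for \<xi> s :: real
  define G :: "real \<Rightarrow> real \<Rightarrow> real \<Rightarrow> ennreal" where
    "G p \<xi> s = ennreal (\<xi> * (p * (1 - p\<^sup>2 * m \<xi> s))) * (if 0 < p \<and> 0 \<le> \<xi> \<and> \<xi> \<le> 1 \<and> - \<sigma> \<le> s \<and> s \<le> 1 then 1 else 0)" for p \<xi> s
  have Gm [measurable]: "(\<lambda>w. G (fst (fst w)) (snd (fst w)) (snd w)) \<in> borel_measurable ((borel \<Otimes>\<^sub>M borel) \<Otimes>\<^sub>M borel)"
    unfolding G_def m_def case_prod_beta by measurable
  have Gm2 [measurable]: "(\<lambda>(\<xi>, s). G p \<xi> s) \<in> borel_measurable (borel \<Otimes>\<^sub>M borel)"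
     "(\<lambda>(p, s). G p \<xi> s) \<in> borel_measurable (borel \<Otimes>\<^sub>M borel)" for p \<xi>
    unfolding G_def m_def case_prod_beta by measurable
  have slice: "(\<integral>\<^sup>+ q. indicator R (p, x, y, q) \<partial>lborel) = F p x y" for p x y
  proof (cases "0 < p \<and> 0 \<le> x \<and> x \<le> p \<and> - \<sigma> * x \<le> y \<and> y \<le> x")
    case True
    let ?l = "(p\<^sup>2 + b * (x\<^sup>2 + y\<^sup>2 / 3)) / p" and ?u = "(1 + a * (x\<^sup>2 + y\<^sup>2 / 3)) / p"
    have "(\<integral>\<^sup>+ q. indicator R (p, x, y, q) \<partial>lborel) = (\<integral>\<^sup>+ q. indicator {?l..<?u} q \<partial>lborel)"
      using True by (intro nn_integral_cong) (auto simp: R_def region_def indicator_def field_simps)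
    also have "\<dots> = ennreal (?u - ?l)"
      by (cases "?l \<le> ?u") (auto simp: ennreal_neg)
    finally show ?thesis using True by (simp add: F_def)
  qed (auto simp: F_def R_def region_def)
  have inner: "(\<integral>\<^sup>+ x. \<integral>\<^sup>+ y. F p x y \<partial>lborel \<partial>lborel) = (\<integral>\<^sup>+ \<xi>. \<integral>\<^sup>+ s. G p \<xi> s \<partial>lborel \<partial>lborel)" for p
  proof (cases "p > 0")
    case True
    have "(\<integral>\<^sup>+ x. \<integral>\<^sup>+ y. F p x y \<partial>lborel \<partial>lborel) = ennreal \<bar>p\<bar> * (\<integral>\<^sup>+ \<xi>. \<integral>\<^sup>+ y. F p (0 + p * \<xi>) y \<partial>lborel \<partial>lborel)"
      using True by (intro nn_integral_real_affine) (auto, measurable)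
    also have "\<dots> = (\<integral>\<^sup>+ \<xi>. ennreal p * (\<integral>\<^sup>+ y. F p (p * \<xi>) y \<partial>lborel) \<partial>lborel)"
      using True by (subst nn_integral_cmult) (auto, measurable)
    also have "\<dots> = (\<integral>\<^sup>+ \<xi>. \<integral>\<^sup>+ s. G p \<xi> s \<partial>lborel \<partial>lborel)"
    \<comment> \<open>At \<open>\<xi> = 0\<close> the substitution in \<open>y\<close> degenerates;
      this null set is left out.\<close>
    proof (intro nn_integral_cong_AE AE_I[of _ _ "{0}"])
      show "{\<xi> \<in> space lborel. ennreal p * (\<integral>\<^sup>+ y. F p (p * \<xi>) y \<partial>lborel) \<noteq> (\<integral>\<^sup>+ s. G p \<xi> s \<partial>lborel)} \<subseteq> {0}"
      proof (rule subsetI, rule ccontr)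
        fix \<xi> :: real assume "\<xi> \<in> {\<xi> \<in> space lborel. ennreal p * (\<integral>\<^sup>+ y. F p (p * \<xi>) y \<partial>lborel) \<noteq> (\<integral>\<^sup>+ s. G p \<xi> s \<partial>lborel)}"
          and "\<xi> \<notin> {0}"
        then have ne: "ennreal p * (\<integral>\<^sup>+ y. F p (p * \<xi>) y \<partial>lborel) \<noteq> (\<integral>\<^sup>+ s. G p \<xi> s \<partial>lborel)" and x0: "\<xi> \<noteq> 0" by auto
        show False
        proof (cases "\<xi> > 0")
          case xi: True
          then have pxi: "p * \<xi> > 0" using True by simp
          have "(\<integral>\<^sup>+ y. F p (p * \<xi>) y \<partial>lborel) = ennreal \<bar>p * \<xi>\<bar> * (\<integral>\<^sup>+ s. F p (p * \<xi>) (0 + (p * \<xi>) * s) \<partial>lborel)"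
            using pxi by (intro nn_integral_real_affine) (auto, measurable)
          also have "\<dots> = (\<integral>\<^sup>+ s. ennreal (p * \<xi>) * F p (p * \<xi>) (p * \<xi> * s) \<partial>lborel)"
            using pxi by (subst nn_integral_cmult) (auto, measurable)
          finally have "ennreal p * (\<integral>\<^sup>+ y. F p (p * \<xi>) y \<partial>lborel) = (\<integral>\<^sup>+ s. ennreal p * (ennreal (p * \<xi>) * F p (p * \<xi>) (p * \<xi> * s)) \<partial>lborel)"
            by (simp add: nn_integral_cmult)
          also have "\<dots> = (\<integral>\<^sup>+ s. G p \<xi> s \<partial>lborel)"
          proof (intro nn_integral_cong)
            fix s :: real
            have c1: "p * \<xi> \<le> p \<longleftrightarrow> \<xi> \<le> 1" using True by (simp add: mult_le_cancel_left1)
            have "- \<sigma> * (p * \<xi>) \<le> p * \<xi> * s \<longleftrightarrow> (p * \<xi>) * (- \<sigma>) \<le> (p * \<xi>) * s" by (simp add: mult.commute)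
            then have c2: "- \<sigma> * (p * \<xi>) \<le> p * \<xi> * s \<longleftrightarrow> - \<sigma> \<le> s"
              using mult_le_cancel_left_pos[OF pxi, of "- \<sigma>" s] by simp
            have c3: "p * \<xi> * s \<le> p * \<xi> \<longleftrightarrow> s \<le> 1" using mult_le_cancel_left_pos[OF pxi, of s 1] by simp
            let ?w = "(p * \<xi>)\<^sup>2 + (p * \<xi> * s)\<^sup>2 / 3"
            have "p * ((p * \<xi>) * ((1 + a * ?w) / p - (p\<^sup>2 + b * ?w) / p)) = p * \<xi> * ((1 + a * ?w) - (p\<^sup>2 + b * ?w))"
              using True by (simp add: field_simps)
            also have "\<dots> = \<xi> * (p * (1 - p\<^sup>2 * m \<xi> s))"
              unfolding m_def by (simp add: algebra_simps power_mult_distrib power2_eq_square)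
            finally have e: "p * ((p * \<xi>) * ((1 + a * ?w) / p - (p\<^sup>2 + b * ?w) / p)) = \<xi> * (p * (1 - p\<^sup>2 * m \<xi> s))" .
            show "ennreal p * (ennreal (p * \<xi>) * F p (p * \<xi>) (p * \<xi> * s)) = G p \<xi> s"
              unfolding F_def G_def c1 c2 c3 e[symmetric] using True xi pxi by (simp add: ennreal_mult'[symmetric] del: mult_pos_pos)
          qed
          finally show False using ne by simp
        next
          case False
          then have "F p (p * \<xi>) y = 0" "G p \<xi> s = 0" for y s
            using True x0 by (auto simp: F_def G_def zero_le_mult_iff)
          then show False using ne by simp
        qed
      qed
    qed auto
    finally show ?thesis .
  qed (simp add: F_def G_def)
  have cubic: "(\<integral>\<^sup>+ p. G p \<xi> s \<partial>lborel) = ennreal (\<xi> / (4 * m \<xi> s)) * indicator {-\<sigma>..1} s * indicator {0..1} \<xi>" for \<xi> s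
  proof (cases "\<xi> \<in> {0..1} \<and> s \<in> {-\<sigma>..1}")
    case True
    have mpos: "m \<xi> s > 0"
      using geometric_ratio_less_one[of "a - b" \<xi> s] True s ab by (auto simp: m_def)
    have "(\<integral>\<^sup>+ p. G p \<xi> s \<partial>lborel) = (\<integral>\<^sup>+ p. ennreal \<xi> * (ennreal (p * (1 - p\<^sup>2 * m \<xi> s)) * indicator {0..1 / sqrt (m \<xi> s)} p) \<partial>lborel)"
    proof (intro nn_integral_cong)
      fix p
      have "p * (1 - p\<^sup>2 * m \<xi> s) \<le> 0" if "p > 1 / sqrt (m \<xi> s)"
      proof -
        have "p\<^sup>2 \<ge> (1 / sqrt (m \<xi> s))\<^sup>2" using that mpos by (intro power_mono) auto
        then have "p\<^sup>2 * m \<xi> s \<ge> 1" using mpos by (simp add: power_divide field_simps)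
        moreover have "p > 0" using that mpos by (smt (verit) divide_nonneg_nonneg real_sqrt_ge_zero)
        ultimately show ?thesis by (simp add: mult_nonneg_nonpos)
      qed
      then have "ennreal (p * (1 - p\<^sup>2 * m \<xi> s)) = 0" if "p > 1 / sqrt (m \<xi> s)"
        using that by (simp add: ennreal_neg)
      moreover have "G p \<xi> s = ennreal \<xi> * ennreal (p * (1 - p\<^sup>2 * m \<xi> s)) * (if 0 < p then 1 else 0)"
        using True by (simp add: G_def ennreal_mult'[of \<xi>])
      ultimately show "G p \<xi> s = ennreal \<xi> * (ennreal (p * (1 - p\<^sup>2 * m \<xi> s)) * indicator {0..1 / sqrt (m \<xi> s)} p)"
        by (cases "p = 0"; cases "p > 1 / sqrt (m \<xi> s)") (simp_all add: indicator_def)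
    qed
    also have "\<dots> = ennreal \<xi> * ennreal (1 / (4 * m \<xi> s))"
      by (subst nn_integral_cmult) (auto simp: nn_integral_cubic[OF mpos])
    also have "\<dots> = ennreal (\<xi> / (4 * m \<xi> s))" using True by (simp add: ennreal_mult'[symmetric])
    finally show ?thesis using True by simp
  qed (auto simp: G_def indicator_def)
  have "(\<lambda>w. (p, w)) \<in> borel_measurable (borel :: (real \<times> real \<times> real) measure)"
    "(\<lambda>w. (p, x, w)) \<in> borel_measurable (borel :: (real \<times> real) measure)" for p x :: real
    by (intro borel_measurable_continuous_onI continuous_intros)+
  note [measurable] = this
  have "emeasure lborel R = (\<integral>\<^sup>+ w. indicator R w \<partial>lborel)"
    by simp
  also have "\<dots> = (\<integral>\<^sup>+ p. \<integral>\<^sup>+ w. indicator R (p, w) \<partial>lborel \<partial>lborel)"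
    by (rule nn_integral_lborel_pair) measurable
  also have "\<dots> = (\<integral>\<^sup>+ p. \<integral>\<^sup>+ x. \<integral>\<^sup>+ w. indicator R (p, x, w) \<partial>lborel \<partial>lborel \<partial>lborel)"
    by (intro nn_integral_cong nn_integral_lborel_pair) measurable
  also have "\<dots> = (\<integral>\<^sup>+ p. \<integral>\<^sup>+ x. \<integral>\<^sup>+ y. \<integral>\<^sup>+ q. indicator R (p, x, y, q) \<partial>lborel \<partial>lborel \<partial>lborel \<partial>lborel)"
    by (intro nn_integral_cong nn_integral_lborel_pair) measurable
  also have "\<dots> = (\<integral>\<^sup>+ p. \<integral>\<^sup>+ x. \<integral>\<^sup>+ y. F p x y \<partial>lborel \<partial>lborel \<partial>lborel)"
    by (simp add: slice)
  also have "\<dots> = (\<integral>\<^sup>+ p. \<integral>\<^sup>+ \<xi>. \<integral>\<^sup>+ s. G p \<xi> s \<partial>lborel \<partial>lborel \<partial>lborel)"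
    by (simp add: inner)
  also have "\<dots> = (\<integral>\<^sup>+ \<xi>. \<integral>\<^sup>+ p. \<integral>\<^sup>+ s. G p \<xi> s \<partial>lborel \<partial>lborel \<partial>lborel)"
    by (rule lborel_pair.Fubini'[symmetric]) measurable
  also have "\<dots> = (\<integral>\<^sup>+ \<xi>. \<integral>\<^sup>+ s. \<integral>\<^sup>+ p. G p \<xi> s \<partial>lborel \<partial>lborel \<partial>lborel)"
    by (intro nn_integral_cong lborel_pair.Fubini'[symmetric]) measurable
  finally show ?thesis unfolding R_def cubic m_def .
qed

text \<open>For \<open>0 \<le> c < 3 / 4\<close> the sum is the integral of
  \<open>2 * \<xi> / (1 - c * \<xi>\<^sup>2 * (1 + s\<^sup>2 / 3))\<close> over the unit square; the
  denominator comes from integrating \<open>\<xi> ^ (2 * n + 1)\<close>.\<close>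

definition density_series :: "real \<Rightarrow> nat \<Rightarrow> real" where
  "density_series c n = c ^ n * moment n / (real n + 1)"

lemma density_series_nonneg: "0 \<le> c \<Longrightarrow> 0 \<le> density_series c n"
  using moment_bounds(1)[of n] by (simp add: density_series_def)

lemma density_series_le:
  assumes "0 \<le> c"
  shows "density_series c n \<le> (c * 4 / 3) ^ n / (real n + 1)"
proof -
  have "c ^ n * moment n \<le> c ^ n * (4/3) ^ n" using assms moment_bounds by (intro mult_left_mono) auto
  then show ?thesis unfolding density_series_def
    by (intro divide_right_mono) (auto simp: power_mult_distrib[symmetric] mult.commute)
qed

lemma density_series_summable:
  assumes "0 \<le> c" "c < 3 / 4"
  shows "summable (density_series c)"
proof (rule summable_comparison_test)
  have "density_series c n \<le> (c * 4 / 3) ^ n" for n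
    using density_series_le[OF assms(1), of n] frac_le[of "(c * 4 / 3) ^ n" "(c * 4 / 3) ^ n" 1 "real n + 1"] assms by simp
  then show "\<exists>N. \<forall>n\<ge>N. norm (density_series c n) \<le> (c * 4 / 3) ^ n"
    using density_series_nonneg[OF assms(1)] by auto
  show "summable (\<lambda>n. (c * 4 / 3) ^ n)" using assms by (intro summable_geometric) auto
qed

text \<open>The case of the horoball sector: only the term \<open>n = 0\<close> survives, by
  \<open>0 ^ 0 = 1\<close>.\<close>

lemma density_series_0: "suminf (density_series 0) = 1"
proof -
  have "(\<lambda>n. density_series 0 n) = (\<lambda>n. if n = 0 then 1 else 0)"
    by (auto simp: density_series_def moment_rec fun_eq_iff)
  then show ?thesis using suminf_finite[of "{0}" "density_series 0"] by (simp add: density_series_def moment_rec)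
qed

text \<open>The integrand is expanded as a geometric series with nonnegative terms, so sum and
  integrals commute. In each term the variables separate: \<open>\<xi>\<close> gives
  \<open>1 / (2 * (n + 1))\<close> and \<open>s\<close> gives
  \<open>(1 + \<sigma>) * moment n\<close>.\<close>

lemma emeasure_region:
  assumes s: "\<sigma> = 0 \<or> \<sigma> = (1::real)" and ab: "0 \<le> b" "b \<le> a" "a < 3 / 4"
  shows "emeasure lborel (region \<sigma> a b) = ennreal ((1 + \<sigma>) / 8 * suminf (density_series (a - b)))"
proof -
  define c where "c = a - b"
  have c: "0 \<le> c" "c < 3 / 4" using ab by (auto simp: c_def)
  let ?t = "\<lambda>n \<xi> s. ennreal (c ^ n / 4 * \<xi> ^ (2 * n + 1) * (1 + s\<^sup>2 / 3) ^ n) * indicator {-\<sigma>..1} s * indicator {0..1} \<xi>"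
  have geo: "ennreal (\<xi> / (4 * (1 - c * \<xi>\<^sup>2 * (1 + s\<^sup>2 / 3)))) * indicator {-\<sigma>..1} s * indicator {0..1} \<xi> = (\<Sum>n. ?t n \<xi> s)"
    for \<xi> s :: real
  proof (cases "\<xi> \<in> {0..1} \<and> s \<in> {-\<sigma>..1}")
    case True
    let ?w = "c * \<xi>\<^sup>2 * (1 + s\<^sup>2 / 3)"
    have w: "0 \<le> ?w" "?w < 1"
      using geometric_ratio_less_one[of c \<xi> s] True s c by auto
    have "(\<lambda>n. \<xi> / 4 * ?w ^ n) sums (\<xi> / 4 * (1 / (1 - ?w)))"
      using w by (intro sums_mult geometric_sums) auto
    moreover have "(\<lambda>n. \<xi> / 4 * ?w ^ n) = (\<lambda>n. c ^ n / 4 * \<xi> ^ (2 * n + 1) * (1 + s\<^sup>2 / 3) ^ n)"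
      by (simp add: power_mult_distrib power_mult fun_eq_iff)
    moreover have "\<xi> / 4 * (1 / (1 - ?w)) = \<xi> / (4 * (1 - ?w))"
      by simp
    ultimately have "(\<lambda>n. c ^ n / 4 * \<xi> ^ (2 * n + 1) * (1 + s\<^sup>2 / 3) ^ n) sums (\<xi> / (4 * (1 - ?w)))"
      by metis
    moreover have "0 \<le> c ^ n / 4 * \<xi> ^ (2 * n + 1) * (1 + s\<^sup>2 / 3) ^ n" for n
      using True c by (intro mult_nonneg_nonneg) (auto simp: add_nonneg_nonneg)
    ultimately have "(\<Sum>n. ennreal (c ^ n / 4 * \<xi> ^ (2 * n + 1) * (1 + s\<^sup>2 / 3) ^ n)) = ennreal (\<xi> / (4 * (1 - ?w)))"
      by (intro suminf_ennreal_eq)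
    then show ?thesis using True by simp
  qed auto
  have mom: "(\<integral>\<^sup>+ \<xi>. \<integral>\<^sup>+ s. ?t n \<xi> s \<partial>lborel \<partial>lborel) = ennreal ((1 + \<sigma>) / 8 * density_series c n)" for n
  proof -
    have "(\<integral>\<^sup>+ \<xi>. \<integral>\<^sup>+ s. ?t n \<xi> s \<partial>lborel \<partial>lborel) = 
      (\<integral>\<^sup>+ \<xi>. \<integral>\<^sup>+ s. (ennreal (c ^ n / 4 * \<xi> ^ (2 * n + 1)) * indicator {0..1} \<xi>) * (ennreal ((1 + s\<^sup>2 / 3) ^ n) * indicator {-\<sigma>..1} s) \<partial>lborel \<partial>lborel)"
    proof (intro nn_integral_cong)
      fix \<xi> s :: real
      have "ennreal (c ^ n / 4 * \<xi> ^ (2 * n + 1) * (1 + s\<^sup>2 / 3) ^ n) =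
          ennreal (c ^ n / 4 * \<xi> ^ (2 * n + 1)) * ennreal ((1 + s\<^sup>2 / 3) ^ n)"
        by (rule ennreal_mult'') simp
      then show "?t n \<xi> s = (ennreal (c ^ n / 4 * \<xi> ^ (2 * n + 1)) * indicator {0..1} \<xi>) *
          (ennreal ((1 + s\<^sup>2 / 3) ^ n) * indicator {-\<sigma>..1} s)"
        by (simp only: mult_ac)
    qed
    also have "\<dots> = (\<integral>\<^sup>+ \<xi>. (ennreal (c ^ n / 4 * \<xi> ^ (2 * n + 1)) * indicator {0..1} \<xi>) * ennreal ((1 + \<sigma>) * moment n) \<partial>lborel)"
      by (subst nn_integral_cmult) (auto simp: nn_integral_moment[OF s])
    also have "\<dots> = (\<integral>\<^sup>+ \<xi>. (ennreal (c ^ n / 4 * \<xi> ^ (2 * n + 1)) * indicator {0..1} \<xi>) \<partial>lborel) * ennreal ((1 + \<sigma>) * moment n)"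
      by (rule nn_integral_multc) simp
    also have "(\<integral>\<^sup>+ \<xi>. (ennreal (c ^ n / 4 * \<xi> ^ (2 * n + 1)) * indicator {0..1} \<xi>) \<partial>lborel) =
      ennreal (c ^ n / (8 * (real n + 1)) * 1 ^ (2 * n + 2) - c ^ n / (8 * (real n + 1)) * 0 ^ (2 * n + 2))"
    proof (rule nn_integral_FTC_Icc)
      fix x :: real
      show "((\<lambda>x. c ^ n / (8 * (real n + 1)) * x ^ (2 * n + 2)) has_real_derivative c ^ n / 4 * x ^ (2 * n + 1)) (at x)"
      proof -
        define k where "k = c ^ n / (8 * (real n + 1))"
        have "((\<lambda>x. k * x ^ (2 * n + 2)) has_real_derivative k * (2 * (real n + 1)) * x ^ (2 * n + 1)) (at x)"
          by (rule derivative_eq_intros refl | simp)+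
        moreover have "k * (2 * (real n + 1)) = c ^ n / 4"
          by (simp add: k_def divide_simps)
        ultimately show ?thesis by (simp only: k_def)
      qed
    qed (use c in auto)
    also have "\<dots> * ennreal ((1 + \<sigma>) * moment n) = ennreal ((1 + \<sigma>) / 8 * density_series c n)"
    proof -
      have "c ^ n / (8 * (real n + 1)) * 1 ^ (2 * n + 2) - c ^ n / (8 * (real n + 1)) * 0 ^ (2 * n + 2) =
          c ^ n / (8 * (real n + 1))" by simp
      moreover have "ennreal (c ^ n / (8 * (real n + 1))) * ennreal ((1 + \<sigma>) * moment n) =
          ennreal (c ^ n / (8 * (real n + 1)) * ((1 + \<sigma>) * moment n))"
        using c by (intro ennreal_mult'[symmetric]) simp
      moreover have "c ^ n / (8 * (real n + 1)) * ((1 + \<sigma>) * moment n) = (1 + \<sigma>) / 8 * density_series c n"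
        by (simp add: density_series_def)
      ultimately show ?thesis by metis
    qed
    finally show ?thesis .
  qed
  have "emeasure lborel (region \<sigma> a b) = (\<integral>\<^sup>+ \<xi>. \<integral>\<^sup>+ s. (\<Sum>n. ?t n \<xi> s) \<partial>lborel \<partial>lborel)"
    unfolding emeasure_region_aux[OF assms] c_def[symmetric] geo ..
  also have "\<dots> = (\<integral>\<^sup>+ \<xi>. (\<Sum>n. \<integral>\<^sup>+ s. ?t n \<xi> s \<partial>lborel) \<partial>lborel)"
    by (intro nn_integral_cong nn_integral_suminf) measurable
  also have "\<dots> = (\<Sum>n. \<integral>\<^sup>+ \<xi>. \<integral>\<^sup>+ s. ?t n \<xi> s \<partial>lborel \<partial>lborel)"
    by (intro nn_integral_suminf) measurable
  also have "\<dots> = (\<Sum>n. ennreal ((1 + \<sigma>) / 8 * density_series c n))"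
    by (simp only: mom)
  also have "\<dots> = ennreal ((1 + \<sigma>) / 8 * suminf (density_series c))"
    using s density_series_nonneg[OF c(1)] by (intro suminf_ennreal_eq sums_mult summable_sums density_series_summable c) auto
  finally show ?thesis unfolding c_def .
qed

section \<open>Numerical value of the density\<close>

text \<open>
  Fixed-point evaluation, with scale \<open>10 ^ 12\<close>, of \<open>q ^ n\<close>, \<open>c ^ n * moment n\<close> and the partial sums
  of \<open>density_series c\<close>, where \<open>q = c * 4 / 3\<close>.  Rounding is downwards for \<open>r = 0\<close> and upwards for \<open>r = 1\<close>.
\<close>

fun fixed_point :: "int \<Rightarrow> int \<Rightarrow> int \<Rightarrow> nat \<Rightarrow> int \<times> int \<times> int" where
  "fixed_point r A B 0 = (10 ^ 12, 10 ^ 12, 0)"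
| "fixed_point r A B (Suc n) = (case fixed_point r A B n of (Q, T, S) \<Rightarrow>
     let Q' = Q * B div 10 ^ 12 + r in
     (Q', (Q' * 10 ^ 12 + 2 * (int n + 1) * T * A) div (10 ^ 12 * (2 * int n + 3)) + r,
      S + T div (int n + 1) + r))"

lemma real_div_bounds:
  fixes a b :: int
  shows "real_of_int (a div b) \<le> a / b" "a / b \<le> real_of_int (a div b) + 1"
  unfolding floor_divide_of_int_eq[symmetric, where 'a=real] by linarith+

text \<open>For \<open>c \<ge> 0\<close> the scaled quantities are at most
  \<open>(c * 4 / 3) ^ n\<close>, hence suited to fixed-point arithmetic, whereas
  \<open>moment n\<close> itself grows with \<open>n\<close>.\<close>

lemma power_moment_Suc:
  "c ^ Suc n * moment (Suc n) =
     ((c * 4 / 3) ^ Suc n + 2 * (real n + 1) * (c ^ n * moment n) * c) / (2 * real n + 3)"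
  unfolding moment_rec by (simp add: divide_simps power_mult_distrib) (simp add: algebra_simps)

lemma rescale_fraction:
  fixes r :: real
  assumes "r \<noteq> 0"
  shows "(r * x * r + k * (r * y) * (r * c)) / (r * d) = r * ((x + k * y * c) / d)"
  using assms by (cases "d = 0") (auto simp: field_simps)

text \<open>Every operation of the recursion is monotone on nonnegative numbers, so rounding down
  preserves lower bounds; nonnegativity therefore belongs to the induction. The sum advances with
  the old \<open>T\<close>, so after \<open>n\<close> rounds it covers the indices below
  \<open>n\<close>.\<close>

lemma fixed_point_lower:
  fixes c :: real
  assumes "0 \<le> A" "0 \<le> B" "A \<le> 10 ^ 12 * c" "B \<le> 10 ^ 12 * (c * 4 / 3)"
    and "fixed_point 0 A B n = (Q, T, S)"
  shows "0 \<le> Q \<and> Q \<le> 10 ^ 12 * (c * 4 / 3) ^ n \<and> 0 \<le> T \<and> T \<le> 10 ^ 12 * (c ^ n * moment n) \<and>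
    S \<le> 10 ^ 12 * sum (density_series c) {..<n}"
  using assms(5)
proof (induction n arbitrary: Q T S)
  case 0
  then show ?case by (simp add: moment_rec)
next
  case (Suc n)
  obtain Q0 T0 S0 where fp: "fixed_point 0 A B n = (Q0, T0, S0)" by (metis prod_cases3)
  note IH = Suc.IH[OF fp]
  have Q: "Q = Q0 * B div 10 ^ 12"
    and T: "T = (Q * 10 ^ 12 + 2 * (int n + 1) * T0 * A) div (10 ^ 12 * (2 * int n + 3))"
    and S: "S = S0 + T0 div (int n + 1)"
    using Suc.prems by (auto simp: fp Let_def)
  have "real_of_int Q \<le> real_of_int (Q0 * B) / real_of_int (10 ^ 12)" unfolding Q by (rule real_div_bounds)
  also have "\<dots> = real_of_int Q0 * real_of_int B / 10 ^ 12" by simp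
  also have "\<dots> \<le> (10 ^ 12 * (c * 4 / 3) ^ n) * (10 ^ 12 * (c * 4 / 3)) / 10 ^ 12"
    using IH assms by (intro divide_right_mono mult_mono) auto
  finally have Q1: "Q \<le> 10 ^ 12 * (c * 4 / 3) ^ Suc n" by simp
  have Q2: "0 \<le> Q" unfolding Q using IH assms by (simp add: pos_imp_zdiv_nonneg_iff)
  have "real_of_int T \<le> real_of_int (Q * 10 ^ 12 + 2 * (int n + 1) * T0 * A) / real_of_int (10 ^ 12 * (2 * int n + 3))"
    unfolding T by (rule real_div_bounds)
  also have "\<dots> = (Q * 10 ^ 12 + 2 * (real n + 1) * T0 * A) / (10 ^ 12 * (2 * real n + 3))" by simp
  also have "\<dots> \<le> ((10 ^ 12 * (c * 4 / 3) ^ Suc n) * 10 ^ 12 + 2 * (real n + 1) * (10 ^ 12 * (c ^ n * moment n)) * (10 ^ 12 * c)) / (10 ^ 12 * (2 * real n + 3))"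
    using IH Q1 assms by (intro divide_right_mono add_mono mult_mono order_refl) auto
  also have "\<dots> = 10 ^ 12 * (c ^ Suc n * moment (Suc n))"
    unfolding power_moment_Suc by (rule rescale_fraction) simp
  finally have T1: "T \<le> 10 ^ 12 * (c ^ Suc n * moment (Suc n))" .
  have T2: "0 \<le> T" unfolding T using IH Q2 assms by (intro pos_imp_zdiv_nonneg_iff[THEN iffD2]) auto
  have "real_of_int S \<le> S0 + T0 / (real n + 1)"
    using real_div_bounds(1)[of T0 "int n + 1"] by (simp add: S)
  also have "\<dots> \<le> 10 ^ 12 * sum (density_series c) {..<n} + 10 ^ 12 * (c ^ n * moment n) / (real n + 1)"
    using IH by (intro add_mono divide_right_mono) auto
  finally have "S \<le> 10 ^ 12 * sum (density_series c) {..<Suc n}" by (simp add: density_series_def algebra_simps)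
  with Q1 Q2 T1 T2 show ?case by blast
qed

text \<open>A floor quotient plus 1 dominates the exact quotient. Nonnegativity of the integers
  follows from the bounds themselves, since they dominate nonnegative reals.\<close>

lemma fixed_point_upper:
  fixes c :: real
  assumes "0 \<le> c" "10 ^ 12 * c \<le> A" "10 ^ 12 * (c * 4 / 3) \<le> B"
    and "fixed_point 1 A B n = (Q, T, S)"
  shows "10 ^ 12 * (c * 4 / 3) ^ n \<le> Q \<and> 10 ^ 12 * (c ^ n * moment n) \<le> T \<and>
    10 ^ 12 * sum (density_series c) {..<n} \<le> S"
  using assms(4)
proof (induction n arbitrary: Q T S)
  case 0
  then show ?case by (simp add: moment_rec)
next
  case (Suc n)
  obtain Q0 T0 S0 where fp: "fixed_point 1 A B n = (Q0, T0, S0)" by (metis prod_cases3)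
  note IH = Suc.IH[OF fp]
  have Q: "Q = Q0 * B div 10 ^ 12 + 1"
    and T: "T = (Q * 10 ^ 12 + 2 * (int n + 1) * T0 * A) div (10 ^ 12 * (2 * int n + 3)) + 1"
    and S: "S = S0 + T0 div (int n + 1) + 1"
    using Suc.prems by (auto simp: fp Let_def)
  have m0: "0 \<le> c ^ n * moment n" using assms moment_bounds(1)[of n] by simp
  have nn: "0 \<le> 10 ^ 12 * (c ^ n * moment n)" "0 \<le> 10 ^ 12 * (c * 4 / 3) ^ n" using m0 assms by auto
  then have nnT: "0 \<le> real_of_int T0" "0 \<le> real_of_int Q0" using IH by linarith+
  have "0 \<le> 10 ^ 12 * c" "0 \<le> 10 ^ 12 * (c * 4 / 3)" using assms(1) by simp_all
  then have nnA: "0 \<le> real_of_int A" "0 \<le> real_of_int B" using assms(2,3) by linarith+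
  have "(10 ^ 12 * (c * 4 / 3) ^ n) * (10 ^ 12 * (c * 4 / 3)) / 10 ^ 12 \<le> real_of_int Q0 * real_of_int B / 10 ^ 12"
    using IH assms nnT by (intro divide_right_mono mult_mono) auto
  also have "\<dots> \<le> real_of_int Q" unfolding Q using real_div_bounds(2)[of "Q0 * B" "10 ^ 12"] by simp
  finally have Q1: "10 ^ 12 * (c * 4 / 3) ^ Suc n \<le> Q" by simp
  have "10 ^ 12 * (c ^ Suc n * moment (Suc n)) = ((10 ^ 12 * (c * 4 / 3) ^ Suc n) * 10 ^ 12 + 2 * (real n + 1) * (10 ^ 12 * (c ^ n * moment n)) * (10 ^ 12 * c)) / (10 ^ 12 * (2 * real n + 3))"
    unfolding power_moment_Suc by (rule rescale_fraction[symmetric]) simp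
  also have "\<dots> \<le> (Q * 10 ^ 12 + 2 * (real n + 1) * T0 * A) / (10 ^ 12 * (2 * real n + 3))"
    using IH Q1 assms nnT m0 nnA by (intro divide_right_mono add_mono mult_mono order_refl) auto
  also have "\<dots> = real_of_int (Q * 10 ^ 12 + 2 * (int n + 1) * T0 * A) / real_of_int (10 ^ 12 * (2 * int n + 3))" by simp
  also have "\<dots> \<le> real_of_int ((Q * 10 ^ 12 + 2 * (int n + 1) * T0 * A) div (10 ^ 12 * (2 * int n + 3))) + 1"
    by (rule real_div_bounds)
  also have "\<dots> = real_of_int T" unfolding T by simp
  finally have T1: "10 ^ 12 * (c ^ Suc n * moment (Suc n)) \<le> T" .
  have "10 ^ 12 * sum (density_series c) {..<n} + 10 ^ 12 * (c ^ n * moment n) / (real n + 1) \<le> S0 + T0 / (real n + 1)"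
    using IH by (intro add_mono divide_right_mono) auto
  also have "\<dots> \<le> real_of_int S" 
    using real_div_bounds(2)[of T0 "int n + 1"] by (simp add: S)
  finally have "10 ^ 12 * sum (density_series c) {..<Suc n} \<le> S" by (simp add: density_series_def algebra_simps)
  with Q1 T1 show ?case by blast
qed

text \<open>The tail is compared with a geometric series of ratio \<open>c * 4 / 3\<close>, the
  denominators being frozen at \<open>real n + 1\<close>.\<close>

lemma suminf_density_series_bounds:
  assumes "0 \<le> c" "c < 3 / 4"
  shows "sum (density_series c) {..<n} \<le> suminf (density_series c)"
    and "suminf (density_series c) \<le> sum (density_series c) {..<n} + (c * 4 / 3) ^ n / ((real n + 1) * (1 - c * 4 / 3))"
proof -
  have sm: "summable (density_series c)" by (rule density_series_summable[OF assms])
  show "sum (density_series c) {..<n} \<le> suminf (density_series c)"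
    using assms by (intro sum_le_suminf sm) (auto intro: density_series_nonneg)
  let ?q = "c * 4 / 3"
  have geo: "(\<lambda>i. ?q ^ n / (real n + 1) * ?q ^ i) sums (?q ^ n / (real n + 1) * (1 / (1 - ?q)))"
    using assms by (intro sums_mult geometric_sums) auto
  have "(\<Sum>i. density_series c (i + n)) \<le> (\<Sum>i. ?q ^ n / (real n + 1) * ?q ^ i)"
  proof (rule suminf_le)
    fix i
    have "density_series c (i + n) \<le> ?q ^ (i + n) / (real (i + n) + 1)" by (rule density_series_le[OF assms(1)])
    also have "\<dots> \<le> ?q ^ (i + n) / (real n + 1)" using assms by (intro divide_left_mono) auto
    finally show "density_series c (i + n) \<le> ?q ^ n / (real n + 1) * ?q ^ i" by (simp add: power_add mult.commute)
  qed (use sm geo in \<open>auto simp: summable_iff_shift sums_iff\<close>)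
  also have "\<dots> = ?q ^ n / ((real n + 1) * (1 - ?q))"
    using geo by (simp add: sums_iff)
  finally show "suminf (density_series c) \<le> sum (density_series c) {..<n} + ?q ^ n / ((real n + 1) * (1 - ?q))"
    using suminf_split_initial_segment[OF sm, of n] by simp
qed

text \<open>For \<theta> = \<pi>/5 the relation 3\<theta> = \<pi> - 2\<theta> gives a cubic equation
  for the cosine with the factor \<open>x + 1\<close>; comparison with \<open>cos (pi / 3)\<close>
  selects the root of the remaining quadratic.\<close>

lemma cos_pi_5: "cos (pi / 5) = (1 + sqrt 5) / 4"
proof -
  let ?x = "cos (pi / 5)"
  have p: "?x > 0" by (rule cos_gt_zero) auto
  have "3 * (pi / 5) = pi - 2 * (pi / 5)" by simp
  then have "cos (3 * (pi / 5)) = - cos (2 * (pi / 5))" by (simp only: cos_pi_minus)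
  then have "4 * ?x ^ 3 - 3 * ?x = - (2 * ?x\<^sup>2 - 1)"
    unfolding cos_treble_cos cos_double_cos .
  then have "(?x + 1) * (4 * ?x\<^sup>2 - 2 * ?x - 1) = 0"
    by (simp add: algebra_simps power2_eq_square power3_eq_cube)
  then have "4 * ?x\<^sup>2 - 2 * ?x - 1 = 0" using p by simp
  then have "(4 * ?x - 1)\<^sup>2 = 5" by (simp add: algebra_simps power2_eq_square)
  moreover have "4 * ?x - 1 \<ge> 0"
  proof -
    have "cos (pi / 3) \<le> ?x" by (intro cos_monotone_0_pi_le) auto
    then show ?thesis by (simp add: cos_60)
  qed
  ultimately have "4 * ?x - 1 = sqrt 5" by (metis real_sqrt_unique)
  then show ?thesis by simp
qed

text \<open>The arguments are \<open>10 ^ 12 * c\<close> and \<open>10 ^ 12 * (c * 4 / 3)\<close>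
  rounded down, for \<open>c = (3 + sqrt 5) / 8\<close>. Ninety terms bring
  \<open>(c * 4 / 3) ^ n\<close> below \<open>5 / 10 ^ 6\<close>, and with it the tail of the series
  below \<open>6 / 10 ^ 7\<close>.\<close>

lemma fixed_point_value_lower: "snd (snd (fixed_point 0 654508497187 872677996249 90)) \<ge> 1815405500000"
  by code_simp

lemma fixed_point_value_upper:
  "(case fixed_point 1 654508497188 872677996250 90 of (Q, T, S) \<Rightarrow> Q \<le> 5000000 \<and> S \<le> 1815405600000)"
  by code_simp

lemma density_value: "\<bar>1 / suminf (density_series ((cos (pi / 5))\<^sup>2)) - 0.550841\<bar> < 1 / 10 ^ 6"
proof -
  define c where "c = (cos (pi / 5))\<^sup>2"
  have c: "c = (3 + sqrt 5) / 8" by (simp add: c_def cos_pi_5 power_divide power2_eq_square algebra_simps)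
  have s5: "2.236067977499 \<le> sqrt 5" "sqrt 5 \<le> 2.236067977500"
    by (rule real_le_rsqrt real_le_lsqrt; simp add: power2_eq_square)+
  have cb: "0 \<le> c" "c < 3 / 4" "654508497187 \<le> 10 ^ 12 * c" "10 ^ 12 * c \<le> 654508497188"
    "872677996249 \<le> 10 ^ 12 * (c * 4 / 3)" "10 ^ 12 * (c * 4 / 3) \<le> 872677996250"
    using s5 by (simp_all add: c field_simps)
  let ?S = "suminf (density_series c)"
  obtain Q T S where fp: "fixed_point 0 654508497187 872677996249 90 = (Q, T, S)" by (metis prod_cases3)
  obtain Q' T' S' where fp': "fixed_point 1 654508497188 872677996250 90 = (Q', T', S')" by (metis prod_cases3)
  \<comment> \<open>Keeps the literal 90 opaque, so that simplification does not unroll the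
    evaluation.\<close>
  define N :: nat where "N = 90"
  note fp = fp[folded N_def] and fp' = fp'[folded N_def]
  have "1815405500000 \<le> S" using fixed_point_value_lower unfolding N_def[symmetric] fp by simp
  then have "1815405500000 \<le> real_of_int S" by linarith
  also have "S \<le> 10 ^ 12 * sum (density_series c) {..<N}"
    using fixed_point_lower[OF _ _ _ _ fp, of c] cb by simp
  also have "\<dots> \<le> 10 ^ 12 * ?S" using suminf_density_series_bounds(1)[OF cb(1,2), of N] by simp
  finally have lo: "1.8154055 \<le> ?S" by simp
  have "Q' \<le> 5000000 \<and> S' \<le> 1815405600000"
    using fixed_point_value_upper unfolding N_def[symmetric] fp' by simp
  then have "real_of_int Q' \<le> 5000000" "real_of_int S' \<le> 1815405600000" by linarith+
  moreover have "10 ^ 12 * (c * 4 / 3) ^ N \<le> real_of_int Q'" "10 ^ 12 * sum (density_series c) {..<N} \<le> real_of_int S'"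
    using fixed_point_upper[OF _ _ _ fp', of c] cb by simp_all
  ultimately have up: "(c * 4 / 3) ^ N \<le> 5 / 10 ^ 6" "sum (density_series c) {..<N} \<le> 1.8154056" by simp_all
  have "?S \<le> sum (density_series c) {..<N} + (c * 4 / 3) ^ N / ((real N + 1) * (1 - c * 4 / 3))"
    by (rule suminf_density_series_bounds(2)[OF cb(1,2)])
  also have "\<dots> \<le> 1.8154056 + 5 / 10 ^ 6 / ((90 + 1) * (1 / 10))"
    using cb by (intro add_mono up frac_le mult_mono) (auto simp: N_def)
  also have "\<dots> \<le> 1.8154065" by simp
  finally have hi: "?S \<le> 1.8154065" .
  \<comment> \<open>The derivative of the reciprocal near 1.8154 has absolute value about 0.3, so an
    uncertainty of \<open>1 / 10 ^ 6\<close> in the sum is harmless.\<close>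
  have "1 / ?S \<le> 1 / 1.8154055" "1 / 1.8154065 \<le> 1 / ?S" using lo hi by (intro divide_left_mono; simp)+
  moreover have "1 / 1.8154055 < (0.550842 :: real)" "0.550840 < (1 / 1.8154065 :: real)" by simp_all
  ultimately have "1 / ?S < 0.550842" "0.550840 < 1 / ?S" by linarith+
  then show ?thesis unfolding c_def[symmetric] abs_less_iff by simp
qed

section \<open>Orbits of reflection groups\<close>

lemma mink_add_right: "mink z (x + y) = mink z x + mink z y"
  by (simp add: mink_def algebra_simps)

lemma mink_scale_right: "mink z (c *\<^sub>R x) = c * mink z x"
  by (simp add: mink_def algebra_simps)

lemma mink_diff_left: "mink (x - y) z = mink x z - mink y z"
  by (simp add: mink_def algebra_simps)

lemma mink_diff_right: "mink z (x - y) = mink z x - mink z y"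
  by (simp add: mink_def algebra_simps)

lemma mink_minus_left: "mink (- x) z = - mink x z"
  by (simp add: mink_def algebra_simps)

lemma mink_minus_right: "mink z (- x) = - mink z x"
  by (simp add: mink_def algebra_simps)

lemma mink_sum_right: "mink z (\<Sum>i\<in>A. f i) = (\<Sum>i\<in>A. mink z (f i))"
  by (simp add: mink_sum_left mink_commute[of z])

lemmas mink_linear = mink_add_left mink_add_right mink_scale_left mink_scale_right mink_diff_left
  mink_diff_right mink_minus_left mink_minus_right

lemma linear_reflection: "linear (reflection u)"
  by (rule linearI) (auto simp: reflection_def mink_linear algebra_simps scaleR_add_left)

text \<open>The orbit argument sees the normals through their Gram matrix alone, so it is carried
  out for any finite family of unit vectors with these products.\<close>

locale coxeter_vectors =
  fixes u :: "'i::finite \<Rightarrow> mvec" and M :: "'i \<Rightarrow> 'i \<Rightarrow> nat"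
  assumes unit: "mink (u i) (u i) = 1"
    and M_ge_2: "i \<noteq> j \<Longrightarrow> M i j \<ge> 2"
    and angle: "i \<noteq> j \<Longrightarrow> mink (u i) (u j) = - cos (pi / M i j)"
begin

abbreviation s :: "'i \<Rightarrow> mvec \<Rightarrow> mvec" where "s i \<equiv> reflection (u i)"

primrec wd :: "'i list \<Rightarrow> mvec \<Rightarrow> mvec" where
  "wd [] = id"
| "wd (i # ws) = s i \<circ> wd ws"

lemma wd_append: "wd (xs @ ys) = wd xs \<circ> wd ys"
  by (induction xs) (simp_all add: o_assoc)

lemma linear_wd: "linear (wd ws)"
proof (induction ws)
  case Nil
  show ?case unfolding wd.simps by (rule linear_id)
next
  case (Cons i ws)
  show ?case unfolding wd.simps by (rule linear_compose[OF Cons linear_reflection])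
qed

lemma s_self: "s i (u i) = - u i"
  by (simp add: reflection_def unit algebra_simps scaleR_2)

lemma s_s: "s i (s i x) = x"
  by (simp add: reflection_def mink_linear unit algebra_simps)

lemma mink_s: "mink (s i x) (s i y) = mink x y"
  by (simp add: reflection_def mink_linear unit mink_commute algebra_simps)

lemma mink_wd: "mink (wd ws x) (wd ws y) = mink x y"
  by (induction ws) (simp_all add: mink_s)

lemma wd_rev: "wd ws (wd (rev ws) x) = x"
  by (induction ws arbitrary: x) (simp_all add: wd_append s_s)

section \<open>Positive combinations of the normals and reduced words\<close>

definition pos :: "mvec \<Rightarrow> bool" where
  "pos x \<longleftrightarrow> (\<exists>a. (\<forall>i. 0 \<le> a i) \<and> x = (\<Sum>i\<in>UNIV. a i *\<^sub>R u i))"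

lemma pos_u: "pos (u i)"
proof -
  have "u i = (\<Sum>j\<in>UNIV. (if j = i then 1 else 0) *\<^sub>R u j)"
    by (simp add: if_distrib[of "\<lambda>c. c *\<^sub>R _"] cong: if_cong)
  then show ?thesis unfolding pos_def by (intro exI[of _ "\<lambda>j. if j = i then 1 else 0"]) auto
qed

lemma pos_add: "pos x \<Longrightarrow> pos y \<Longrightarrow> pos (x + y)"
  unfolding pos_def
  by (elim exE, rule_tac x="\<lambda>i. a i + aa i" in exI) (auto simp: scaleR_add_left sum.distrib)

lemma pos_scale: "0 \<le> c \<Longrightarrow> pos x \<Longrightarrow> pos (c *\<^sub>R x)"
  unfolding pos_def
  by (elim exE, rule_tac x="\<lambda>i. c * a i" in exI) (auto simp: scaleR_sum_right)

definition reduced :: "'i list \<Rightarrow> bool" where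
  "reduced ws \<longleftrightarrow> (\<forall>ws'. wd ws' = wd ws \<longrightarrow> length ws \<le> length ws')"

text \<open>For reduced \<open>ws\<close>, right multiplication by \<open>s i\<close> does not
  decrease the word length. The inequality is weak, so its failure produces a word strictly shorter
  than \<open>ws\<close>.\<close>

definition ascent :: "'i list \<Rightarrow> 'i \<Rightarrow> bool" where
  "ascent ws i \<longleftrightarrow> (\<forall>ws'. wd ws' = wd ws \<circ> s i \<longrightarrow> length ws \<le> length ws')"

lemma obtain_reduced: obtains ws' where "wd ws' = wd ws" "reduced ws'"
proof -
  obtain ws' where "wd ws' = wd ws" "\<And>y. wd y = wd ws \<Longrightarrow> length ws' \<le> length y"
    using ex_has_least_nat[of "\<lambda>w. wd w = wd ws" ws length] by auto
  then show ?thesis using that by (auto simp: reduced_def)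
qed

lemma reduced_left: "reduced (xs @ ys) \<Longrightarrow> reduced xs"
  unfolding reduced_def using wd_append by (metis add_le_cancel_right length_append)

lemma reduced_right: "reduced (xs @ ys) \<Longrightarrow> reduced ys"
  unfolding reduced_def using wd_append by (metis add_le_cancel_left length_append)

section \<open>Dihedral subgroups\<close>

primrec alt :: "nat \<Rightarrow> 'i \<Rightarrow> 'i \<Rightarrow> 'i list" where
  "alt 0 i j = []"
| "alt (Suc k) i j = alt k j i @ [j]"

lemma length_alt [simp]: "length (alt k i j) = k"
  by (induction k arbitrary: i j) auto

lemma alt_split: "\<exists>p. length p = r \<and> alt (r + k) i j = p @ alt k i j"
proof (induction k arbitrary: i j)
  case 0
  show ?case by (rule exI[of _ "alt r i j"]) simp
next
  case (Suc k)
  obtain p where "length p = r" "alt (r + k) j i = p @ alt k j i" using Suc[of j i] by (elim exE conjE)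
  then show ?case by (intro exI[of _ p]) simp
qed

lemma wd_snoc_cancel: "wd (xs @ [i]) \<circ> s i = wd xs"
  by (auto simp: wd_append s_s fun_eq_iff)

text \<open>Equal neighbouring letters would cancel. The word \<open>alt k i j\<close> is the
  alternating one that ends in \<open>j\<close>, and the last letter is the one that acts
  first.\<close>

lemma reduced_imp_alt:
  assumes "set d \<subseteq> {i, j}" "reduced d" "d \<noteq> [] \<Longrightarrow> last d \<noteq> i"
  shows "d = alt (length d) i j"
  using assms
proof (induction d arbitrary: i j rule: rev_induct)
  case (snoc x e)
  have x: "x = j" using snoc.prems by auto
  have "last e \<noteq> j" if "e \<noteq> []"
  proof
    assume l: "last e = j"
    define e0 where "e0 = butlast e"
    have e: "e = e0 @ [j]" using append_butlast_last_id[OF \<open>e \<noteq> []\<close>] l by (simp add: e0_def)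
    have "wd (e @ [x]) = wd e0" using wd_snoc_cancel[of e0 j] by (simp add: e x wd_append o_assoc)
    then show False using snoc.prems(2) unfolding reduced_def by (auto simp: e dest!: spec[of _ e0])
  qed
  then have "e = alt (length e) j i"
    using snoc.prems reduced_left by (intro snoc.IH) auto
  then show ?case using x by simp
qed simp

text \<open>Both sides satisfy the Chebyshev recursion of the sines of multiples of \<theta>. The
  two orders of the letters are treated together because each step of the recursion swaps
  them.\<close>

lemma alt_formula:
  assumes "i \<noteq> j" "\<theta> = pi / M i j"
  shows "sin \<theta> *\<^sub>R wd (alt k i j) (u i) =
      sin (real (Suc k) * \<theta>) *\<^sub>R u (if even k then i else j) + sin (real k * \<theta>) *\<^sub>R u (if even k then j else i) \<and>
    sin \<theta> *\<^sub>R wd (alt k j i) (u j) =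
      sin (real (Suc k) * \<theta>) *\<^sub>R u (if even k then j else i) + sin (real k * \<theta>) *\<^sub>R u (if even k then i else j)"
    (is "?P k")
proof -
  have ij: "mink (u i) (u j) = - cos \<theta>" "mink (u j) (u i) = - cos \<theta>"
    using angle[OF assms(1)] assms(2) by (simp_all add: mink_commute)
  have su: "s j (u i) = u i + (2 * cos \<theta>) *\<^sub>R u j" "s i (u j) = u j + (2 * cos \<theta>) *\<^sub>R u i"
    by (simp_all add: reflection_def ij)
  have rec: "wd (alt (Suc (Suc k)) i j) (u i) = (2 * cos \<theta>) *\<^sub>R wd (alt (Suc k) j i) (u j) - wd (alt k i j) (u i)"
    "wd (alt (Suc (Suc k)) j i) (u j) = (2 * cos \<theta>) *\<^sub>R wd (alt (Suc k) i j) (u i) - wd (alt k j i) (u j)" for k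
    by (simp_all add: wd_append su s_self linear_add[OF linear_wd] linear_cmul[OF linear_wd] linear_neg[OF linear_wd] linear_diff[OF linear_wd]
        linear_add[OF linear_reflection] linear_cmul[OF linear_reflection])
  have sn: "sin (real (Suc (Suc k)) * \<theta>) = 2 * cos \<theta> * sin (real (Suc k) * \<theta>) - sin (real k * \<theta>)" for k
  proof -
    have "sin (x + \<theta>) = 2 * cos \<theta> * sin x - sin (x - \<theta>)" for x by (simp add: sin_add sin_diff)
    from this[of "real (Suc k) * \<theta>"] show ?thesis by (simp add: algebra_simps)
  qed
  show ?thesis
  proof (induction k rule: induct_nat_012)
    case 1
    have "sin (real (Suc 1) * \<theta>) = 2 * cos \<theta> * sin \<theta>" using sn[of 0] by simp
    then show ?case by (simp add: su scaleR_add_right mult.commute)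
  next
    case (ge2 k)
    define a b where "a = sin (real k * \<theta>)" and "b = sin (real (Suc k) * \<theta>)"
    have d: "sin (real (Suc (Suc k)) * \<theta>) = 2 * cos \<theta> * b - a"
      "sin (real (Suc (Suc (Suc k))) * \<theta>) = 2 * cos \<theta> * (2 * cos \<theta> * b - a) - b"
      by (simp_all only: sn a_def b_def)
    have "sin \<theta> *\<^sub>R ((2 * cos \<theta>) *\<^sub>R x - y) = (2 * cos \<theta>) *\<^sub>R (sin \<theta> *\<^sub>R x) - sin \<theta> *\<^sub>R y" for x y :: mvec
      by (simp add: scaleR_diff_right mult.commute)
    note e = this
    show ?case unfolding rec e ge2[THEN conjunct1] ge2[THEN conjunct2] d unfolding a_def[symmetric] b_def[symmetric]
      by (simp add: scaleR_diff_left scaleR_diff_right scaleR_add_right right_diff_distrib)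
  qed simp
qed

lemma sin_angle_pos: "i \<noteq> j \<Longrightarrow> sin (pi / M i j) > 0"
proof (rule sin_gt_zero)
  assume "i \<noteq> j"
  then have "2 \<le> real (M i j)" using M_ge_2[of i j] by simp
  then have "pi / real (M i j) \<le> pi / 2" by (intro divide_left_mono) auto
  then show "pi / real (M i j) < pi" "0 < pi / real (M i j)"
    using \<open>2 \<le> real (M i j)\<close> pi_gt_zero by (linarith, simp)
qed

text \<open>The two maps agree on \<open>u i\<close> and \<open>u j\<close> by the sine formula at
  \<open>M i j * \<theta> = pi\<close>, and both fix the vectors orthogonal to these two. Together
  these span the space, since the Gram determinant \<open>(sin \<theta>)\<^sup>2\<close> is
  positive.\<close>

lemma braid:
  assumes "i \<noteq> j"
  shows "wd (alt (M i j) i j) = wd (alt (M i j) j i)"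
proof
  fix x
  define \<theta> where "\<theta> = pi / M i j"
  obtain m where m: "M i j = Suc m" using M_ge_2[OF assms] by (cases "M i j") auto
  have sp: "sin \<theta> > 0" using sin_angle_pos[OF assms] by (simp add: \<theta>_def)
  have "real (Suc m) * \<theta> = pi" by (simp add: \<theta>_def m)
  then have e: "real (Suc (Suc m)) * \<theta> = pi + \<theta>" "real m * \<theta> = pi - \<theta>" "real (Suc m) * \<theta> = pi"
    by (simp_all add: algebra_simps)
  have sn: "sin (real (Suc (Suc m)) * \<theta>) = - sin \<theta>" "sin (real (Suc m) * \<theta>) = 0" "sin (real m * \<theta>) = sin \<theta>"
    unfolding e by simp_all
  note F = alt_formula[OF assms \<theta>_def]
  let ?f = "wd (alt (Suc m) i j)" and ?g = "wd (alt (Suc m) j i)"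
  have "sin \<theta> *\<^sub>R ?f (u i) = - (sin \<theta> *\<^sub>R u (if even m then j else i))"
    using F[of "Suc m"] unfolding sn by (auto simp del: alt.simps)
  moreover have "?g (u i) = - wd (alt m i j) (u i)"
    by (simp add: wd_append s_self linear_neg[OF linear_wd])
  moreover have "sin \<theta> *\<^sub>R wd (alt m i j) (u i) = sin \<theta> *\<^sub>R u (if even m then j else i)"
    using F[of m] unfolding sn by auto
  ultimately have "sin \<theta> *\<^sub>R ?f (u i) = sin \<theta> *\<^sub>R ?g (u i)" by (metis scaleR_minus_right)
  then have fi: "?f (u i) = ?g (u i)" using sp by (simp del: alt.simps)
  have "sin \<theta> *\<^sub>R ?g (u j) = - (sin \<theta> *\<^sub>R u (if even m then i else j))"
    using F[of "Suc m"] unfolding sn by (auto simp del: alt.simps)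
  moreover have "?f (u j) = - wd (alt m j i) (u j)"
    by (simp add: wd_append s_self linear_neg[OF linear_wd])
  moreover have "sin \<theta> *\<^sub>R wd (alt m j i) (u j) = sin \<theta> *\<^sub>R u (if even m then i else j)"
    using F[of m] unfolding sn by auto
  ultimately have "sin \<theta> *\<^sub>R ?f (u j) = sin \<theta> *\<^sub>R ?g (u j)" by (metis scaleR_minus_right)
  then have fj: "?f (u j) = ?g (u j)" using sp by (simp del: alt.simps)
  have ij: "mink (u i) (u j) = - cos \<theta>" "mink (u j) (u i) = - cos \<theta>"
    using angle[OF assms] by (simp_all add: mink_commute \<theta>_def)
  \<comment> \<open>Coefficients of the orthogonal projection of \<open>x\<close> to the plane of
    \<open>u i\<close> and \<open>u j\<close>, from the Gram system by Cramer's rule.\<close>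
  define a where "a = (mink x (u i) + cos \<theta> * mink x (u j)) / (sin \<theta>)\<^sup>2"
  define b where "b = (mink x (u j) + cos \<theta> * mink x (u i)) / (sin \<theta>)\<^sup>2"
  define y where "y = x - a *\<^sub>R u i - b *\<^sub>R u j"
  have ab: "a - b * cos \<theta> = mink x (u i)" "b - a * cos \<theta> = mink x (u j)"
  proof -
    have "(a - b * cos \<theta>) * (sin \<theta>)\<^sup>2 = mink x (u i) * (1 - (cos \<theta>)\<^sup>2)"
      "(b - a * cos \<theta>) * (sin \<theta>)\<^sup>2 = mink x (u j) * (1 - (cos \<theta>)\<^sup>2)"
      using sp by (simp_all add: a_def b_def left_diff_distrib power2_eq_square) (simp_all add: algebra_simps)
    then show "a - b * cos \<theta> = mink x (u i)" "b - a * cos \<theta> = mink x (u j)"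
      using sp by (simp_all add: sin_squared_eq[symmetric])
  qed
  have "mink y (u i) = 0" "mink y (u j) = 0"
    using ab by (simp_all add: y_def mink_linear unit ij)
  then have "s i y = y" "s j y = y" by (simp_all add: reflection_def)
  then have "wd (alt k i j) y = y \<and> wd (alt k j i) y = y" for k
    by (induction k) (simp_all add: wd_append)
  then have fy: "?f y = ?g y" by (simp del: alt.simps)
  have "x = a *\<^sub>R u i + b *\<^sub>R u j + y" by (simp add: y_def)
  then show "wd (alt (M i j) i j) x = wd (alt (M i j) j i) x"
    unfolding m by (simp only: linear_add[OF linear_wd] linear_cmul[OF linear_wd] fi fj fy)
qed

text \<open>The word alternates and ends in \<open>j\<close>. Its length \<open>k\<close> is below
  \<open>M i j\<close>, since otherwise the braid relation would let it end in \<open>i\<close> and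
  \<open>s i\<close> would shorten it. Hence \<open>(k + 1) * \<theta> \<le> pi\<close>, and both
  sines in the formula are nonnegative.\<close>

lemma dihedral_pos:
  assumes "i \<noteq> j" "set d \<subseteq> {i, j}" "reduced d" "ascent d i"
  obtains a b where "0 \<le> a" "0 \<le> b" "wd d (u i) = a *\<^sub>R u i + b *\<^sub>R u j"
proof -
  define \<theta> where "\<theta> = pi / M i j"
  have last: "last d \<noteq> i" if "d \<noteq> []"
  proof
    assume l: "last d = i"
    define e where "e = butlast d"
    have e: "d = e @ [i]" using append_butlast_last_id[OF \<open>d \<noteq> []\<close>] l by (simp add: e_def)
    then have "wd e = wd d \<circ> s i" by (simp only: wd_snoc_cancel)
    then have "length d \<le> length e" using assms(4) unfolding ascent_def by blast
    then show False using e by simp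
  qed
  have d: "d = alt (length d) i j" using reduced_imp_alt[OF assms(2,3)] last by blast
  define k where "k = length d"
  have "k < M i j"
  proof (rule ccontr)
    assume "\<not> k < M i j"
    then obtain r where r: "k = r + M i j" by (metis add.commute le_iff_add not_less)
    obtain m where m: "M i j = Suc m" using M_ge_2[OF assms(1)] by (cases "M i j") auto
    obtain p where p: "length p = r" "d = p @ alt (M i j) i j"
      using alt_split[of r "M i j" i j] d by (auto simp: k_def[symmetric] r)
    have "wd d = wd (p @ alt m i j @ [i])"
      unfolding p(2) wd_append braid[OF assms(1)] by (simp add: m wd_append)
    then have "wd (p @ alt m i j) = wd d \<circ> s i"
      using wd_snoc_cancel[of "p @ alt m i j" i] by simp
    then have "k \<le> length (p @ alt m i j)" using assms(4) by (auto simp: ascent_def k_def)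
    then show False using p(1) r m by simp
  qed
  have "0 \<le> \<theta>" by (simp add: \<theta>_def)
  have "real (Suc k) * \<theta> \<le> real (M i j) * \<theta>"
    using \<open>k < M i j\<close> \<open>0 \<le> \<theta>\<close> by (intro mult_right_mono) auto
  also have "real (M i j) * \<theta> = pi" using M_ge_2[OF assms(1)] by (simp add: \<theta>_def)
  finally have "real (Suc k) * \<theta> \<le> pi" .
  moreover have "real k * \<theta> \<le> real (Suc k) * \<theta>" using \<open>0 \<le> \<theta>\<close> by (simp add: algebra_simps)
  ultimately have nn: "0 \<le> sin (real (Suc k) * \<theta>)" "0 \<le> sin (real k * \<theta>)"
    using \<open>0 \<le> \<theta>\<close> by (auto intro!: sin_ge_zero simp del: of_nat_Suc)
  have sp: "sin \<theta> > 0" using sin_angle_pos[OF assms(1)] by (simp add: \<theta>_def)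
  define A where "A = sin (real (Suc k) * \<theta>) / sin \<theta>"
  define B where "B = sin (real k * \<theta>) / sin \<theta>"
  have "wd d (u i) = (1 / sin \<theta>) *\<^sub>R (sin \<theta> *\<^sub>R wd (alt k i j) (u i))"
    using sp d by (simp add: k_def)
  also have "\<dots> = A *\<^sub>R u (if even k then i else j) + B *\<^sub>R u (if even k then j else i)"
    using alt_formula[OF assms(1) \<theta>_def, of k] by (simp add: A_def B_def scaleR_add_right del: of_nat_Suc)
  finally have "wd d (u i) = (if even k then A else B) *\<^sub>R u i + (if even k then B else A) *\<^sub>R u j"
    by (auto simp: add.commute)
  moreover have "0 \<le> A" "0 \<le> B" using nn sp by (auto simp: A_def B_def)
  then have "0 \<le> (if even k then A else B)" "0 \<le> (if even k then B else A)" by simp_all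
  ultimately show ?thesis by (intro that)
qed

text \<open>Tits' argument: peel off a maximal right factor in the dihedral subgroup generated by the last
  letter and \<open>i\<close>; the remaining left factor is shorter and has an ascent at both generators.\<close>

theorem ascent_pos:
  assumes "reduced ws" "ascent ws i"
  shows "pos (wd ws (u i))"
  using assms
proof (induction "length ws" arbitrary: ws i rule: less_induct)
  case less
  show ?case
  proof (cases ws rule: rev_cases)
    case Nil
    then show ?thesis by (simp add: pos_u)
  next
    case (snoc xs j)
    have "j \<noteq> i"
    proof
      assume "j = i"
      then have "wd xs = wd ws \<circ> s i" using snoc by (simp add: wd_snoc_cancel)
      then show False using less.prems(2) snoc by (auto simp: ascent_def)
    qed
    define P where "P h d \<longleftrightarrow> wd (h @ d) = wd ws \<and> length h + length d = length ws \<and> set d \<subseteq> {i, j}" for h d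
    have "\<exists>d. P xs d" using snoc by (intro exI[of _ "[j]"]) (auto simp: P_def)
    then obtain h where h: "\<exists>d. P h d" and hmin: "\<And>h'. \<exists>d. P h' d \<Longrightarrow> length h \<le> length h'"
      using ex_has_least_nat[of "\<lambda>h. \<exists>d. P h d" xs length] by metis
    obtain d where d: "wd (h @ d) = wd ws" "length h + length d = length ws" "set d \<subseteq> {i, j}"
      using h by (auto simp: P_def)
    have hlt: "length h < length ws" using hmin[OF \<open>\<exists>d. P xs d\<close>] snoc by simp
    have red: "reduced (h @ d)" using less.prems(1) d by (simp add: reduced_def)
    \<comment> \<open>With a word \<open>w\<close> for \<open>wd h \<circ> s t\<close> shorter than
      \<open>h\<close>, the letter \<open>t\<close> could move into the right factor, against the
      minimality of \<open>h\<close>.\<close>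
    have asc: "ascent h t" if "t \<in> {i, j}" for t
      unfolding ascent_def
    proof (intro allI impI, rule ccontr)
      fix w assume w: "wd w = wd h \<circ> s t" "\<not> length h \<le> length w"
      have e: "wd (w @ t # d) = wd ws"
      proof
        fix x show "wd (w @ t # d) x = wd ws x"
          using fun_cong[OF w(1), of "s t (wd d x)"] fun_cong[OF d(1), of x] by (simp add: wd_append s_s)
      qed
      then have "length ws \<le> length (w @ t # d)" using less.prems(1) by (auto simp: reduced_def)
      then have "P w (t # d)" using e d w(2) that by (auto simp: P_def)
      then show False using hmin[of w] w(2) by blast
    qed
    have pi: "pos (wd h (u i))" and pj: "pos (wd h (u j))"
      using less.hyps[OF hlt reduced_left[OF red]] asc by auto
    have "ascent d i"
      unfolding ascent_def
    proof (intro allI impI)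
      fix w assume "wd w = wd d \<circ> s i"
      then have "wd (h @ w) = wd ws \<circ> s i" using d(1) by (simp add: wd_append o_assoc)
      then have "length ws \<le> length (h @ w)" using less.prems(2) by (auto simp: ascent_def)
      then show "length d \<le> length w" using d(2) by simp
    qed
    then obtain a b where ab: "0 \<le> a" "0 \<le> b" "wd d (u i) = a *\<^sub>R u i + b *\<^sub>R u j"
      using dihedral_pos[of i j d] \<open>j \<noteq> i\<close> d(3) reduced_right[OF red] by metis
    have "wd ws (u i) = wd h (wd d (u i))" using fun_cong[OF d(1), of "u i"] by (simp add: wd_append)
    also have "\<dots> = a *\<^sub>R wd h (u i) + b *\<^sub>R wd h (u j)"
      by (simp add: ab(3) linear_add[OF linear_wd] linear_cmul[OF linear_wd])
    finally show ?thesis using pi pj ab(1,2) by (simp add: pos_add pos_scale)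
  qed
qed

text \<open>Here \<open>l\<close> acts as a fundamental weight: every generator except
  \<open>s r\<close> fixes it. Appending \<open>r\<close> to a reduced word adds
  \<open>2 * k\<close> times a positive combination, by \<open>ascent_pos\<close>. The lower bound
  at \<open>r\<close> arises when \<open>l\<close> is first moved and is never lost
  afterwards.\<close>

lemma orbit_displacement:
  assumes "\<And>i. i \<noteq> r \<Longrightarrow> mink l (u i) = 0" "mink l (u r) = - k" "k > 0"
  shows "wd ws l = l \<or> (\<exists>a. (\<forall>i. 0 \<le> a i) \<and> 2 * k \<le> a r \<and> wd ws l = l + (\<Sum>i\<in>UNIV. a i *\<^sub>R u i))"
proof -
  let ?C = "\<lambda>w. w = l \<or> (\<exists>a. (\<forall>i. 0 \<le> a i) \<and> 2 * k \<le> a r \<and> w = l + (\<Sum>i\<in>UNIV. a i *\<^sub>R u i))"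
  have "?C (wd ws l)" if "reduced ws" for ws
    using that
  proof (induction ws rule: rev_induct)
    case (snoc i xs)
    have IH: "?C (wd xs l)" using snoc reduced_left by blast
    show ?case
    proof (cases "i = r")
      case False
      then have "wd (xs @ [i]) l = wd xs l" using assms(1) by (simp add: wd_append reflection_def)
      then show ?thesis using IH by (simp only:)
    next
      case True
      have "ascent xs i"
        unfolding ascent_def
      proof (intro allI impI)
        fix w assume "wd w = wd xs \<circ> s i"
        then have "wd w = wd (xs @ [i])" by (simp add: wd_append)
        then show "length xs \<le> length w" using snoc.prems unfolding reduced_def by fastforce
      qed
      then have "pos (wd xs (u i))" by (intro ascent_pos) (use snoc.prems reduced_left in auto)
      then obtain b where b: "\<And>i. 0 \<le> b i" "wd xs (u r) = (\<Sum>i\<in>UNIV. b i *\<^sub>R u i)"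
        unfolding pos_def True by blast
      have "s r l = l + (2 * k) *\<^sub>R u r" using assms(2) by (simp add: reflection_def)
      then have e: "wd (xs @ [i]) l = wd xs l + (2 * k) *\<^sub>R (\<Sum>i\<in>UNIV. b i *\<^sub>R u i)"
        by (simp add: True wd_append linear_add[OF linear_wd] linear_cmul[OF linear_wd] b(2))
      show ?thesis
      proof (cases "wd xs l = l")
        case True
        \<comment> \<open>Since \<open>wd xs\<close> fixes \<open>l\<close> and preserves
          \<open>mink\<close>, pairing with \<open>l\<close> forces the coefficient at
          \<open>r\<close> to be exactly 1.\<close>
        have "- k = mink (wd xs l) (wd xs (u r))" using assms(2) mink_wd by simp
        also have "\<dots> = (\<Sum>i\<in>UNIV. b i * mink l (u i))"
          unfolding True b(2) by (simp add: mink_sum_right mink_scale_right)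
        also have "\<dots> = (\<Sum>i\<in>UNIV. if i = r then - (b r * k) else 0)"
          by (intro sum.cong) (auto simp: assms)
        finally have "b r = 1" using assms(3) by simp
        then show ?thesis using e b(1) assms(3) unfolding True
          by (intro disjI2 exI[of _ "\<lambda>i. 2 * k * b i"]) (auto simp: scaleR_sum_right)
      next
        case False
        then obtain a where a: "\<And>i. 0 \<le> a i" "2 * k \<le> a r" "wd xs l = l + (\<Sum>i\<in>UNIV. a i *\<^sub>R u i)"
          using IH by blast
        have "wd (xs @ [i]) l = l + (\<Sum>i\<in>UNIV. (a i + 2 * k * b i) *\<^sub>R u i)"
          unfolding e a(3) by (simp add: scaleR_add_left sum.distrib scaleR_sum_right)
        then show ?thesis using a b(1) assms(3)
          by (intro disjI2 exI[of _ "\<lambda>i. a i + 2 * k * b i"]) (auto intro: add_increasing2)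
      qed
    qed
  qed simp
  then show ?thesis by (metis obtain_reduced)
qed

end

section \<open>Normals and faces of a hyperbolic tetrahedron\<close>

text \<open>Reverse Cauchy-Schwarz: spatial norms are at most the time coordinates, and equality
  throughout forces the vectors to be parallel.\<close>

lemma mink_causal:
  assumes "x \<in> hyp3 \<union> future_cone" "y \<in> hyp3 \<union> future_cone"
  shows "mink x y \<le> 0" "mink x y = 0 \<Longrightarrow> fst y *\<^sub>R x = fst x *\<^sub>R y"
proof -
  have t: "fst x > 0" "fst y > 0" using assms by (auto simp: hyp3_def future_cone_def)
  have "(norm (snd x))\<^sup>2 \<le> (fst x)\<^sup>2" "(norm (snd y))\<^sup>2 \<le> (fst y)\<^sup>2"
    using assms by (auto simp: hyp3_def future_cone_def mink_def power2_norm_eq_inner power2_eq_square[of "fst _"])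
  then have n: "norm (snd x) \<le> fst x" "norm (snd y) \<le> fst y"
    using t by (auto intro: power2_le_imp_le)
  have cs: "snd x \<bullet> snd y \<le> norm (snd x) * norm (snd y)" by (rule norm_cauchy_schwarz)
  have nn: "norm (snd x) * norm (snd y) \<le> fst x * fst y" using n t by (intro mult_mono) auto
  then show "mink x y \<le> 0" using cs by (simp add: mink_def)
  assume "mink x y = 0"
  then have e: "snd x \<bullet> snd y = norm (snd x) * norm (snd y)" "norm (snd x) * norm (snd y) = fst x * fst y"
    using cs nn by (auto simp: mink_def)
  have "norm (snd x) = fst x" "norm (snd y) = fst y"
  proof -
    have "norm (snd x) * norm (snd y) \<le> norm (snd x) * fst y" "norm (snd x) * norm (snd y) \<le> fst x * norm (snd y)"
      using n by (auto intro: mult_left_mono mult_right_mono)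
    then have "fst x * fst y \<le> norm (snd x) * fst y" "fst x * fst y \<le> fst x * norm (snd y)" unfolding e(2) .
    then have "fst x \<le> norm (snd x)" "fst y \<le> norm (snd y)" using t by auto
    then show "norm (snd x) = fst x" "norm (snd y) = fst y" using n by auto
  qed
  then show "fst y *\<^sub>R x = fst x *\<^sub>R y"
    using e(1) norm_cauchy_schwarz_eq[of "snd x" "snd y"] by (auto simp: prod_eq_iff)
qed

lemma mink_timelike_neg:
  assumes "x \<in> hyp3" "y \<in> hyp3 \<union> future_cone"
  shows "mink x y < 0"
proof (rule ccontr)
  assume "\<not> mink x y < 0"
  then have 0: "mink x y = 0" using mink_causal(1)[of x y] assms by auto
  have "fst y *\<^sub>R x = fst x *\<^sub>R y" using mink_causal(2)[of x y] assms 0 by auto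
  then have "fst y * mink x x = fst x * mink x y" by (metis mink_scale_right)
  then show False using assms 0 by (auto simp: hyp3_def future_cone_def)
qed

lemma spacelike_of_orthogonal:
  assumes "mink x x < 0" "mink x n = 0" "n \<noteq> 0"
  shows "mink n n > 0"
proof -
  have nx: "(norm (snd x))\<^sup>2 < (fst x)\<^sup>2"
    using assms(1) by (simp add: mink_def power2_norm_eq_inner power2_eq_square[of "fst _"])
  have "fst x * fst n = snd x \<bullet> snd n" using assms(2) by (simp add: mink_def)
  then have "(fst x)\<^sup>2 * (fst n)\<^sup>2 = (snd x \<bullet> snd n)\<^sup>2" by (metis power_mult_distrib)
  also have "\<dots> \<le> (norm (snd x))\<^sup>2 * (norm (snd n))\<^sup>2"
    using Cauchy_Schwarz_ineq[of "snd x" "snd n"] by (simp add: power2_norm_eq_inner)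
  finally have le: "(fst x)\<^sup>2 * (fst n)\<^sup>2 \<le> (norm (snd x))\<^sup>2 * (norm (snd n))\<^sup>2" .
  have "(fst n)\<^sup>2 < (norm (snd n))\<^sup>2"
  proof (rule ccontr)
    assume a: "\<not> (fst n)\<^sup>2 < (norm (snd n))\<^sup>2"
    then have "(norm (snd x))\<^sup>2 * (norm (snd n))\<^sup>2 \<le> (norm (snd x))\<^sup>2 * (fst n)\<^sup>2"
      by (intro mult_left_mono) auto
    then have "((fst x)\<^sup>2 - (norm (snd x))\<^sup>2) * (fst n)\<^sup>2 \<le> 0" using le by (simp add: algebra_simps)
    then have "(fst n)\<^sup>2 \<le> 0" using nx by (simp add: mult_le_0_iff)
    then have "fst n = 0" by simp
    then show False using a assms(3) by (simp add: prod_eq_iff)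
  qed
  then show ?thesis by (simp add: mink_def power2_norm_eq_inner power2_eq_square[of "fst _"])
qed

text \<open>Independent vertices are not parallel, so their product is strictly negative even if
  both are ideal. The resulting timelike vector on each edge is the witness that the normals are
  spacelike.\<close>

lemma tetrahedron_edge_timelike:
  assumes "tetrahedron v" "i \<noteq> j"
  shows "mink (v i + v j) (v i + v j) < 0"
proof -
  have c: "v i \<in> hyp3 \<union> future_cone" "v j \<in> hyp3 \<union> future_cone"
    and ind: "independent (range v)" and ne: "v i \<noteq> v j"
    using assms by (auto simp: tetrahedron_def inj_def)
  have "mink (v i) (v j) \<noteq> 0"
  proof
    assume "mink (v i) (v j) = 0"
    then have e: "fst (v j) *\<^sub>R v i = fst (v i) *\<^sub>R v j" by (rule mink_causal(2)[OF c])
    have "fst (v j) > 0" using c by (auto simp: hyp3_def future_cone_def)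
    then have "v i = (fst (v i) / fst (v j)) *\<^sub>R v j"
      using arg_cong[OF e, of "\<lambda>w. (1 / fst (v j)) *\<^sub>R w"] by simp
    then have "v i \<in> span (range v - {v i})" using ne by (metis Diff_iff empty_iff insert_iff rangeI span_base span_scale)
    then show False using ind by (auto simp: dependent_def)
  qed
  then have "mink (v i) (v j) < 0" using mink_causal(1)[OF c] by simp
  moreover have "mink (v i) (v i) \<le> 0" "mink (v j) (v j) \<le> 0" using c by (auto simp: hyp3_def future_cone_def)
  ultimately show ?thesis by (simp add: mink_linear mink_commute)
qed

lemma two_other_indices: "\<exists>k l. k \<noteq> l \<and> k \<noteq> i \<and> k \<noteq> j \<and> l \<noteq> i \<and> l \<noteq> (j::4)"
proof -
  have "card {i, j} < card (UNIV :: 4 set)" by (simp add: card_insert_if)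
  then have "{i, j} \<noteq> UNIV" by fastforce
  then obtain k where k: "k \<notin> {i, j}" by blast
  have "card {i, j, k} < card (UNIV :: 4 set)" by (simp add: card_insert_if)
  then have "{i, j, k} \<noteq> UNIV" by fastforce
  then obtain l where "l \<notin> {i, j, k}" by blast
  with k show ?thesis by blast
qed

text \<open>Justifies the definite description. Independence yields the functional that is -1 on
  \<open>v i\<close> and 0 on the other vertices; its representing vector is orthogonal to an edge
  of facet \<open>i\<close>, hence spacelike and normalisable.\<close>

lemma outward_normal:
  assumes "tetrahedron v"
  shows "mink (outward_normal v i) (outward_normal v i) = 1"
    "\<And>j. j \<noteq> i \<Longrightarrow> mink (outward_normal v i) (v j) = 0"
    "mink (outward_normal v i) (v i) < 0"
proof -
  have ind: "independent (range v)" and inj: "inj v" using assms by (auto simp: tetrahedron_def)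
  obtain g :: "mvec \<Rightarrow> real" where g: "linear g" "\<And>x. x \<in> range v \<Longrightarrow> g x = (if x = v i then -1 else 0)"
    using linear_independent_extend[OF ind, of "\<lambda>x. if x = v i then -1 else 0"] by blast
  define a where "a = adjoint g 1"
  have ga: "g x = x \<bullet> a" for x unfolding a_def using adjoint_works[OF g(1), of x 1] by simp
  \<comment> \<open>Flipping the time coordinate turns the Euclidean representative of the
    functional into the Minkowski one.\<close>
  define w :: mvec where "w = (- fst a, snd a)"
  have w: "mink w x = g x" for x
    by (simp add: ga w_def mink_def inner_prod_def inner_commute)
  have wi: "mink w (v i) = -1" using g(2)[of "v i"] by (simp add: w)
  have wj: "mink w (v j) = 0" if "j \<noteq> i" for j
    using g(2)[of "v j"] inj that by (auto simp: w inj_def)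
  obtain k l where kl: "k \<noteq> l" "k \<noteq> i" "l \<noteq> i" using two_other_indices[of i i] by auto
  have "mink w w > 0"
  proof (rule spacelike_of_orthogonal[OF tetrahedron_edge_timelike[OF assms kl(1)]])
    show "mink (v k + v l) w = 0" using wj kl by (simp add: mink_linear mink_commute[of _ w])
    show "w \<noteq> 0" using wi by (auto simp: mink_def)
  qed
  then have s: "sqrt (mink w w) > 0" "sqrt (mink w w) * sqrt (mink w w) = mink w w" by auto
  define u where "u = (1 / sqrt (mink w w)) *\<^sub>R w"
  have "outward_normal v i = u"
    by (rule outward_normal_eqI[OF assms]) (use s wi wj in \<open>auto simp: u_def mink_linear field_simps\<close>)
  then show "mink (outward_normal v i) (outward_normal v i) = 1"
    "\<And>j. j \<noteq> i \<Longrightarrow> mink (outward_normal v i) (v j) = 0"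
    "mink (outward_normal v i) (v i) < 0"
    using s wi wj by (auto simp: u_def mink_linear field_simps)
qed

text \<open>The facets \<open>i\<close> and \<open>j\<close> share an edge, so the normals span a positive definite plane; this rules
  out an angle coming from a junk value of \<open>arccos\<close>.\<close>

lemma mink_outward_normals:
  assumes t: "tetrahedron v" and "i \<noteq> j" "dihedral_angle v i j = \<theta>"
  shows "mink (outward_normal v i) (outward_normal v j) = - cos \<theta>"
proof -
  let ?u = "outward_normal v"
  obtain k l where kl: "k \<noteq> l" "k \<noteq> i" "k \<noteq> j" "l \<noteq> i" "l \<noteq> j" using two_other_indices by blast
  note e = tetrahedron_edge_timelike[OF t kl(1)]
  have o: "mink (v k + v l) (?u i) = 0" "mink (v k + v l) (?u j) = 0"
    using kl outward_normal(2)[OF t] by (simp_all add: mink_linear mink_commute[of "v _"])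
  have "mink n n \<ge> 0" if "mink (v k + v l) n = 0" for n
    using spacelike_of_orthogonal[OF e that] by (cases "n = 0") (auto simp: mink_def)
  from this[of "?u i + ?u j"] this[of "?u i - ?u j"]
  have "\<bar>mink (?u i) (?u j)\<bar> \<le> 1"
    using o outward_normal(1)[OF t] by (simp add: mink_linear mink_commute[of "?u j" "?u i"])
  moreover have "arccos (mink (?u i) (?u j)) = pi - \<theta>" using assms(3) by (simp add: dihedral_angle_def)
  ultimately have "mink (?u i) (?u j) = cos (pi - \<theta>)" by (metis abs_le_iff cos_arccos minus_le_iff)
  then show ?thesis by simp
qed

lemma coxeter_simplex_vectors:
  assumes "coxeter_simplex M v" "\<And>i j. i \<noteq> j \<Longrightarrow> M i j \<ge> 2"
  shows "coxeter_vectors (outward_normal v) M"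
proof
  have t: "tetrahedron v" using assms(1) by (simp add: coxeter_simplex_def)
  fix i j
  show "mink (outward_normal v i) (outward_normal v i) = 1" by (rule outward_normal(1)[OF t])
  assume "i \<noteq> j"
  then show "2 \<le> M i j" by (rule assms(2))
  show "mink (outward_normal v i) (outward_normal v j) = - cos (pi / real (M i j))"
    using assms(1) \<open>i \<noteq> j\<close> by (intro mink_outward_normals[OF t]) (auto simp: coxeter_simplex_def)
qed

text \<open>Up to negative factors the normals are the dual basis of the vertices, so signs of
  coordinates become sides of facets.\<close>

lemma dual_expansion:
  assumes t: "tetrahedron v"
  obtains c where "x = (\<Sum>i\<in>UNIV. c i *\<^sub>R v i)" "\<And>i. mink x (outward_normal v i) = c i * mink (outward_normal v i) (v i)"
proof -
  have ind: "independent (range v)" and inj: "inj v" using t by (auto simp: tetrahedron_def)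
  have "card (range v) = DIM(mvec)" using inj by (simp add: card_image)
  then have span: "span (range v) = UNIV" using ind card_eq_dim[of "range v" UNIV] by (auto simp: dim_UNIV)
  then obtain d where "x = (\<Sum>w\<in>range v. d w *\<^sub>R w)" using span_finite[of "range v"] by (auto simp: image_iff)
  then have e: "x = (\<Sum>i\<in>UNIV. d (v i) *\<^sub>R v i)" by (simp add: sum.reindex[OF inj])
  have "mink x (outward_normal v i) = d (v i) * mink (outward_normal v i) (v i)" for i
  proof -
    have "mink x (outward_normal v i) = (\<Sum>j\<in>UNIV. d (v j) * mink (outward_normal v i) (v j))"
      by (subst e) (simp add: mink_sum_left mink_scale_left mink_commute[of "v _"])
    also have "\<dots> = (\<Sum>j\<in>UNIV. if j = i then d (v i) * mink (outward_normal v i) (v i) else 0)"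
      by (intro sum.cong) (auto simp: outward_normal(2)[OF t])
    finally show ?thesis by simp
  qed
  with e show ?thesis by (rule that)
qed

lemma orthogonal_normals_zero:
  assumes "tetrahedron v" "\<And>i. mink x (outward_normal v i) = 0"
  shows "x = 0"
proof -
  obtain c where c: "x = (\<Sum>i\<in>UNIV. c i *\<^sub>R v i)" "\<And>i. mink x (outward_normal v i) = c i * mink (outward_normal v i) (v i)"
    using dual_expansion[OF assms(1)] by blast
  have "c i = 0" for i
    using assms(2)[of i] c(2)[of i] outward_normal(3)[OF assms(1), of i] by (metis less_irrefl mult_eq_0_iff)
  then show ?thesis using c by simp
qed

lemma solid_eq:
  assumes "tetrahedron v"
  shows "solid v = {x \<in> hyp3. \<forall>i. mink x (outward_normal v i) \<le> 0}"
proof (intro set_eqI iffI)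
  fix x assume "x \<in> solid v"
  then obtain c where x: "x \<in> hyp3" "\<And>i. 0 \<le> c i" "x = (\<Sum>i\<in>UNIV. c i *\<^sub>R v i)" by (auto simp: solid_def)
  have "mink x (outward_normal v i) \<le> 0" for i
  proof -
    have "mink x (outward_normal v i) = (\<Sum>j\<in>UNIV. c j * mink (outward_normal v i) (v j))"
      by (subst x(3)) (simp add: mink_sum_left mink_scale_left mink_commute[of "v _"])
    also have "\<dots> \<le> 0"
    proof (rule sum_nonpos)
      fix j show "c j * mink (outward_normal v i) (v j) \<le> 0"
        using x(2)[of j] outward_normal(2)[OF assms, of j i] outward_normal(3)[OF assms, of i]
        by (cases "j = i") (auto simp: mult_nonneg_nonpos)
    qed
    finally show ?thesis .
  qed
  then show "x \<in> {x \<in> hyp3. \<forall>i. mink x (outward_normal v i) \<le> 0}" using x by simp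
next
  fix x assume x: "x \<in> {x \<in> hyp3. \<forall>i. mink x (outward_normal v i) \<le> 0}"
  obtain c where c: "x = (\<Sum>i\<in>UNIV. c i *\<^sub>R v i)" "\<And>i. mink x (outward_normal v i) = c i * mink (outward_normal v i) (v i)"
    using dual_expansion[OF assms] by blast
  have "0 \<le> c i" for i
  proof (rule ccontr)
    assume "\<not> 0 \<le> c i"
    then have "c i * mink (outward_normal v i) (v i) > 0"
      using outward_normal(3)[OF assms, of i] by (intro mult_neg_neg) auto
    moreover have "mink x (outward_normal v i) \<le> 0" using x by blast
    ultimately show False unfolding c(2) by linarith
  qed
  then show "x \<in> solid v" unfolding solid_def using x c(1) by blast
qed

section \<open>Horoballs\<close>

definition hyp_normalize :: "mvec \<Rightarrow> mvec" where
  "hyp_normalize X = (1 / sqrt (- mink X X)) *\<^sub>R X"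

lemma hyp_normalize_in_hyp3: "mink X X < 0 \<Longrightarrow> fst X > 0 \<Longrightarrow> hyp_normalize X \<in> hyp3"
  by (simp add: hyp_normalize_def hyp3_def mink_linear power2_eq_square[symmetric] power_divide flip: real_sqrt_mult)

lemma mink_hyp_normalize: "mink (hyp_normalize X) y = mink X y / sqrt (- mink X X)"
  by (simp add: hyp_normalize_def mink_linear)

lemma hyp_interior_subset: "hyp_interior S \<subseteq> S"
  unfolding hyp_interior_def by (rule interior_of_subset)

text \<open>The form in which interior points are exploited: a small displacement in any direction,
  projected radially back to the hyperboloid, stays in \<open>S\<close>.\<close>

lemma hyp_interior_perturb:
  assumes "x \<in> hyp_interior S"
  shows "eventually (\<lambda>s. hyp_normalize (x + s *\<^sub>R d) \<in> S) (at_right 0)"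
proof -
  obtain T where T: "openin (top_of_set hyp3) T" "x \<in> T" "T \<subseteq> S"
    using assms unfolding hyp_interior_def interior_of_def by blast
  then obtain U where U: "open U" "T = hyp3 \<inter> U" by (auto simp: openin_open)
  have x: "x \<in> hyp3" "x \<in> U" using T U by auto
  then have xx: "mink x x = -1" "fst x > 0" by (auto simp: hyp3_def)
  have cm: "isCont (\<lambda>s. mink (x + s *\<^sub>R d) (x + s *\<^sub>R d)) 0" unfolding mink_def by (intro continuous_intros)
  then have tm: "((\<lambda>s. mink (x + s *\<^sub>R d) (x + s *\<^sub>R d)) \<longlongrightarrow> mink x x) (at 0)"
    by (simp add: isCont_def)
  then have 1: "eventually (\<lambda>s. mink (x + s *\<^sub>R d) (x + s *\<^sub>R d) < 0) (at 0)"
    using xx by (intro order_tendstoD(2)[of _ "mink x x"]) auto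
  have "isCont (\<lambda>s. fst (x + s *\<^sub>R d)) 0" by (intro continuous_intros)
  then have "((\<lambda>s. fst (x + s *\<^sub>R d)) \<longlongrightarrow> fst x) (at 0)" by (simp add: isCont_def)
  then have 2: "eventually (\<lambda>s. fst (x + s *\<^sub>R d) > 0) (at 0)"
    using xx by (intro order_tendstoD(1)[of _ "fst x"]) auto
  have "((\<lambda>s. hyp_normalize (x + s *\<^sub>R d)) \<longlongrightarrow> (1 / sqrt (- mink x x)) *\<^sub>R (x + 0 *\<^sub>R d)) (at 0)"
    unfolding hyp_normalize_def using xx by (intro tendsto_intros tm) auto
  then have "((\<lambda>s. hyp_normalize (x + s *\<^sub>R d)) \<longlongrightarrow> x) (at 0)" using xx by simp
  then have 3: "eventually (\<lambda>s. hyp_normalize (x + s *\<^sub>R d) \<in> U) (at 0)"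
    using U(1) x(2) by (rule topological_tendstoD)
  from 1 2 3 have "eventually (\<lambda>s. hyp_normalize (x + s *\<^sub>R d) \<in> S) (at 0)"
  proof eventually_elim
    case (elim s)
    then have "hyp_normalize (x + s *\<^sub>R d) \<in> hyp3" by (intro hyp_normalize_in_hyp3)
    then show ?case using elim T(3) U(2) by blast
  qed
  then show ?thesis by (simp add: eventually_at_split)
qed

lemma eventually_at_right_0_witness:
  assumes "eventually P (at_right (0::real))"
  obtains s where "s > 0" "P s"
proof -
  have "eventually (\<lambda>s. s > 0 \<and> P s) (at_right (0::real))"
    using eventually_conj[OF eventually_at_right_less[of 0] assms] by simp
  then obtain s where "s > 0 \<and> P s" using eventually_happens trivial_limit_at_right_real by blast
  then show ?thesis using that by blast
qed

lemma hyp_interior_halfspace: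
  assumes "x \<in> hyp_interior S" "\<And>y. y \<in> S \<Longrightarrow> mink y n \<le> 0" "mink n n = 1"
  shows "mink x n < 0"
proof (rule ccontr)
  assume a: "\<not> mink x n < 0"
  have xS: "x \<in> S" using assms(1) hyp_interior_subset by auto
  then have 0: "mink x n = 0" using a assms(2)[of x] by linarith
  \<comment> \<open>Moving along \<open>n\<close> crosses the plane; \<open>s < 1\<close> keeps the
    vector timelike, as its square is \<open>-1 + s\<^sup>2\<close>.\<close>
  have "eventually (\<lambda>s. s < 1) (at_right (0::real))" by (rule eventually_at_right_real[of 0 1, THEN eventually_mono]) auto
  then have "eventually (\<lambda>s. hyp_normalize (x + s *\<^sub>R n) \<in> S \<and> s < 1) (at_right 0)"
    using hyp_interior_perturb[OF assms(1)] eventually_conj by blast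
  then obtain s where s: "s > 0" "hyp_normalize (x + s *\<^sub>R n) \<in> S \<and> s < 1" by (rule eventually_at_right_0_witness)
  have "mink x x = -1"
  proof -
    have "x \<in> hyp3" using assms(1) unfolding hyp_interior_def by (metis hyp_interior_def interior_of_subset_topspace subsetD topspace_euclidean_subtopology)
    then show ?thesis by (simp add: hyp3_def)
  qed
  then have "mink (x + s *\<^sub>R n) (x + s *\<^sub>R n) = -1 + s\<^sup>2"
    using 0 assms(3) by (simp add: mink_linear mink_commute[of n x] power2_eq_square)
  moreover have "s\<^sup>2 < 1" using s by (simp add: power_less_one_iff)
  ultimately have "mink (hyp_normalize (x + s *\<^sub>R n)) n > 0"
    using s 0 assms(3) by (simp add: mink_hyp_normalize mink_linear)
  then show False using assms(2)[of "hyp_normalize (x + s *\<^sub>R n)"] s by linarith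
qed

lemma hyp_interior_I:
  assumes "finite I" "x \<in> hyp3" "\<And>i. i \<in> I \<Longrightarrow> mink x (n i) < 0"
    "\<And>y. y \<in> hyp3 \<Longrightarrow> (\<And>i. i \<in> I \<Longrightarrow> mink y (n i) < 0) \<Longrightarrow> y \<in> S"
  shows "x \<in> hyp_interior S"
proof -
  let ?U = "\<Inter>i\<in>I. {y. mink y (n i) < 0}"
  have "open ?U"
    using assms(1) unfolding mink_def by (intro open_INT) (auto intro!: open_Collect_less continuous_intros)
  then have "openin (top_of_set hyp3) (hyp3 \<inter> ?U)" by (auto simp: openin_open)
  moreover have "hyp3 \<inter> ?U \<subseteq> S" using assms(4) by auto
  ultimately have "hyp3 \<inter> ?U \<subseteq> hyp_interior S" unfolding hyp_interior_def by (rule interior_of_maximal[rotated])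
  then show ?thesis using assms(2,3) by auto
qed

text \<open>The vector \<open>n\<close> is the component orthogonal to \<open>x\<close> of
  \<open>mink x w' *\<^sub>R w + mink x w *\<^sub>R w'\<close>. Its square is nonnegative because
  \<open>x\<close> is timelike, and is a positive multiple of
  \<open>mink w w' + 2 * (mink x w * mink x w')\<close>.\<close>

lemma lightlike_product_bound:
  assumes x: "x \<in> hyp3" and w: "w \<in> future_cone" "w' \<in> future_cone"
  shows "- mink w w' \<le> 2 * (mink x w * mink x w')"
proof -
  have neg: "mink x w < 0" "mink x w' < 0" using mink_timelike_neg x w by auto
  have xx: "mink x x = -1" and ww: "mink w w = 0" "mink w' w' = 0" using x w by (auto simp: hyp3_def future_cone_def)
  define n where "n = mink x w' *\<^sub>R w + mink x w *\<^sub>R w' + (2 * (mink x w * mink x w')) *\<^sub>R x"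
  have "mink x n = 0" by (simp add: n_def mink_linear xx algebra_simps)
  then have "mink n n \<ge> 0"
    using spacelike_of_orthogonal[of x n] xx by (cases "n = 0") (auto simp: mink_def)
  moreover have "mink n n = 2 * (mink x w * mink x w') * (mink w w' + 2 * (mink x w * mink x w'))"
    unfolding n_def by (simp add: mink_linear xx ww mink_commute[of w x] mink_commute[of w' x] mink_commute[of w' w] algebra_simps)
  moreover have "mink x w * mink x w' > 0" using neg by (simp add: mult_neg_neg)
  ultimately show ?thesis by (simp add: zero_le_mult_iff)
qed

text \<open>All horoballs of an orbit share one level \<open>k\<close>; their sizes are carried by
  the scale of \<open>w\<close>, so isometries act on \<open>w\<close> alone.\<close>

definition sublevel :: "real \<Rightarrow> mvec \<Rightarrow> mvec set" where
  "sublevel k w = {x \<in> hyp3. - mink x w \<le> k}"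

lemma horoball_sublevel: "w \<in> future_cone \<Longrightarrow> k > 0 \<Longrightarrow> horoball_at w (sublevel k w)"
  by (auto simp: horoball_at_def sublevel_def)

text \<open>At the threshold the horoballs are tangent, and every common point lies on the bounding
  horosphere. A common interior point could be moved along \<open>w\<close> strictly into the first
  horoball while staying in both.\<close>

lemma sublevel_interiors_disjoint:
  assumes "w \<in> future_cone" "w' \<in> future_cone" "k > 0" "- mink w w' \<ge> 2 * k\<^sup>2"
  shows "hyp_interior (sublevel k w) \<inter> hyp_interior (sublevel k w') = {}"
proof (rule ccontr)
  assume "\<not> ?thesis"
  then obtain x where x: "x \<in> hyp_interior (sublevel k w)" "x \<in> hyp_interior (sublevel k w')" by blast
  have on: "mink y w = - k" if "y \<in> sublevel k w" "y \<in> sublevel k w'" for y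
  proof -
    have y: "y \<in> hyp3" "- mink y w \<le> k" "- mink y w' \<le> k" using that by (auto simp: sublevel_def)
    have neg: "mink y w < 0" "mink y w' < 0" using mink_timelike_neg y assms by auto
    have "2 * k\<^sup>2 \<le> 2 * (mink y w * mink y w')" using lightlike_product_bound[OF y(1) assms(1,2)] assms(4) by simp
    also have "mink y w * mink y w' = (- mink y w) * (- mink y w')" by simp
    also have "\<dots> \<le> (- mink y w) * k" using y neg by (intro mult_left_mono) auto
    finally have "k * k \<le> (- mink y w) * k" by (simp add: power2_eq_square mult.commute)
    then have "k \<le> - mink y w" using assms(3) by (rule mult_right_le_imp_le)
    then show ?thesis using y by simp
  qed
  have xw: "mink x w = - k" using on x hyp_interior_subset by blast
  have xx: "mink x x = -1" using x(1) hyp_interior_subset by (force simp: sublevel_def hyp3_def)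
  have ww: "mink w w = 0" using assms(1) by (simp add: future_cone_def)
  have "eventually (\<lambda>s. hyp_normalize (x + s *\<^sub>R w) \<in> sublevel k w \<and> hyp_normalize (x + s *\<^sub>R w) \<in> sublevel k w') (at_right 0)"
    using hyp_interior_perturb x by (intro eventually_conj) auto
  then obtain s where s: "s > 0" "hyp_normalize (x + s *\<^sub>R w) \<in> sublevel k w \<and> hyp_normalize (x + s *\<^sub>R w) \<in> sublevel k w'"
    by (rule eventually_at_right_0_witness)
  have "mink (x + s *\<^sub>R w) (x + s *\<^sub>R w) = - (1 + 2 * s * k)"
    by (simp add: mink_linear xx ww xw mink_commute[of w x])
  moreover have "mink (hyp_normalize (x + s *\<^sub>R w)) w = - k" using on s by blast
  moreover have "mink (x + s *\<^sub>R w) w = - k" by (simp add: mink_linear ww xw)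
  ultimately have "- k / sqrt (1 + 2 * s * k) = - k" by (simp only: mink_hyp_normalize minus_minus)
  moreover have r: "1 + 2 * s * k > 1" using assms(3) s(1) by simp
  ultimately have "k = k * sqrt (1 + 2 * s * k)" by (simp add: divide_eq_eq split: if_splits)
  then show False using assms(3) r by simp
qed

lemma hyp3_borel [measurable]: "hyp3 \<in> sets borel"
  unfolding hyp3_def by measurable

lemma sublevel_borel [measurable]: "sublevel r w \<in> sets borel"
proof -
  have "sublevel r w = hyp3 \<inter> {x. - mink x w \<le> r}" by (auto simp: sublevel_def)
  also have "\<dots> \<in> sets borel" by measurable
  finally show ?thesis .
qed

lemma in_unit_cone: "X \<in> unit_cone S \<longleftrightarrow> fst X > 0 \<and> -1 < mink X X \<and> mink X X < 0 \<and> hyp_normalize X \<in> S"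
  by (simp add: unit_cone_def hyp_normalize_def)

section \<open>Action of the reflection group on points and horoballs\<close>

context coxeter_vectors
begin

text \<open>The product of \<open>x\<close> with its image is
  \<open>- 1 - 2 * (mink x (u i))\<^sup>2\<close>; being negative, it keeps the image on the sheet
  of \<open>x\<close>.\<close>

lemma s_hyp3:
  assumes "x \<in> hyp3"
  shows "s i x \<in> hyp3"
proof -
  let ?y = "s i x"
  have xx: "mink x x = -1" using assms by (simp add: hyp3_def)
  have yy: "mink ?y ?y = -1" using mink_s xx by simp
  have "mink x ?y = - 1 - 2 * (mink x (u i))\<^sup>2"
    by (simp add: reflection_def mink_linear xx power2_eq_square)
  then have xy: "mink x ?y < 0" using zero_le_power2[of "mink x (u i)"] by linarith
  have "fst ?y > 0"
  proof (rule ccontr)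
    assume "\<not> fst ?y > 0"
    moreover have "mink ?y ?y \<ge> 0" if "fst ?y = 0" using that by (simp add: mink_def)
    then have "fst ?y \<noteq> 0" using yy by linarith
    ultimately have "- ?y \<in> hyp3" using yy by (simp add: hyp3_def mink_linear)
    then have "mink x (- ?y) < 0" using assms by (intro mink_timelike_neg) auto
    then show False using xy by (simp add: mink_linear)
  qed
  then show ?thesis using yy by (simp add: hyp3_def)
qed

lemma wd_hyp3: "x \<in> hyp3 \<Longrightarrow> wd ws x \<in> hyp3"
  by (induction ws) (auto simp: s_hyp3)

lemma mink_wd_left: "mink (wd ws x) y = mink x (wd (rev ws) y)"
  using mink_wd[of ws x "wd (rev ws) y"] by (simp add: wd_rev)

lemma wd_future_cone:
  assumes "w \<in> future_cone"
  shows "wd ws w \<in> future_cone"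
proof -
  let ?o = "(1, 0) :: mvec"
  have o: "?o \<in> hyp3" by (simp add: hyp3_def mink_def)
  have "mink (wd ws w) ?o < 0"
    unfolding mink_wd_left using mink_timelike_neg[OF wd_hyp3[OF o]] assms by (subst mink_commute) auto
  then show ?thesis using assms mink_wd[of ws w w] by (simp add: future_cone_def mink_def[of _ ?o])
qed

lemma wd_sublevel: "wd ws ` sublevel k w = sublevel k (wd ws w)"
proof (intro set_eqI iffI)
  fix x assume "x \<in> wd ws ` sublevel k w"
  then obtain y where "x = wd ws y" "y \<in> hyp3" "- mink y w \<le> k" unfolding sublevel_def by blast
  then show "x \<in> sublevel k (wd ws w)" by (simp add: sublevel_def wd_hyp3 mink_wd)
next
  fix x assume x: "x \<in> sublevel k (wd ws w)"
  have "mink (wd (rev ws) x) w = mink x (wd ws w)" using mink_wd_left[of "rev ws" x w] by simp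
  then have "wd (rev ws) x \<in> sublevel k w" using x wd_hyp3 by (auto simp: sublevel_def)
  then show "x \<in> wd ws ` sublevel k w" using wd_rev[of ws x] by (metis imageI)
qed

end

section \<open>Coordinates adapted to the ideal vertex\<close>

text \<open>
  A Lorentz frame adapted to the simplex: the ideal vertex is the null direction \<open>et + ez\<close>, facet 1 is
  \<open>z = 0\<close>, facet 2 is \<open>x = c (t - z)\<close> and facets 3 and 4 bound the wedge
  \<open>- \<sigma> x \<le> \<surd>3 y \<le> x\<close>, with \<open>\<sigma> = 0\<close> for \<open>HV3\<close> and \<open>\<sigma> = 1\<close> for \<open>HP3\<close>.
\<close>

locale framed_simplex = coxeter_vectors "outward_normal v" M
  for v :: "4 \<Rightarrow> mvec" and M :: "4 \<Rightarrow> 4 \<Rightarrow> nat" +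
  fixes et ex ey ez :: mvec and \<sigma> c \<mu> :: real
  assumes tet: "tetrahedron v"
    and frame: "mink et et = -1" "mink ex ex = 1" "mink ey ey = 1" "mink ez ez = 1"
      "mink et ex = 0" "mink et ey = 0" "mink et ez = 0" "mink ex ey = 0" "mink ex ez = 0" "mink ey ez = 0"
    and c: "0 < c" "c\<^sup>2 < 3 / 4"
    and \<sigma>: "\<sigma> = 0 \<or> \<sigma> = 1"
    and \<mu>: "0 < \<mu>"
    and n1: "outward_normal v 1 = - ez"
    and n2: "outward_normal v 2 = ex + c *\<^sub>R (et + ez)"
    and n3: "outward_normal v 3 = - (1 / 2) *\<^sub>R ex + (sqrt 3 / 2) *\<^sub>R ey"
    and n4: "outward_normal v 4 = - (\<mu> * \<sigma>) *\<^sub>R ex - (\<mu> * sqrt 3) *\<^sub>R ey"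
begin

abbreviation "n \<equiv> outward_normal v"

lemma frame': "mink ex et = 0" "mink ey et = 0" "mink ez et = 0" "mink ey ex = 0" "mink ez ex = 0" "mink ez ey = 0"
  using frame by (simp_all add: mink_commute)

section \<open>Null coordinates\<close>

definition P :: "mvec \<Rightarrow> real" where "P X = - mink X et - mink X ez"
definition Q :: "mvec \<Rightarrow> real" where "Q X = - mink X et + mink X ez"
text \<open>Divided by the slope \<open>c\<close> of facet 2, with a further \<open>sqrt 3\<close>
  in \<open>Y1\<close>, so that facets 2 to 4 read \<open>X1 \<le> P\<close>,
  \<open>Y1 \<le> X1\<close> and \<open>- \<sigma> * X1 \<le> Y1\<close>.\<close>

definition X1 :: "mvec \<Rightarrow> real" where "X1 X = mink X ex / c"
definition Y1 :: "mvec \<Rightarrow> real" where "Y1 X = sqrt 3 * mink X ey / c"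

lemmas coord_defs = P_def Q_def X1_def Y1_def

definition point :: "real \<Rightarrow> real \<Rightarrow> real \<Rightarrow> real \<Rightarrow> mvec" where
  "point p x y q = ((p + q) / 2) *\<^sub>R et + ((q - p) / 2) *\<^sub>R ez + (c * x) *\<^sub>R ex + (c * y / sqrt 3) *\<^sub>R ey"

lemma coord_point [simp]: "P (point p x y q) = p" "Q (point p x y q) = q" "X1 (point p x y q) = x" "Y1 (point p x y q) = y"
  using c by (simp_all add: coord_defs point_def mink_linear frame frame' field_simps)

lemma mink_n:
  "mink X (n 1) \<le> 0 \<longleftrightarrow> P X \<le> Q X" "mink X (n 1) < 0 \<longleftrightarrow> P X < Q X"
  "mink X (n 2) \<le> 0 \<longleftrightarrow> X1 X \<le> P X" "mink X (n 2) < 0 \<longleftrightarrow> X1 X < P X"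
  "mink X (n 3) \<le> 0 \<longleftrightarrow> Y1 X \<le> X1 X" "mink X (n 3) < 0 \<longleftrightarrow> Y1 X < X1 X"
  "mink X (n 4) \<le> 0 \<longleftrightarrow> - \<sigma> * X1 X \<le> Y1 X" "mink X (n 4) < 0 \<longleftrightarrow> - \<sigma> * X1 X < Y1 X"
proof -
  have e1: "mink X (n 1) = (P X - Q X) / 2" by (simp add: n1 coord_defs mink_linear)
  have e2: "mink X (n 2) = c * (X1 X - P X)" using c by (simp add: n2 coord_defs mink_linear algebra_simps)
  have e3: "mink X (n 3) = c / 2 * (Y1 X - X1 X)" using c by (simp add: n3 coord_defs mink_linear algebra_simps)
  have e4: "mink X (n 4) = (\<mu> * c) * (- \<sigma> * X1 X - Y1 X)" using c by (simp add: n4 coord_defs mink_linear algebra_simps)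
  have sgn: "k * t \<le> 0 \<longleftrightarrow> t \<le> 0" "k * t < 0 \<longleftrightarrow> t < 0" if "k > 0" for k t :: real
    using that by (auto simp: mult_le_0_iff mult_less_0_iff)
  have k: "0 < c / 2" "0 < \<mu> * c" using c \<mu> by auto
  show "mink X (n 1) \<le> 0 \<longleftrightarrow> P X \<le> Q X" "mink X (n 1) < 0 \<longleftrightarrow> P X < Q X" unfolding e1 by auto
  show "mink X (n 2) \<le> 0 \<longleftrightarrow> X1 X \<le> P X" "mink X (n 2) < 0 \<longleftrightarrow> X1 X < P X"
    unfolding e2 sgn[OF c(1)] by simp_all
  show "mink X (n 3) \<le> 0 \<longleftrightarrow> Y1 X \<le> X1 X" "mink X (n 3) < 0 \<longleftrightarrow> Y1 X < X1 X"
    unfolding e3 sgn[OF k(1)] by simp_all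
  show "mink X (n 4) \<le> 0 \<longleftrightarrow> - \<sigma> * X1 X \<le> Y1 X" "mink X (n 4) < 0 \<longleftrightarrow> - \<sigma> * X1 X < Y1 X"
    unfolding e4 sgn[OF k(2)] by simp_all
qed

lemma expansion: "X = point (P X) (X1 X) (Y1 X) (Q X)"
proof -
  define d where "d = X - point (P X) (X1 X) (Y1 X) (Q X)"
  have "mink d et = 0" "mink d ex = 0" "mink d ey = 0" "mink d ez = 0"
    unfolding d_def point_def using c
    by (simp_all add: mink_linear frame frame' coord_defs field_simps)
  then have "mink d (n i) = 0" for i
    using exhaust_4[of i] by (auto simp: n1 n2 n3 n4 mink_linear)
  then have "d = 0" by (rule orthogonal_normals_zero[OF tet])
  then show ?thesis by (simp add: d_def)
qed

lemma mink_point: "mink (point p x y q) (point p x y q) = c\<^sup>2 * (x\<^sup>2 + y\<^sup>2 / 3) - p * q"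
  unfolding point_def
  by (simp add: mink_linear frame frame' power2_eq_square field_simps)

lemma mink_self: "mink X X = c\<^sup>2 * ((X1 X)\<^sup>2 + (Y1 X)\<^sup>2 / 3) - P X * Q X"
  by (subst (1 2) expansion) (rule mink_point)

definition coords :: "mvec \<Rightarrow> real \<times> real \<times> real \<times> real" where
  "coords X = (P X, X1 X, Y1 X, Q X)"

lemma linear_coords: "linear coords"
  by (rule linearI) (auto simp: coords_def coord_defs mink_linear algebra_simps add_divide_distrib)

lemma coords_inverse: "coords (point p x y q) = (p, x, y, q)"
  by (simp add: coords_def)

lemma bij_coords: "bij coords"
proof (rule o_bij[where g="\<lambda>(p, x, y, q). point p x y q"])
  show "(\<lambda>(p, x, y, q). point p x y q) \<circ> coords = id"
    using expansion by (auto simp: fun_eq_iff coords_def simp flip: expansion)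
  show "coords \<circ> (\<lambda>(p, x, y, q). point p x y q) = id"
    by (auto simp: fun_eq_iff coords_inverse)
qed

section \<open>The ideal vertex\<close>

lemma vertex1: obtains k where "k > 0" "v 1 = k *\<^sub>R (et + ez)"
proof -
  obtain a where a: "et + ez = (\<Sum>i\<in>UNIV. a i *\<^sub>R v i)" "\<And>i. mink (et + ez) (n i) = a i * mink (n i) (v i)"
    using dual_expansion[OF tet] by blast
  have az: "a i = 0" if "i \<noteq> 1" for i
  proof -
    have "mink (et + ez) (n i) = 0"
      using exhaust_4[of i] that by (auto simp: n2 n3 n4 mink_linear frame frame')
    then show ?thesis using a(2)[of i] outward_normal(3)[OF tet, of i] by simp
  qed
  have "(\<Sum>i\<in>UNIV. a i *\<^sub>R v i) = (\<Sum>i::4\<in>UNIV. if i = 1 then a 1 *\<^sub>R v 1 else 0)"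
    by (intro sum.cong) (auto simp: az)
  then have e: "et + ez = a 1 *\<^sub>R v 1" using a(1) by simp
  have "- 1 = a 1 * mink (n 1) (v 1)" using a(2)[of 1] by (simp add: n1 mink_linear frame frame')
  then have "a 1 > 0" using outward_normal(3)[OF tet, of 1] by (smt (verit) mult_nonpos_nonpos)
  then show ?thesis using that[of "1 / a 1"] e by simp
qed

text \<open>Both the scale of the representative \<open>v 1\<close> and the level of the tangent
  horoball: since \<open>mink X (v 1) = - \<kappa> * P X\<close>, that horoball is
  \<open>P X \<le> 1\<close> for any choice of scale.\<close>

definition \<kappa> :: real where "\<kappa> = - mink (v 1) (n 1)"

lemma \<kappa>: "\<kappa> > 0" and v1: "v 1 = \<kappa> *\<^sub>R (et + ez)"
proof -
  obtain k where k: "k > 0" "v 1 = k *\<^sub>R (et + ez)" by (rule vertex1)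
  then have "\<kappa> = k" by (simp add: \<kappa>_def n1 mink_linear frame frame')
  with k show "\<kappa> > 0" "v 1 = \<kappa> *\<^sub>R (et + ez)" by auto
qed

lemma mink_v1: "mink X (v 1) = - \<kappa> * P X"
  by (simp add: v1 P_def mink_linear algebra_simps)

text \<open>Any other vertex lies on facet 1, where \<open>P = Q\<close>, and the wedge bounds
  \<open>c\<^sup>2 * (X1\<^sup>2 + Y1\<^sup>2 / 3)\<close> by
  \<open>4 / 3 * c\<^sup>2 * P\<^sup>2\<close>. As \<open>c\<^sup>2 < 3 / 4\<close>, a lightlike
  vector there would have \<open>P = 0\<close> and vanish.\<close>

lemma ideal: "v i \<in> future_cone \<longleftrightarrow> i = 1"
proof
  have v: "v i \<in> hyp3 \<union> future_cone" for i using tet by (auto simp: tetrahedron_def)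
  {
    assume "i = 1"
    have "mink (v 1) (v 1) = 0" by (simp add: v1 mink_linear frame frame')
    then show "v i \<in> future_cone" using v[of 1] \<open>i = 1\<close> by (auto simp: hyp3_def)
  next
    assume fc: "v i \<in> future_cone"
    show "i = 1"
    proof (rule ccontr)
      assume "i \<noteq> 1"
      let ?X = "v i"
      have le: "mink ?X (n j) \<le> 0" for j
        using outward_normal(2)[OF tet, of i j] outward_normal(3)[OF tet, of j]
        by (cases "i = j") (auto simp: mink_commute)
      have "mink ?X (n 1) = 0" using outward_normal(2)[OF tet, of i 1] \<open>i \<noteq> 1\<close> by (simp add: mink_commute)
      then have pq: "P ?X = Q ?X" using mink_n(1,2)[of ?X] by linarith
      have ineq: "X1 ?X \<le> P ?X" "Y1 ?X \<le> X1 ?X" "- \<sigma> * X1 ?X \<le> Y1 ?X"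
        using le mink_n(3,5,7) by blast+
      have x: "0 \<le> X1 ?X" "\<bar>Y1 ?X\<bar> \<le> X1 ?X" using ineq \<sigma> by auto
      have "(X1 ?X)\<^sup>2 \<le> (P ?X)\<^sup>2" using x ineq by (intro power_mono) auto
      moreover have "(Y1 ?X)\<^sup>2 \<le> (X1 ?X)\<^sup>2" using x by (metis abs_le_square_iff abs_of_nonneg)
      ultimately have "(X1 ?X)\<^sup>2 + (Y1 ?X)\<^sup>2 / 3 \<le> 4 / 3 * (P ?X)\<^sup>2" by simp
      then have "c\<^sup>2 * ((X1 ?X)\<^sup>2 + (Y1 ?X)\<^sup>2 / 3) \<le> c\<^sup>2 * (4 / 3 * (P ?X)\<^sup>2)" by (intro mult_left_mono) auto
      moreover have "c\<^sup>2 * ((X1 ?X)\<^sup>2 + (Y1 ?X)\<^sup>2 / 3) = (P ?X)\<^sup>2"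
        using fc mink_self[of ?X] pq by (simp add: future_cone_def power2_eq_square)
      ultimately have "(1 - 4 / 3 * c\<^sup>2) * (P ?X)\<^sup>2 \<le> 0" by (simp add: algebra_simps)
      then have "(P ?X)\<^sup>2 \<le> 0" using c by (simp add: mult_le_0_iff)
      then have p0: "P ?X = 0" by simp
      then have "X1 ?X = 0" "Y1 ?X = 0" using x ineq by auto
      then have "?X = 0" using expansion[of ?X] p0 pq by (simp add: point_def)
      then show False using fc by (simp add: future_cone_def)
    qed
  }
qed

lemma ideal_vertices: "ideal_vertices v = {1}"
  by (auto simp: ideal_vertices_def ideal)

lemma hyp3_P_pos: "X \<in> hyp3 \<Longrightarrow> P X > 0"
proof -
  assume "X \<in> hyp3"
  moreover have "v 1 \<in> future_cone" using ideal by simp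
  ultimately have "mink X (v 1) < 0" by (intro mink_timelike_neg) auto
  then show "P X > 0" using \<kappa> by (simp add: mink_v1 zero_less_mult_iff)
qed

lemma fst_pos_iff:
  assumes "mink X X < 0"
  shows "fst X > 0 \<longleftrightarrow> P X > 0"
proof -
  have pos: "P X > 0" if "mink X X < 0" "fst X > 0" for X
  proof -
    have "P (hyp_normalize X) > 0" using hyp_normalize_in_hyp3 hyp3_P_pos that by blast
    moreover have "P (hyp_normalize X) = P X / sqrt (- mink X X)"
      by (simp add: P_def mink_hyp_normalize diff_divide_distrib)
    ultimately show ?thesis using that by (simp add: zero_less_divide_iff)
  qed
  have "fst X \<noteq> 0"
  proof
    assume "fst X = 0"
    then show False using assms inner_ge_zero[of "snd X"] by (simp add: mink_def)
  qed
  moreover have "P X < 0" if "fst X < 0"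
    using pos[of "- X"] that assms by (simp add: mink_linear P_def)
  ultimately show ?thesis using pos[OF assms] by force
qed

lemma point_in_hyp3:
  assumes "p > 0" "p * q = 1 + c\<^sup>2 * (x\<^sup>2 + y\<^sup>2 / 3)"
  shows "point p x y q \<in> hyp3"
  using fst_pos_iff[of "point p x y q"] assms by (simp add: hyp3_def mink_point)


section \<open>Cones over the simplex and the horoball sector\<close>

lemma wedge_bound:
  assumes "0 < p" "0 \<le> x" "x \<le> p" "- \<sigma> * x \<le> y" "y \<le> x"
  shows "c\<^sup>2 * (x\<^sup>2 + y\<^sup>2 / 3) < p\<^sup>2"
proof -
  have y: "\<bar>y\<bar> \<le> x" using assms \<sigma> by auto
  have "x\<^sup>2 \<le> p\<^sup>2" using assms by (intro power_mono) auto
  moreover have "y\<^sup>2 \<le> x\<^sup>2" using y assms by (metis abs_le_square_iff abs_of_nonneg)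
  ultimately have "x\<^sup>2 + y\<^sup>2 / 3 \<le> 4 / 3 * p\<^sup>2" by simp
  then have "c\<^sup>2 * (x\<^sup>2 + y\<^sup>2 / 3) \<le> c\<^sup>2 * (4 / 3 * p\<^sup>2)" by (intro mult_left_mono) auto
  also have "\<dots> = (4 / 3 * c\<^sup>2) * p\<^sup>2" by simp
  also have "\<dots> < 1 * p\<^sup>2" using c assms(1) by (intro mult_strict_right_mono) auto
  finally show ?thesis by simp
qed

lemma wedge_nonneg: "- \<sigma> * x \<le> y \<Longrightarrow> y \<le> x \<Longrightarrow> 0 \<le> x"
  using \<sigma> by auto

lemma normalize_in_solid:
  assumes "mink X X < 0" "fst X > 0"
  shows "hyp_normalize X \<in> solid v \<longleftrightarrow>
    P X \<le> Q X \<and> X1 X \<le> P X \<and> Y1 X \<le> X1 X \<and> - \<sigma> * X1 X \<le> Y1 X"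
proof -
  have "mink (hyp_normalize X) (n i) \<le> 0 \<longleftrightarrow> mink X (n i) \<le> 0" for i
    using assms by (simp add: mink_hyp_normalize divide_le_0_iff)
  then have "hyp_normalize X \<in> solid v \<longleftrightarrow> (\<forall>i. mink X (n i) \<le> 0)"
    using hyp_normalize_in_hyp3[OF assms] by (simp add: solid_eq[OF tet])
  then show ?thesis by (simp add: forall_4 mink_n)
qed

text \<open>That vectors of \<open>region\<close> are timelike is automatic:
  \<open>wedge_bound\<close> puts the transverse part below \<open>P\<^sup>2\<close>, which is at
  most \<open>P * Q\<close>.\<close>

lemma unit_cone_solid: "unit_cone (solid v) = coords -` region \<sigma> (c\<^sup>2) 0"
proof (intro set_eqI iffI)
  fix X assume "X \<in> unit_cone (solid v)"
  then have X: "fst X > 0" "-1 < mink X X" "mink X X < 0" "hyp_normalize X \<in> solid v" by (auto simp: in_unit_cone)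
  note w = normalize_in_solid[OF X(3,1), THEN iffD1, OF X(4)]
  have p: "P X > 0" using fst_pos_iff[OF X(3)] X(1) by simp
  have "(P X)\<^sup>2 \<le> P X * Q X" using w p by (simp add: power2_eq_square)
  then show "X \<in> coords -` region \<sigma> (c\<^sup>2) 0"
    using w p X(2) wedge_nonneg[of "X1 X" "Y1 X"] by (simp add: coords_def region_def mink_self)
next
  fix X assume "X \<in> coords -` region \<sigma> (c\<^sup>2) 0"
  then have w: "0 < P X" "0 \<le> X1 X" "X1 X \<le> P X" "- \<sigma> * X1 X \<le> Y1 X" "Y1 X \<le> X1 X"
    and q: "(P X)\<^sup>2 \<le> P X * Q X" "P X * Q X < 1 + c\<^sup>2 * ((X1 X)\<^sup>2 + (Y1 X)\<^sup>2 / 3)"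
    by (auto simp: coords_def region_def)
  have m: "mink X X < 0" "-1 < mink X X" using wedge_bound[OF w] q by (auto simp: mink_self)
  then have f: "fst X > 0" using fst_pos_iff w(1) by simp
  have "P X \<le> Q X" using q(1) w(1) by (simp add: power2_eq_square)
  then show "X \<in> unit_cone (solid v)"
    using normalize_in_solid[OF m(1) f] w m f by (simp add: in_unit_cone)
qed

abbreviation "Bmax \<equiv> sublevel \<kappa> (v 1)"

lemma Bmax_iff: "X \<in> Bmax \<longleftrightarrow> X \<in> hyp3 \<and> P X \<le> 1"
  using \<kappa> by (simp add: sublevel_def mink_v1)

lemma normalize_in_Bmax:
  assumes "mink X X < 0" "fst X > 0"
  shows "hyp_normalize X \<in> Bmax \<longleftrightarrow> (P X)\<^sup>2 + c\<^sup>2 * ((X1 X)\<^sup>2 + (Y1 X)\<^sup>2 / 3) \<le> P X * Q X"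
proof -
  have p: "P X > 0" using fst_pos_iff[OF assms(1)] assms(2) by simp
  have "P (hyp_normalize X) = P X / sqrt (- mink X X)"
    by (simp add: P_def mink_hyp_normalize diff_divide_distrib)
  then have "hyp_normalize X \<in> Bmax \<longleftrightarrow> P X \<le> sqrt (- mink X X)"
    using assms hyp_normalize_in_hyp3[OF assms] by (simp add: Bmax_iff divide_le_eq)
  also have "\<dots> \<longleftrightarrow> (P X)\<^sup>2 \<le> - mink X X"
    using p real_sqrt_le_iff[of "(P X)\<^sup>2" "- mink X X"] by simp
  finally show ?thesis by (auto simp: mink_self)
qed

text \<open>Normalising divides \<open>P\<close> by the Minkowski length, so
  \<open>P \<le> 1\<close> becomes the inequality with \<open>b = c\<^sup>2\<close>, which implies
  that of facet 1.\<close>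

lemma unit_cone_Bmax: "unit_cone (Bmax \<inter> solid v) = coords -` region \<sigma> (c\<^sup>2) (c\<^sup>2)"
proof -
  have "X \<in> unit_cone (Bmax \<inter> solid v) \<longleftrightarrow> X \<in> coords -` region \<sigma> (c\<^sup>2) (c\<^sup>2)" for X
  proof -
    have 1: "X \<in> unit_cone (Bmax \<inter> solid v) \<longleftrightarrow> X \<in> unit_cone (solid v) \<and> hyp_normalize X \<in> Bmax"
      by (auto simp: in_unit_cone)
    have 2: "hyp_normalize X \<in> Bmax \<longleftrightarrow> (P X)\<^sup>2 + c\<^sup>2 * ((X1 X)\<^sup>2 + (Y1 X)\<^sup>2 / 3) \<le> P X * Q X"
      if "X \<in> unit_cone (solid v)"
      using normalize_in_Bmax that by (simp add: in_unit_cone)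
    have "0 \<le> c\<^sup>2 * ((X1 X)\<^sup>2 + (Y1 X)\<^sup>2 / 3)" by simp
    then have "(P X)\<^sup>2 \<le> P X * Q X" if "(P X)\<^sup>2 + c\<^sup>2 * ((X1 X)\<^sup>2 + (Y1 X)\<^sup>2 / 3) \<le> P X * Q X"
      using that by linarith
    then show ?thesis unfolding 1 using 2 unfolding unit_cone_solid by (auto simp: coords_def region_def)
  qed
  then show ?thesis by blast
qed

text \<open>The constant is fixed before \<open>S\<close> and \<open>b\<close>, so it cancels in the
  density. It absorbs the determinant, the factor 4 of the cone formula and
  \<open>(1 + \<sigma>) / 8\<close>.\<close>

lemma hyp_vol_region:
  obtains k where "k > 0"
    "\<And>S b. S \<in> sets borel \<Longrightarrow> 0 \<le> b \<Longrightarrow> b \<le> c\<^sup>2 \<Longrightarrow> unit_cone S = coords -` region \<sigma> (c\<^sup>2) b \<Longrightarrow>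
      emeasure hyp_measure S = ennreal (k * suminf (density_series (c\<^sup>2 - b)))"
proof -
  obtain g where g: "linear g" "g \<circ> coords = id"
    using linear_injective_left_inverse[OF linear_coords bij_is_inj[OF bij_coords]] by (elim exE conjE)
  have gc: "g (coords X) = X" for X using fun_cong[OF g(2), of X] by simp
  have cg: "coords (g w) = w" for w
  proof -
    obtain X where "w = coords X" using surjD[OF bij_is_surj[OF bij_coords]] by blast
    then show ?thesis by (simp add: gc)
  qed
  have bg: "bij g" using gc cg by (intro o_bij[of coords]) auto
  have dims: "DIM(real \<times> real \<times> real \<times> real) = CARD(4)" "DIM(mvec) = CARD(4)" by simp_all
  obtain k where k: "k > 0" "\<And>S. S \<in> sets borel \<Longrightarrow> emeasure lborel S < \<infinity> \<Longrightarrow>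
       emeasure lborel (g ` S) = ennreal (k * measure lborel S)"
    using measure_linear_bij[OF g(1) bg dims] by blast
  show ?thesis
  proof (rule that)
    show "k * (1 + \<sigma>) / 2 > 0" using k \<sigma> by auto
    fix S b assume S: "S \<in> sets borel" and b: "0 \<le> b" "b \<le> c\<^sup>2" and u: "unit_cone S = coords -` region \<sigma> (c\<^sup>2) b"
    have R: "emeasure lborel (region \<sigma> (c\<^sup>2) b) = ennreal ((1 + \<sigma>) / 8 * suminf (density_series (c\<^sup>2 - b)))"
      using emeasure_region[OF \<sigma> b c(2)] .
    have nn: "0 \<le> suminf (density_series (c\<^sup>2 - b))"
      using b c density_series_nonneg density_series_summable[of "c\<^sup>2 - b"] by (intro suminf_nonneg) auto
    have "unit_cone S = g ` region \<sigma> (c\<^sup>2) b"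
    proof (intro set_eqI)
      fix X show "X \<in> unit_cone S \<longleftrightarrow> X \<in> g ` region \<sigma> (c\<^sup>2) b"
      proof
        assume "X \<in> unit_cone S"
        then have "coords X \<in> region \<sigma> (c\<^sup>2) b" unfolding u by simp
        then show "X \<in> g ` region \<sigma> (c\<^sup>2) b" by (rule rev_image_eqI) (simp add: gc)
      next
        assume "X \<in> g ` region \<sigma> (c\<^sup>2) b"
        then show "X \<in> unit_cone S" unfolding u by (auto simp: cg)
      qed
    qed
    then have "emeasure lborel (unit_cone S) = ennreal (k * measure lborel (region \<sigma> (c\<^sup>2) b))"
      using k(2)[OF region_borel, of \<sigma> "c\<^sup>2" b] R by simp
    also have "measure lborel (region \<sigma> (c\<^sup>2) b) = (1 + \<sigma>) / 8 * suminf (density_series (c\<^sup>2 - b))"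
      using R nn \<sigma> by (intro measure_eq_emeasure_eq_ennreal) auto
    finally have "emeasure hyp_measure S = 4 * ennreal (k * ((1 + \<sigma>) / 8 * suminf (density_series (c\<^sup>2 - b))))"
      using emeasure_unit_cone[OF S] by simp
    also have "\<dots> = ennreal (4 * (k * ((1 + \<sigma>) / 8 * suminf (density_series (c\<^sup>2 - b)))))"
      by (subst ennreal_mult') auto
    also have "4 * (k * ((1 + \<sigma>) / 8 * suminf (density_series (c\<^sup>2 - b)))) = k * (1 + \<sigma>) / 2 * suminf (density_series (c\<^sup>2 - b))"
      by simp
    finally show "emeasure hyp_measure S = ennreal (k * (1 + \<sigma>) / 2 * suminf (density_series (c\<^sup>2 - b)))" .
  qed
qed

lemma solid_borel [measurable]: "solid v \<in> sets borel"
proof -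
  have "solid v = hyp3 \<inter> {x. mink x (n 1) \<le> 0 \<and> mink x (n 2) \<le> 0 \<and> mink x (n 3) \<le> 0 \<and> mink x (n 4) \<le> 0}"
    by (auto simp: solid_eq[OF tet] forall_4)
  also have "\<dots> \<in> sets borel" by measurable
  finally show ?thesis .
qed

lemma density_series_pos: "suminf (density_series (c\<^sup>2)) > 0"
  using suminf_density_series_bounds(1)[of "c\<^sup>2" 1] c by (simp add: density_series_def moment_rec)

lemma density_Bmax: "hyp_vol (Bmax \<inter> solid v) / hyp_vol (solid v) = 1 / suminf (density_series (c\<^sup>2))"
  and finite_solid: "emeasure hyp_measure (solid v) < \<infinity>"
  and solid_pos: "hyp_vol (solid v) > 0"
proof -
  obtain k where k: "k > 0" "\<And>S b. S \<in> sets borel \<Longrightarrow> 0 \<le> b \<Longrightarrow> b \<le> c\<^sup>2 \<Longrightarrow> unit_cone S = coords -` region \<sigma> (c\<^sup>2) b \<Longrightarrow>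
      emeasure hyp_measure S = ennreal (k * suminf (density_series (c\<^sup>2 - b)))"
    using hyp_vol_region by blast
  have 1: "emeasure hyp_measure (solid v) = ennreal (k * suminf (density_series (c\<^sup>2)))"
    using k(2)[OF solid_borel _ _ unit_cone_solid] by simp
  have 2: "emeasure hyp_measure (Bmax \<inter> solid v) = ennreal k"
    using k(2)[OF _ _ _ unit_cone_Bmax] by (simp add: density_series_0)
  show "emeasure hyp_measure (solid v) < \<infinity>" unfolding 1 by simp
  have s: "hyp_vol (solid v) = k * suminf (density_series (c\<^sup>2))" "hyp_vol (Bmax \<inter> solid v) = k"
    unfolding hyp_vol_def measure_def 1 2 using k(1) density_series_pos by simp_all
  then show "hyp_vol (solid v) > 0" "hyp_vol (Bmax \<inter> solid v) / hyp_vol (solid v) = 1 / suminf (density_series (c\<^sup>2))"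
    using k(1) density_series_pos by simp_all
qed


section \<open>The orbit of the tangent horoball as optimal packing\<close>

lemma refl_group_eq: "refl_group v = range wd"
proof (intro set_eqI iffI)
  fix g assume "g \<in> refl_group v"
  then show "g \<in> range wd"
  proof induction
    case id
    show ?case using wd.simps(1) by (metis rangeI)
  next
    case (step g i)
    then obtain ws where "g = wd ws" by blast
    then have "s i \<circ> g = wd (i # ws)" by simp
    then show ?case by (metis rangeI)
  qed
next
  fix g assume "g \<in> range wd"
  then obtain ws where g: "g = wd ws" by blast
  have "wd ws \<in> refl_group v"
  proof (induction ws)
    case Nil
    show ?case unfolding wd.simps by (rule refl_group.id)
  next
    case (Cons i ws)
    then show ?case unfolding wd.simps by (rule refl_group.step)
  qed
  then show "g \<in> refl_group v" by (simp add: g)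
qed

lemma Bmax_halfspace: "Bmax \<subseteq> facet_halfspace v 1"
proof
  fix x assume "x \<in> Bmax"
  then have x: "x \<in> hyp3" "P x \<le> 1" by (auto simp: Bmax_iff)
  have p: "P x > 0" using x hyp3_P_pos by simp
  have "P x * Q x = 1 + c\<^sup>2 * ((X1 x)\<^sup>2 + (Y1 x)\<^sup>2 / 3)" using x mink_self[of x] by (simp add: hyp3_def)
  moreover have "0 \<le> c\<^sup>2 * ((X1 x)\<^sup>2 + (Y1 x)\<^sup>2 / 3)" by simp
  moreover have "P x * P x \<le> 1 * 1" using x p by (intro mult_mono) auto
  ultimately have "P x * P x \<le> P x * Q x" by linarith
  then have "P x \<le> Q x" using p by simp
  then show "x \<in> facet_halfspace v 1" using x by (simp add: facet_halfspace_def mink_n)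
qed

text \<open>The witness lies on the perpendicular from the ideal vertex to facet 1, at
  \<open>P = r / \<kappa>\<close> and \<open>Q = \<kappa> / r\<close>. For
  \<open>r > \<kappa>\<close> it is beyond the facet but still in \<open>B\<close>.\<close>

lemma horoball_level_le:
  assumes "B \<subseteq> facet_halfspace v 1" "horoball_at (v 1) B"
  shows "B \<subseteq> Bmax"
proof -
  obtain r where r: "r > 0" "B = {x \<in> hyp3. - mink x (v 1) \<le> r}" using assms(2) by (auto simp: horoball_at_def)
  have "r \<le> \<kappa>"
  proof (rule ccontr)
    assume a: "\<not> r \<le> \<kappa>"
    define p where "p = r / \<kappa>"
    have p: "p > 1" using a \<kappa> by (simp add: p_def)
    let ?x = "point p 0 0 (1 / p)"
    have "?x \<in> hyp3" using p by (intro point_in_hyp3) auto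
    moreover have "- mink ?x (v 1) \<le> r" using \<kappa> by (simp add: mink_v1 p_def)
    ultimately have "mink ?x (n 1) \<le> 0" using assms(1) r(2) by (auto simp: facet_halfspace_def)
    then have "p * p \<le> 1" using p by (simp add: mink_n field_simps)
    moreover have "1 * 1 < p * p" using p by (intro mult_strict_mono) auto
    ultimately show False by simp
  qed
  then show ?thesis by (auto simp: r(2) sublevel_def)
qed

lemma mink_v1_n: "mink (v 1) (n 1) = - \<kappa>" "i \<noteq> 1 \<Longrightarrow> mink (v 1) (n i) = 0"
  using outward_normal(2)[OF tet, of 1 i] by (auto simp: \<kappa>_def mink_commute)

lemma wd_v1:
  assumes "wd ws (v 1) \<noteq> v 1"
  shows "\<exists>a. (\<forall>i. 0 \<le> a i) \<and> 2 * \<kappa> \<le> a 1 \<and> wd ws (v 1) = v 1 + (\<Sum>i\<in>UNIV. a i *\<^sub>R n i)"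
  using orbit_displacement[OF mink_v1_n(2) mink_v1_n(1) \<kappa>, of ws] assms by simp

text \<open>Pairing with \<open>v 1\<close> kills all normals but the first, so the bound on
  \<open>a 1\<close> becomes the tangency threshold of
  \<open>sublevel_interiors_disjoint\<close>.\<close>

lemma orbit_separation:
  assumes "wd ws (v 1) \<noteq> v 1"
  shows "2 * \<kappa>\<^sup>2 \<le> - mink (v 1) (wd ws (v 1))"
proof -
  obtain a where a: "\<And>i. 0 \<le> a i" "2 * \<kappa> \<le> a 1" "wd ws (v 1) = v 1 + (\<Sum>i\<in>UNIV. a i *\<^sub>R n i)"
    using wd_v1[OF assms] by blast
  have "mink (v 1) (v 1) = 0" using ideal[of 1] by (simp add: future_cone_def)
  then have "mink (v 1) (wd ws (v 1)) = (\<Sum>i\<in>UNIV. a i * mink (v 1) (n i))"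
    by (simp add: a(3) mink_add_right mink_sum_right mink_scale_right)
  also have "\<dots> = (\<Sum>i::4\<in>UNIV. if i = 1 then - (a 1 * \<kappa>) else 0)"
    by (intro sum.cong) (auto simp: mink_v1_n)
  finally have "- mink (v 1) (wd ws (v 1)) = a 1 * \<kappa>" by simp
  moreover have "2 * \<kappa> * \<kappa> \<le> a 1 * \<kappa>" using a(2) \<kappa> by (intro mult_right_mono) auto
  ultimately show ?thesis by (simp add: power2_eq_square)
qed

lemma interior_neg: "x \<in> hyp_interior (solid v) \<Longrightarrow> mink x (n i) < 0"
  by (rule hyp_interior_halfspace[OF _ _ outward_normal(1)[OF tet]]) (auto simp: solid_eq[OF tet])

text \<open>Reflecting \<open>x\<close> in facet 1 takes it out of \<open>Bmax\<close>, which
  settles the displacement \<open>2 * \<kappa>\<close> along \<open>n 1\<close> alone. Any other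
  displacement has coefficients at least as large, and since all \<open>mink x (n i)\<close> are
  negative this only moves \<open>x\<close> further out of the horoball.\<close>

lemma orbit_avoids_interior:
  assumes "x \<in> hyp_interior (solid v)" "wd ws (v 1) \<noteq> v 1"
  shows "x \<notin> sublevel \<kappa> (wd ws (v 1))"
proof -
  obtain a where a: "\<And>i. 0 \<le> a i" "2 * \<kappa> \<le> a 1" "wd ws (v 1) = v 1 + (\<Sum>i\<in>UNIV. a i *\<^sub>R n i)"
    using wd_v1[OF assms(2)] by blast
  have x: "x \<in> hyp3" using assms(1) hyp_interior_subset by (auto simp: solid_def)
  have neg: "mink x (n i) < 0" for i by (rule interior_neg[OF assms(1)])
  let ?y = "s 1 x"
  have "mink ?y (n 1) = - mink x (n 1)" by (simp add: reflection_def mink_linear unit)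
  then have "?y \<notin> Bmax" using Bmax_halfspace neg[of 1] by (auto simp: facet_halfspace_def)
  then have "- mink ?y (v 1) > \<kappa>" using s_hyp3[OF x] by (simp add: sublevel_def)
  moreover have "mink ?y (v 1) = mink x (v 1) + 2 * \<kappa> * mink x (n 1)"
    using mink_v1_n(1) by (simp add: reflection_def mink_linear mink_commute[of "n 1"])
  moreover have "mink x (wd ws (v 1)) = mink x (v 1) + (\<Sum>i\<in>UNIV. a i * mink x (n i))"
    by (simp add: a(3) mink_add_right mink_sum_right mink_scale_right)
  moreover have "(\<Sum>i\<in>UNIV. a i * mink x (n i)) \<le> (\<Sum>i::4\<in>UNIV. if i = 1 then 2 * \<kappa> * mink x (n 1) else 0)"
    using a neg by (intro sum_mono) (auto intro: mult_right_mono_neg simp: mult_nonneg_nonpos less_imp_le)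
  ultimately show ?thesis by (simp add: sublevel_def)
qed

lemma Bmax_meets_interior: "Bmax \<inter> hyp_interior (solid v) \<noteq> {}"
proof -
  \<comment> \<open>Chosen to put the point on the hyperboloid; \<open>0 < y < x < p < q\<close>
    makes all facet inequalities strict.\<close>
  define q where "q = 2 * (1 + c\<^sup>2 * ((1 / 4)\<^sup>2 + (1 / 8)\<^sup>2 / 3))"
  let ?x = "point (1 / 2) (1 / 4) (1 / 8) q"
  have h: "?x \<in> hyp3" by (rule point_in_hyp3) (auto simp: q_def)
  have "0 \<le> c\<^sup>2 * ((1 / 4)\<^sup>2 + (1 / 8)\<^sup>2 / 3)" by simp
  then have "2 * (1 + 0) \<le> q" unfolding q_def by (intro mult_left_mono add_left_mono) auto
  then have "1 / 2 < q" by simp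
  then have "mink ?x (n i) < 0" for i
    using exhaust_4[of i] \<sigma> by (auto simp: mink_n)
  then have "?x \<in> hyp_interior (solid v)"
    using h by (intro hyp_interior_I[of UNIV _ n]) (auto simp: solid_eq[OF tet] less_imp_le)
  moreover have "?x \<in> Bmax" using h by (simp add: Bmax_iff)
  ultimately show ?thesis by blast
qed

text \<open>Different words may give the same horoball, so members are told apart by their lightlike
  vectors. By invariance the product of two of them equals that of \<open>v 1\<close> with a single
  orbit element.\<close>

lemma packing_Bmax: "horoball_packing v (range (\<lambda>ws. wd ws ` Bmax)) (\<lambda>_. Bmax)"
  unfolding horoball_packing_def
proof (intro conjI ballI impI)
  have l: "v 1 \<in> future_cone" by (simp add: ideal)
  have eq: "wd ws ` Bmax = sublevel \<kappa> (wd ws (v 1))" for ws by (rule wd_sublevel)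
  show "horoball H" if "H \<in> range (\<lambda>ws. wd ws ` Bmax)" for H
  proof -
    obtain ws where "H = sublevel \<kappa> (wd ws (v 1))"
      using \<open>H \<in> range (\<lambda>ws. wd ws ` Bmax)\<close> unfolding eq by blast
    then show ?thesis unfolding horoball_def using horoball_sublevel[OF wd_future_cone[OF l] \<kappa>] by blast
  qed
  show "g ` H \<in> range (\<lambda>ws. wd ws ` Bmax)" if "g \<in> refl_group v" "H \<in> range (\<lambda>ws. wd ws ` Bmax)" for g H
  proof -
    obtain ws ws' where "g = wd ws" "H = wd ws' ` Bmax"
      using \<open>g \<in> refl_group v\<close> \<open>H \<in> range (\<lambda>ws. wd ws ` Bmax)\<close> unfolding refl_group_eq by blast
    then have "g ` H = wd (ws @ ws') ` Bmax" by (simp add: wd_append image_comp)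
    then show ?thesis by blast
  qed
  show "{H \<in> range (\<lambda>ws. wd ws ` Bmax). H \<inter> hyp_interior (solid v) \<noteq> {}} = (\<lambda>_. Bmax) ` ideal_vertices v"
  proof (intro set_eqI iffI)
    fix H assume "H \<in> {H \<in> range (\<lambda>ws. wd ws ` Bmax). H \<inter> hyp_interior (solid v) \<noteq> {}}"
    then obtain ws x where "H = sublevel \<kappa> (wd ws (v 1))" "x \<in> H" "x \<in> hyp_interior (solid v)" by (auto simp: eq)
    moreover from this have "wd ws (v 1) = v 1" using orbit_avoids_interior by blast
    ultimately have "H = Bmax" by simp
    then show "H \<in> (\<lambda>_. Bmax) ` ideal_vertices v" by (simp add: ideal_vertices)
  next
    fix H assume "H \<in> (\<lambda>_. Bmax) ` ideal_vertices v"
    then have H: "H = Bmax" by auto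
    then have "H \<in> range (\<lambda>ws. wd ws ` Bmax)" by (intro range_eqI[of _ _ "[]"]) simp
    then show "H \<in> {H \<in> range (\<lambda>ws. wd ws ` Bmax). H \<inter> hyp_interior (solid v) \<noteq> {}}"
      using Bmax_meets_interior H by blast
  qed
  show "horoball_at (v i) Bmax" if "i \<in> ideal_vertices v" for i
    using that horoball_sublevel[OF l \<kappa>] by (simp add: ideal_vertices)
  show "Bmax \<subseteq> facet_halfspace v i" if "i \<in> ideal_vertices v" for i
    using that Bmax_halfspace by (simp add: ideal_vertices)
  fix H H' assume H: "H \<in> range (\<lambda>ws. wd ws ` Bmax)" "H' \<in> range (\<lambda>ws. wd ws ` Bmax)" "H \<noteq> H'"
  then obtain ws ws' where w: "H = sublevel \<kappa> (wd ws (v 1))" "H' = sublevel \<kappa> (wd ws' (v 1))" by (auto simp: eq)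
  have m: "mink (wd ws (v 1)) (wd ws' (v 1)) = mink (v 1) (wd (rev ws @ ws') (v 1))"
    by (simp add: mink_wd_left wd_append)
  have "wd (rev ws @ ws') (v 1) \<noteq> v 1"
  proof
    assume "wd (rev ws @ ws') (v 1) = v 1"
    then have "wd ws (wd (rev ws) (wd ws' (v 1))) = wd ws (v 1)" by (simp add: wd_append)
    then show False using H(3) by (simp add: wd_rev w)
  qed
  then show "hyp_interior H \<inter> hyp_interior H' = {}"
    unfolding w using orbit_separation[of "rev ws @ ws'"] l \<kappa>
    by (intro sublevel_interiors_disjoint wd_future_cone) (auto simp: m)
qed

theorem delta_opt_eq: "delta_opt v = 1 / suminf (density_series (c\<^sup>2))"
  unfolding delta_opt_def
proof (rule cSup_eq_maximum)
  have "packing_density v (\<lambda>_. Bmax) = 1 / suminf (density_series (c\<^sup>2))"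
    by (simp add: packing_density_def ideal_vertices density_Bmax)
  then show "1 / suminf (density_series (c\<^sup>2)) \<in> {packing_density v B | \<B> B. horoball_packing v \<B> B}"
    using packing_Bmax by force
  fix \<delta> assume "\<delta> \<in> {packing_density v B | \<B> B. horoball_packing v \<B> B}"
  then obtain \<B> B where \<delta>: "\<delta> = packing_density v B" and hp: "horoball_packing v \<B> B" by blast
  have at: "horoball_at (v 1) (B 1)" "B 1 \<subseteq> facet_halfspace v 1"
    using hp by (auto simp: horoball_packing_def ideal_vertices)
  then have sub: "B 1 \<subseteq> Bmax" by (intro horoball_level_le)
  obtain r where "B 1 = sublevel r (v 1)" using at by (auto simp: horoball_at_def sublevel_def)
  then have "hyp_vol (B 1 \<inter> solid v) \<le> hyp_vol (Bmax \<inter> solid v)"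
    unfolding hyp_vol_def
  \<comment> \<open>The real-valued \<open>measure\<close> is 0 on sets of infinite measure, so
    monotonicity rests on the finite volume of the simplex.\<close>
  proof (intro measure_mono_fmeasurable)
    have "emeasure hyp_measure (Bmax \<inter> solid v) \<le> emeasure hyp_measure (solid v)"
      by (intro emeasure_mono) (auto simp: hyp_measure_def)
    then show "Bmax \<inter> solid v \<in> fmeasurable hyp_measure"
      using finite_solid by (auto simp: fmeasurable_def hyp_measure_def)
  qed (use sub in \<open>auto simp: hyp_measure_def\<close>)
  then have "hyp_vol (B 1 \<inter> solid v) / hyp_vol (solid v) \<le> hyp_vol (Bmax \<inter> solid v) / hyp_vol (solid v)"
    using solid_pos by (intro divide_right_mono) auto
  then show "\<delta> \<le> 1 / suminf (density_series (c\<^sup>2))"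
    by (simp add: \<delta> packing_density_def ideal_vertices density_Bmax)
qed

end

section \<open>Recovering the frame from the Gram matrix\<close>

lemma time_vector:
  assumes "mink w w = 1" "mink ex ex = 1" "mink ez ez = 1" "mink ex ey = 0" "mink ex ez = 0" "mink ey ez = 0"
    and "mink w ex = 1" "mink w ey = 0" "mink w ez = c" "c \<noteq> 0" "et = (1 / c) *\<^sub>R (w - ex) - ez"
  shows "mink et et = -1" "mink et ex = 0" "mink et ey = 0" "mink et ez = 0"
proof -
  have "mink ex w = 1" "mink ez w = c" "mink ez ex = 0" "mink ez ey = 0"
    using assms by (simp_all only: mink_commute)
  then show "mink et et = -1" "mink et ex = 0" "mink et ey = 0" "mink et ez = 0"
    using assms(1-10) unfolding assms(11) by (simp_all add: mink_linear)
qed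

text \<open>The diagram fixes all products of the normals, so the frame is found by solving the
  formulas of the locale for its vectors. The \<open>HP3\<close> wedge is the \<open>HV3\<close>
  wedge together with its mirror image, which is the choice of \<sigma>.\<close>

lemma coxeter_simplex_framed:
  assumes "\<Gamma> \<in> {HV3, HP3}" "coxeter_simplex \<Gamma> v"
  obtains et ex ey ez \<sigma> \<mu> where "framed_simplex v \<Gamma> et ex ey ez \<sigma> (cos (pi / 5)) \<mu>"
proof -
  have M: "\<Gamma> i j \<ge> 2" for i j using assms(1) by (auto simp: HV3_def HP3_def)
  interpret coxeter_vectors "outward_normal v" \<Gamma>
    by (rule coxeter_simplex_vectors[OF assms(2)]) (rule M)
  let ?n = "outward_normal v" and ?c = "cos (pi / 5)"
  have tet: "tetrahedron v" using assms(2) by (simp add: coxeter_simplex_def)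
  have c: "?c > 0" by (rule cos_gt_zero) auto
  have c2: "?c\<^sup>2 < 3 / 4"
  proof -
    have "?c < cos (pi / 6)" by (rule cos_monotone_0_pi) auto
    then have "?c\<^sup>2 < (cos (pi / 6))\<^sup>2" using c by (intro power_strict_mono) auto
    then show ?thesis by (simp add: cos_30 power_divide)
  qed
  have s3: "sqrt 3 * (sqrt 3 * x) = 3 * x" "sqrt 3 * sqrt 3 = 3" for x by (simp_all flip: mult.assoc)
  have n: "mink (?n i) (?n i) = 1" for i by (rule unit)
  have sym: "mink (?n 2) (?n 1) = mink (?n 1) (?n 2)" "mink (?n 3) (?n 1) = mink (?n 1) (?n 3)"
    "mink (?n 4) (?n 1) = mink (?n 1) (?n 4)" "mink (?n 3) (?n 2) = mink (?n 2) (?n 3)"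
    "mink (?n 4) (?n 2) = mink (?n 2) (?n 4)" "mink (?n 4) (?n 3) = mink (?n 3) (?n 4)"
    by (simp_all add: mink_commute)
  define ez where "ez = - ?n 1"
  show ?thesis
  proof (cases "\<Gamma> = HV3")
    case True
    have g: "mink (?n 1) (?n 2) = - ?c" "mink (?n 1) (?n 3) = 0" "mink (?n 1) (?n 4) = 0"
      "mink (?n 2) (?n 3) = - (1 / 2)" "mink (?n 2) (?n 4) = 0" "mink (?n 3) (?n 4) = - (sqrt 3 / 2)"
      by (simp_all add: angle True HV3_def doubleton_eq_iff cos_60 cos_30)
    define ey where "ey = - ?n 4"
    define ex where "ex = - sqrt 3 *\<^sub>R ?n 4 - 2 *\<^sub>R ?n 3"
    \<comment> \<open>The vector that makes \<open>?n 2 = ex + ?c *\<^sub>R (et + ez)\<close>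
      true.\<close>
    define et where "et = (1 / ?c) *\<^sub>R (?n 2 - ex) - ez"
    have "framed_simplex v \<Gamma> et ex ey ez 0 ?c (1 / sqrt 3)"
    proof
      show "mink ex ex = 1" "mink ey ey = 1" "mink ez ez = 1" "mink ex ey = 0" "mink ex ez = 0" "mink ey ez = 0"
        by (simp_all add: ex_def ey_def ez_def mink_linear n sym g s3)
      note e = this
      have r: "mink (?n 2) ex = 1" "mink (?n 2) ey = 0" "mink (?n 2) ez = ?c"
        by (simp_all add: ex_def ey_def ez_def mink_linear n sym g)
      show "mink et et = -1" "mink et ex = 0" "mink et ey = 0" "mink et ez = 0"
        using time_vector[OF n e(1,3,4,5,6) r _ et_def] c by simp_all
      have "?c *\<^sub>R (et + ez) = ?n 2 - ex" using c by (simp add: et_def)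
      then show "?n 2 = ex + ?c *\<^sub>R (et + ez)" by simp
      show "?n 1 = - ez" by (simp add: ez_def)
      show "?n 3 = - (1 / 2) *\<^sub>R ex + (sqrt 3 / 2) *\<^sub>R ey" by (simp add: ex_def ey_def scaleR_diff_right)
      show "?n 4 = - (1 / sqrt 3 * 0) *\<^sub>R ex - (1 / sqrt 3 * sqrt 3) *\<^sub>R ey" by (simp add: ey_def)
    qed (use tet c c2 in simp_all)
    then show ?thesis by (rule that)
  next
    case False
    then have HP: "\<Gamma> = HP3" using assms(1) by simp
    have g: "mink (?n 1) (?n 2) = - ?c" "mink (?n 1) (?n 3) = 0" "mink (?n 1) (?n 4) = 0"
      "mink (?n 2) (?n 3) = - (1 / 2)" "mink (?n 2) (?n 4) = - (1 / 2)" "mink (?n 3) (?n 4) = - (1 / 2)"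
      by (simp_all add: angle HP HP3_def doubleton_eq_iff cos_60)
    \<comment> \<open>Normals 3 and 4 are unit vectors with product -1/2, so their sum and
      difference are orthogonal, of squares 1 and 3.\<close>
    define ey where "ey = (1 / sqrt 3) *\<^sub>R (?n 3 - ?n 4)"
    define ex where "ex = - (?n 3 + ?n 4)"
    define et where "et = (1 / ?c) *\<^sub>R (?n 2 - ex) - ez"
    have "framed_simplex v \<Gamma> et ex ey ez 1 ?c (1 / 2)"
    proof
      show "mink ex ex = 1" "mink ey ey = 1" "mink ez ez = 1" "mink ex ey = 0" "mink ex ez = 0" "mink ey ez = 0"
        by (simp_all add: ex_def ey_def ez_def mink_linear n sym g s3)
      note e = this
      have r: "mink (?n 2) ex = 1" "mink (?n 2) ey = 0" "mink (?n 2) ez = ?c"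
        by (simp_all add: ex_def ey_def ez_def mink_linear n sym g)
      show "mink et et = -1" "mink et ex = 0" "mink et ey = 0" "mink et ez = 0"
        using time_vector[OF n e(1,3,4,5,6) r _ et_def] c by simp_all
      have "?c *\<^sub>R (et + ez) = ?n 2 - ex" using c by (simp add: et_def)
      then show "?n 2 = ex + ?c *\<^sub>R (et + ez)" by simp
      show "?n 1 = - ez" by (simp add: ez_def)
      have half: "x = (1 / 2) *\<^sub>R (x + y) + (1 / 2) *\<^sub>R (x - y)" "y = (1 / 2) *\<^sub>R (x + y) - (1 / 2) *\<^sub>R (x - y)" for x y :: mvec
        by (simp_all add: scaleR_add_right scaleR_diff_right flip: scaleR_add_left)
      have y: "(sqrt 3 / 2) *\<^sub>R ey = (1 / 2) *\<^sub>R (?n 3 - ?n 4)" "(1 / 2 * sqrt 3) *\<^sub>R ey = (1 / 2) *\<^sub>R (?n 3 - ?n 4)"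
        by (simp_all add: ey_def)
      have x: "- (1 / 2) *\<^sub>R ex = (1 / 2) *\<^sub>R (?n 3 + ?n 4)" "- (1 / 2 * 1) *\<^sub>R ex = (1 / 2) *\<^sub>R (?n 3 + ?n 4)"
        by (simp_all add: ex_def scaleR_add_right scaleR_diff_right)
      show "?n 3 = - (1 / 2) *\<^sub>R ex + (sqrt 3 / 2) *\<^sub>R ey" unfolding x y by (rule half)
      show "?n 4 = - (1 / 2 * 1) *\<^sub>R ex - (1 / 2 * sqrt 3) *\<^sub>R ey" unfolding x y by (rule half)
    qed (use tet c c2 in simp_all)
    then show ?thesis by (rule that)
  qed
qed

theorem theorem3:
  fixes \<Gamma> :: diagram and v :: "4 \<Rightarrow> mvec"
  assumes "\<Gamma> \<in> {HV3, HP3}"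
    and "coxeter_simplex \<Gamma> v"
  shows "\<bar>delta_opt v - 0.550841\<bar> < 1 / 10 ^ 6"
proof -
  obtain et ex ey ez \<sigma> \<mu> where "framed_simplex v \<Gamma> et ex ey ez \<sigma> (cos (pi / 5)) \<mu>"
    using coxeter_simplex_framed[OF assms] .
  then interpret framed_simplex v \<Gamma> et ex ey ez \<sigma> "cos (pi / 5)" \<mu> .
  show ?thesis using density_value by (simp only: delta_opt_eq)
qed

end
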